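(* Fix $p\ge1$. For each $n$ let $B_n$ be an $n\times p$ random matrix whose entries belong to the first Wiener chaos $\mathcal{W}_1$ (i.e. are centered jointly Gaussian variables in the closed linear span of the $N_i$), and let $A_n={}^tB_nB_n$. Assume that $A_n$ converges in probability to a deterministic invertible matrix $\Sigma$. Then for every $q\ge1$ there exist $N\in\mathbb{N}$ and $C>0$ such that $\mathbb{E}[\det(A_n)^{-q}]\le C$ for all $n\ge N$. In particular $A_n^{-1}\to\Sigma^{-1}$ in $L^q$ for every $q\ge1$.
   Context: $(N_i)_{i\ge1}$ is an i.i.d. standard Gaussian sequence; $\mathcal{W}_1$ is its first Wiener chaos, the $L^2$-closure of the linear span of the $N_i$. *)

theory Defs
  imports "HOL-Analysis.Analysis" "HOL-Probability.Probability"
begin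

definition first_wiener_chaos :: "'a measure \<Rightarrow> (nat \<Rightarrow> 'a \<Rightarrow> real) \<Rightarrow> ('a \<Rightarrow> real) set" where
  "first_wiener_chaos M N =
     {X. X \<in> borel_measurable M \<and> integrable M (\<lambda>\<omega>. (X \<omega>)\<^sup>2) \<and>
         (\<exists>m :: nat \<Rightarrow> nat. \<exists>c :: nat \<Rightarrow> nat \<Rightarrow> real.
            (\<lambda>k. \<integral>\<^sup>+\<omega>. ennreal ((X \<omega> - (\<Sum>i<m k. c k i * N i \<omega>))\<^sup>2) \<partial>M) \<longlonglongrightarrow> 0)}"

definition gram_matrix :: "nat \<Rightarrow> (nat \<Rightarrow> 'p \<Rightarrow> real) \<Rightarrow> real^'p^'p" where
  "gram_matrix n B = (\<chi> j k. \<Sum>i<n. B i j * B i k)"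

end

theory Submission
  imports Defs "HOL-Real_Asymp.Real_Asymp"
begin

text \<open>
  Let \<open>Y\<close> be a finite family in the first chaos, \<open>Q = \<Sum> Y\<^sub>i\<^sup>2\<close> and \<open>\<Gamma>\<close> its covariance matrix.
  Gaussian integration by parts gives
  \<open>E (Q exp (- s Q)) = tr \<Gamma> E (exp (- s Q)) - 2 s \<Sum>\<^sub>i\<^sub>j \<Gamma>\<^sub>i\<^sub>j E (Y\<^sub>i Y\<^sub>j exp (- s Q))\<close>,
  so the Laplace transform of \<open>Q\<close> decays polynomially, with an exponent governed by the ratio of
  \<open>tr \<Gamma>\<close> to the Hilbert-Schmidt norm of \<open>\<Gamma>\<close>. As \<open>Var Q\<close> is twice the square of that norm, concentration
  of \<open>Q\<close> forces fast decay. Equivalence of Gaussian moments upgrades the convergence of the Gram matrices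
  in probability to convergence of all moments; applied to \<open>Q = x \<bullet> A\<^sub>n x\<close>, this bounds
  \<open>E (exp (- x \<bullet> A\<^sub>n x))\<close> by any prescribed negative power of \<open>1 + |x|\<close> for large \<open>n\<close>. Finally the integral
  of \<open>|x|\<^sup>a exp (- x \<bullet> A x)\<close> over all \<open>x\<close>, together with a power of \<open>|A|\<close>, dominates a large negative
  power of the smallest value of \<open>v \<bullet> A v\<close> on the unit sphere, hence \<open>det A\<close> and the inverse matrix.
\<close>

section \<open>Gaussian integration by parts\<close>

text \<open>The entries of \<open>B n\<close> may be correlated in any way, across rows as well as
  columns, so the law of the Gram matrix offers no density that could be estimated near singular
  matrices. What convergence in probability does provide is that, for
  \<open>Q = x \<bullet> A\<^sub>n x\<close>, the trace of \<open>\<Gamma>\<close> stays near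
  \<open>x \<bullet> \<Sigma> x\<close> while its Hilbert-Schmidt norm tends to 0. Both scale like
  the square of \<open>|x|\<close>, so the threshold in n can be chosen uniformly in x; it depends
  on the wanted exponent. Positivity of \<Sigma> is not among the assumptions: it is inherited from
  Gram matrices close to \<Sigma>. The differential inequality for the Laplace transform is kept as
  an inequality between two points, because that form survives the passage from finite combinations
  to L2 limits. A bound for each fixed x does not control the smallest value over a sphere;
  integrating over x does, since Tonelli needs only the bound at fixed x, and no net on the sphere
  enters. For the L^q convergence, Young's inequality separates a power of the inverse coercivity,
  whose mean is bounded, from a power of \<open>|A\<^sub>n - \<Sigma>|\<close>, whose mean
  vanishes.\<close>

lemma gaussian_integration_by_parts_line:
  fixes q :: "real \<Rightarrow> real"
  assumes s: "s \<ge> 0" and q0: "\<And>y. q y \<ge> 0"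
    and dq: "\<And>y. (q has_real_derivative 2 * (a * y + b)) (at y)"
  shows "(\<integral>y. (y * (\<alpha> * y + \<beta>) - \<alpha> + 2 * s * (\<alpha> * y + \<beta>) * (a * y + b)) * exp (- s * q y)
            \<partial>std_normal_distribution) = 0"
proof -
  let ?\<phi> = std_normal_density
  \<comment> \<open>The product rule and \<phi>'(y) = - y \<phi>(y) make \<open>f\<close> the
    derivative of \<open>F\<close>, so the integral over the line is a difference of boundary
    values, both 0.\<close>
  define F where "F y = - ((\<alpha> * y + \<beta>) * exp (- s * q y) * ?\<phi> y)" for y
  define f where "f y = ?\<phi> y * ((y * (\<alpha> * y + \<beta>) - \<alpha> + 2 * s * (\<alpha> * y + \<beta>) * (a * y + b)) * exp (- s * q y))" for y
  have e1: "exp (- s * q y) \<le> 1" for y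
    using s q0[of y] by simp
  have qcont: "continuous_on UNIV q"
    by (intro continuous_at_imp_continuous_on ballI DERIV_isCont[OF dq])
  then have [measurable]: "q \<in> borel_measurable borel"
    by (rule borel_measurable_continuous_onI)
  have qC: "isCont q y" for y
    using qcont by (simp add: continuous_on_eq_continuous_at)
  have d\<phi>: "(?\<phi> has_real_derivative - y * ?\<phi> y) (at y)" for y
    unfolding std_normal_density_def
    by (auto intro!: derivative_eq_intros simp: field_simps)
  have dF: "(F has_vector_derivative f y) (at y)" for y
    unfolding F_def f_def has_real_derivative_iff_has_vector_derivative[symmetric]
    by (auto intro!: derivative_eq_intros dq d\<phi>) (simp add: algebra_simps)
  have \<phi>C: "isCont ?\<phi> y" for y
    using d\<phi> DERIV_isCont by blast
  have fC: "isCont f y" for y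
    unfolding f_def by (intro continuous_intros qC \<phi>C)
  have int: "integrable lborel f"
  proof -
    \<comment> \<open>Coefficients of the polynomial factor of \<open>f\<close>. As the exponential
      is at most 1, absolute Gaussian moments up to order 2 dominate \<open>f\<close>.\<close>
    define c0 where "c0 = - \<alpha> + 2 * s * \<beta> * b"
    define c1 where "c1 = \<beta> + 2 * s * (\<alpha> * b + \<beta> * a)"
    define c2 where "c2 = \<alpha> + 2 * s * \<alpha> * a"
    have "integrable lborel (\<lambda>y. \<bar>c0\<bar> * (?\<phi> y * \<bar>y\<bar> ^ 0) + \<bar>c1\<bar> * (?\<phi> y * \<bar>y\<bar> ^ 1) + \<bar>c2\<bar> * (?\<phi> y * \<bar>y\<bar> ^ 2))"
      by (intro Bochner_Integration.integrable_add integrable_mult_right integrable_std_normal_moment_abs)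
    then show ?thesis
    proof (rule Bochner_Integration.integrable_bound)
      show "AE y in lborel. norm (f y) \<le> norm (\<bar>c0\<bar> * (?\<phi> y * \<bar>y\<bar> ^ 0) + \<bar>c1\<bar> * (?\<phi> y * \<bar>y\<bar> ^ 1) + \<bar>c2\<bar> * (?\<phi> y * \<bar>y\<bar> ^ 2))"
      proof (rule AE_I2)
        fix y
        have "y * (\<alpha> * y + \<beta>) - \<alpha> + 2 * s * (\<alpha> * y + \<beta>) * (a * y + b) = c0 + c1 * y + c2 * y\<^sup>2"
          by (simp add: c0_def c1_def c2_def algebra_simps power2_eq_square)
        then have "norm (f y) = ?\<phi> y * (\<bar>c0 + c1 * y + c2 * y\<^sup>2\<bar> * exp (- s * q y))"
          by (simp add: f_def abs_mult)
        also have "\<dots> \<le> ?\<phi> y * (\<bar>c0 + c1 * y + c2 * y\<^sup>2\<bar> * 1)"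
          using e1[of y] by (intro mult_left_mono) auto
        also have "\<dots> \<le> ?\<phi> y * (\<bar>c0\<bar> + \<bar>c1\<bar> * \<bar>y\<bar> + \<bar>c2\<bar> * \<bar>y\<bar>\<^sup>2)"
          using abs_triangle_ineq[of "c0 + c1 * y" "c2 * y\<^sup>2"] abs_triangle_ineq[of c0 "c1 * y"]
          by (intro mult_left_mono) (auto simp: abs_mult)
        finally show "norm (f y) \<le> norm (\<bar>c0\<bar> * (?\<phi> y * \<bar>y\<bar> ^ 0) + \<bar>c1\<bar> * (?\<phi> y * \<bar>y\<bar> ^ 1) + \<bar>c2\<bar> * (?\<phi> y * \<bar>y\<bar> ^ 2))"
          by (simp add: algebra_simps)
      qed
    qed (unfold f_def, measurable)
  qed
  have "((\<lambda>y::real. \<bar>y\<bar> * exp (- y\<^sup>2 / 2)) \<longlongrightarrow> 0) at_top" "((\<lambda>y::real. exp (- y\<^sup>2 / 2)) \<longlongrightarrow> 0) at_top"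
    "((\<lambda>y::real. \<bar>y\<bar> * exp (- y\<^sup>2 / 2)) \<longlongrightarrow> 0) at_bot" "((\<lambda>y::real. exp (- y\<^sup>2 / 2)) \<longlongrightarrow> 0) at_bot"
    by real_asymp+
  then have "((\<lambda>y. \<bar>\<alpha>\<bar> / sqrt (2 * pi) * (\<bar>y\<bar> * exp (- y\<^sup>2 / 2)) + \<bar>\<beta>\<bar> / sqrt (2 * pi) * exp (- y\<^sup>2 / 2))
      \<longlongrightarrow> \<bar>\<alpha>\<bar> / sqrt (2 * pi) * 0 + \<bar>\<beta>\<bar> / sqrt (2 * pi) * 0) at_top"
    "((\<lambda>y. \<bar>\<alpha>\<bar> / sqrt (2 * pi) * (\<bar>y\<bar> * exp (- y\<^sup>2 / 2)) + \<bar>\<beta>\<bar> / sqrt (2 * pi) * exp (- y\<^sup>2 / 2))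
      \<longlongrightarrow> \<bar>\<alpha>\<bar> / sqrt (2 * pi) * 0 + \<bar>\<beta>\<bar> / sqrt (2 * pi) * 0) at_bot"
    by - (intro tendsto_add tendsto_mult_left; assumption)+
  then have lim0: "((\<lambda>y. (\<bar>\<alpha>\<bar> * \<bar>y\<bar> + \<bar>\<beta>\<bar>) * ?\<phi> y) \<longlongrightarrow> 0) at_top"
    "((\<lambda>y. (\<bar>\<alpha>\<bar> * \<bar>y\<bar> + \<bar>\<beta>\<bar>) * ?\<phi> y) \<longlongrightarrow> 0) at_bot"
    by (simp_all add: std_normal_density_def algebra_simps add_divide_distrib)
  have bF: "\<forall>\<^sub>F y in A. norm (F y) \<le> (\<bar>\<alpha>\<bar> * \<bar>y\<bar> + \<bar>\<beta>\<bar>) * ?\<phi> y" for A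
  proof (rule always_eventually, rule allI)
    fix y
    have "norm (F y) = \<bar>\<alpha> * y + \<beta>\<bar> * ?\<phi> y * exp (- s * q y)"
      by (simp add: F_def abs_mult)
    also have "\<dots> \<le> (\<bar>\<alpha>\<bar> * \<bar>y\<bar> + \<bar>\<beta>\<bar>) * ?\<phi> y * 1"
      using e1[of y] abs_triangle_ineq[of "\<alpha> * y" \<beta>]
      by (intro mult_mono mult_right_mono mult_nonneg_nonneg) (auto simp: abs_mult)
    finally show "norm (F y) \<le> (\<bar>\<alpha>\<bar> * \<bar>y\<bar> + \<bar>\<beta>\<bar>) * ?\<phi> y" by simp
  qed
  have "(LBINT y=-\<infinity>..\<infinity>. f y) = 0 - 0"
  proof (rule interval_integral_FTC_integrable)
    show "set_integrable lborel (einterval (- \<infinity>) \<infinity>) f"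
      using int by (simp add: set_integrable_def)
    show "((F \<circ> real_of_ereal) \<longlongrightarrow> 0) (at_right (- \<infinity>))"
      by (simp add: ereal_tendsto_simps Lim_null_comparison[OF bF lim0(2)])
    show "((F \<circ> real_of_ereal) \<longlongrightarrow> 0) (at_left \<infinity>)"
      by (simp add: ereal_tendsto_simps Lim_null_comparison[OF bF lim0(1)])
  qed (use dF fC in auto)
  then have "(\<integral>y. f y \<partial>lborel) = 0"
    by (simp add: interval_lebesgue_integral_def set_lebesgue_integral_def)
  then show ?thesis
    unfolding f_def by (subst integral_density) auto
qed

locale gaussian_sequence = prob_space M for M :: "'a measure" +
  fixes N :: "nat \<Rightarrow> 'a \<Rightarrow> real"
  assumes indep: "indep_vars (\<lambda>_. borel) N UNIV"
    and std: "\<And>i. distributed M lborel (N i) std_normal_density"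
begin

lemma N_measurable [measurable]: "N i \<in> borel_measurable M"
  using distributed_measurable[OF std[of i]] by simp

lemma distr_N: "distr M borel (N i) = std_normal_distribution"
  using distributed_distr_eq_density[OF std[of i]] by (metis distr_cong sets_lborel)

lemma integrable_N_power: "integrable M (\<lambda>\<omega>. N i \<omega> ^ k)"
proof -
  have "integrable (distr M borel (N i)) (\<lambda>x. x ^ k)"
    unfolding distr_N by (subst integrable_density) (auto simp: integrable_std_normal_moment)
  then show ?thesis
    by (subst (asm) integrable_distr_eq) auto
qed

definition gauss_span :: "('a \<Rightarrow> real) set" where
  "gauss_span = {Z. \<exists>m c. Z = (\<lambda>\<omega>. \<Sum>i<m. c i * N i \<omega>)}"

lemma gaussian_integration_by_parts:
  fixes c :: "nat \<Rightarrow> nat \<Rightarrow> real" and m d :: nat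
  defines "Y \<equiv> \<lambda>i \<omega>. \<Sum>l<m. c i l * N l \<omega>"
  assumes s: "s \<ge> 0" and l: "l < m"
  shows "expectation (\<lambda>\<omega>. (N l \<omega> * Y i \<omega> - c i l + 2 * s * Y i \<omega> * (\<Sum>j<d. c j l * Y j \<omega>))
            * exp (- s * (\<Sum>j<d. (Y j \<omega>)\<^sup>2))) = 0"
proof -
  define P where "P = (\<lambda>_::nat. std_normal_distribution)"
  interpret P: product_prob_space P
    unfolding P_def product_prob_space_def product_prob_space_axioms_def product_sigma_finite_def
    using prob_space_normal_density[of 1 0] by (auto intro!: prob_space_imp_sigma_finite)
  define Z where "Z = (\<lambda>i x. \<Sum>l<m. c i l * x l :: real)"
  define f where "f = (\<lambda>x. (x l * Z i x - c i l + 2 * s * Z i x * (\<Sum>j<d. c j l * Z j x))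
            * exp (- s * (\<Sum>j<d. (Z j x)\<^sup>2)))"
  let ?X = "\<lambda>\<omega>. \<lambda>i\<in>{..<m}. N i \<omega>"
  have D: "distr M (Pi\<^sub>M {..<m} (\<lambda>_. borel)) ?X = Pi\<^sub>M {..<m} P"
    using indep_vars_iff_distr_eq_PiM[where I = "{..<m}" and M' = "\<lambda>_. borel" and X = N] l
      indep_vars_subset[OF indep, of "{..<m}"]
    by (auto simp: P_def distr_N)
  have [measurable]: "(\<lambda>x. x k) \<in> borel_measurable (Pi\<^sub>M {..<m} (\<lambda>_. borel))" if "k \<in> {..<m}" for k
    using that by (rule measurable_component_singleton)
  have [measurable]: "Z j \<in> borel_measurable (Pi\<^sub>M {..<m} (\<lambda>_. borel))" for j
    unfolding Z_def by measurable
  have [measurable]: "(\<lambda>x. x l) \<in> borel_measurable (Pi\<^sub>M {..<m} (\<lambda>_. borel))"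
    using l by auto
  have [measurable]: "f \<in> borel_measurable (Pi\<^sub>M {..<m} (\<lambda>_. borel))"
    unfolding f_def by measurable
  have "expectation (\<lambda>\<omega>. f (?X \<omega>)) = integral\<^sup>L (Pi\<^sub>M {..<m} P) f"
    by (subst D[symmetric], subst integral_distr) auto
  also have "\<dots> = 0"
  \<comment> \<open>Fubini needs integrability. In the other case the Bochner integral is 0 by
    convention, which is again the claim.\<close>
  proof (cases "integrable (Pi\<^sub>M {..<m} P) f")
    case True
    have ins: "{..<m} = insert l ({..<m} - {l})" using l by auto
    have "(\<integral>y. f (x(l := y)) \<partial>P l) = 0" for x
    proof -
      \<comment> \<open>\<open>r j\<close> is the part of \<open>Z j\<close> free of coordinate
        \<open>l\<close>; below, \<open>2 * (a * y + b)\<close> is the derivative of the sum of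
        squares \<open>q\<close>.\<close>
      define r where "r = (\<lambda>j. \<Sum>k\<in>{..<m} - {l}. c j k * x k)"
      have Zy: "Z j (x(l := y)) = c j l * y + r j" for j y
      proof -
        have "Z j (x(l := y)) = c j l * y + (\<Sum>k\<in>{..<m} - {l}. c j k * (x(l := y)) k)"
          unfolding Z_def by (subst ins, subst sum.insert) auto
        also have "(\<Sum>k\<in>{..<m} - {l}. c j k * (x(l := y)) k) = r j"
          unfolding r_def by (intro sum.cong) auto
        finally show ?thesis .
      qed
      define q where "q = (\<lambda>y. \<Sum>j<d. (c j l * y + r j)\<^sup>2)"
      define a where "a = (\<Sum>j<d. c j l * c j l)"
      define b where "b = (\<Sum>j<d. c j l * r j)"
      have dq: "(q has_real_derivative 2 * (a * y + b)) (at y)" for y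
        unfolding q_def a_def b_def
        by (auto intro!: derivative_eq_intros sum.cong
              simp: sum_distrib_left sum_distrib_right sum.distrib[symmetric] algebra_simps)
      have "(\<Sum>j<d. c j l * (c j l * y + r j)) = a * y + b" for y
        by (simp add: a_def b_def sum.distrib sum_distrib_left sum_distrib_right algebra_simps)
      then have fy: "f (x(l := y)) = (y * (c i l * y + r i) - c i l + 2 * s * (c i l * y + r i) * (a * y + b))
            * exp (- s * q y)" for y
        by (simp add: f_def Zy q_def)
      show ?thesis
        unfolding fy P_def
        by (rule gaussian_integration_by_parts_line[OF s _ dq]) (simp add: q_def sum_nonneg)
    qed
    then show ?thesis
      using P.product_integral_insert[of "{..<m} - {l}" l f] True ins by simp
  qed (simp add: not_integrable_integral_eq)
  also have "(\<lambda>\<omega>. f (?X \<omega>)) = (\<lambda>\<omega>. (N l \<omega> * Y i \<omega> - c i l + 2 * s * Y i \<omega> * (\<Sum>j<d. c j l * Y j \<omega>))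
            * exp (- s * (\<Sum>j<d. (Y j \<omega>)\<^sup>2)))"
    using l by (auto simp: f_def Y_def Z_def intro!: ext)
  finally show ?thesis .
qed

end

section \<open>Decrease of the Laplace transform for finite linear combinations\<close>

lemma (in prob_space) integrable_mult_of_squares:
  fixes X Y :: "'a \<Rightarrow> real"
  assumes [measurable]: "X \<in> borel_measurable M" "Y \<in> borel_measurable M"
    and "integrable M (\<lambda>\<omega>. (X \<omega>)\<^sup>2)" "integrable M (\<lambda>\<omega>. (Y \<omega>)\<^sup>2)"
  shows "integrable M (\<lambda>\<omega>. X \<omega> * Y \<omega>)"
proof (rule Bochner_Integration.integrable_bound)
  show "integrable M (\<lambda>\<omega>. (X \<omega>)\<^sup>2 + (Y \<omega>)\<^sup>2)"
    using assms by simp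
  have "\<bar>a * b\<bar> \<le> \<bar>a\<^sup>2 + b\<^sup>2\<bar>" for a b :: real
    using sum_squares_bound[of "\<bar>a\<bar>" "\<bar>b\<bar>"] abs_ge_zero[of "a * b"]
    unfolding abs_mult power2_abs by linarith
  then show "AE \<omega> in M. norm (X \<omega> * Y \<omega>) \<le> norm ((X \<omega>)\<^sup>2 + (Y \<omega>)\<^sup>2)"
    by simp
qed simp

lemma (in prob_space) integrable_sum_of_squares:
  fixes X Y :: "'a \<Rightarrow> real"
  assumes [measurable]: "X \<in> borel_measurable M" "Y \<in> borel_measurable M"
    and "integrable M (\<lambda>\<omega>. (X \<omega>)\<^sup>2)" "integrable M (\<lambda>\<omega>. (Y \<omega>)\<^sup>2)"
  shows "integrable M (\<lambda>\<omega>. (X \<omega> + Y \<omega>)\<^sup>2)"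
  unfolding power2_sum using assms integrable_mult_of_squares[OF assms]
  by (auto simp: mult.assoc)

lemma (in prob_space) integrable_mult_exp_neg:
  fixes X Q :: "'a \<Rightarrow> real"
  assumes X: "integrable M X" and [measurable]: "Q \<in> borel_measurable M"
    and Q: "\<And>\<omega>. Q \<omega> \<ge> 0" and s: "s \<ge> 0"
  shows "integrable M (\<lambda>\<omega>. X \<omega> * exp (- s * Q \<omega>))"
proof (rule Bochner_Integration.integrable_bound[OF X])
  show "(\<lambda>\<omega>. X \<omega> * exp (- s * Q \<omega>)) \<in> borel_measurable M"
    using X by measurable
  have "exp (- s * Q \<omega>) \<le> 1" for \<omega> using Q s by simp
  then show "AE \<omega> in M. norm (X \<omega> * exp (- s * Q \<omega>)) \<le> norm (X \<omega>)"
    by (auto simp: abs_mult mult_left_le)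
qed

text \<open>The form pairs \<open>G\<close> with the rank-one matrix \<open>y i * y j\<close>, whose
  Hilbert-Schmidt norm is the sum of the squares of \<open>y\<close>. This norm is chosen over the
  operator norm because the variance of the quadratic form computes it exactly.\<close>

lemma quadratic_form_le_hilbert_schmidt:
  fixes G :: "nat \<Rightarrow> nat \<Rightarrow> real" and y :: "nat \<Rightarrow> real"
  shows "(\<Sum>i<d. \<Sum>j<d. G i j * (y i * y j)) \<le> sqrt (\<Sum>i<d. \<Sum>j<d. (G i j)\<^sup>2) * (\<Sum>i<d. (y i)\<^sup>2)"
proof -
  let ?I = "{..<d} \<times> {..<d}"
  have "(\<Sum>(i,j)\<in>?I. G i j * (y i * y j))\<^sup>2 \<le> (\<Sum>(i,j)\<in>?I. (G i j)\<^sup>2) * (\<Sum>(i,j)\<in>?I. (y i * y j)\<^sup>2)"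
    using Cauchy_Schwarz_ineq_sum[of "\<lambda>(i,j). G i j" "\<lambda>(i,j). y i * y j" ?I]
    by (simp add: case_prod_unfold)
  also have "(\<Sum>(i,j)\<in>?I. (y i * y j)\<^sup>2) = (\<Sum>i<d. (y i)\<^sup>2)\<^sup>2"
    by (simp add: sum.cartesian_product[symmetric] power_mult_distrib sum_product power2_eq_square[of "sum _ _"])
  finally have "(\<Sum>i<d. \<Sum>j<d. G i j * (y i * y j))\<^sup>2 \<le> (\<Sum>i<d. \<Sum>j<d. (G i j)\<^sup>2) * (\<Sum>i<d. (y i)\<^sup>2)\<^sup>2"
    by (simp add: sum.cartesian_product)
  then have "\<bar>\<Sum>i<d. \<Sum>j<d. G i j * (y i * y j)\<bar> \<le> sqrt ((\<Sum>i<d. \<Sum>j<d. (G i j)\<^sup>2) * (\<Sum>i<d. (y i)\<^sup>2)\<^sup>2)"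
    unfolding real_sqrt_abs[symmetric] by (rule real_sqrt_le_mono)
  also have "\<dots> = sqrt (\<Sum>i<d. \<Sum>j<d. (G i j)\<^sup>2) * (\<Sum>i<d. (y i)\<^sup>2)"
    by (simp add: real_sqrt_mult sum_nonneg)
  finally show ?thesis by simp
qed

context gaussian_sequence
begin

lemma gauss_span_measurable [measurable_dest]: "Z \<in> gauss_span \<Longrightarrow> Z \<in> borel_measurable M"
  by (auto simp: gauss_span_def)

text \<open>Integration by parts is stated for one coefficient array with a common length. Shorter
  combinations are padded with zeros up to the sum of all lengths.\<close>

lemma gauss_span_common:
  fixes d :: nat
  assumes "\<And>i. i < d \<Longrightarrow> Y i \<in> gauss_span"
  obtains m c where "\<And>i. i < d \<Longrightarrow> Y i = (\<lambda>\<omega>. \<Sum>l<m. c i l * N l \<omega>)"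
proof -
  have "\<forall>i. \<exists>m c. i < d \<longrightarrow> Y i = (\<lambda>\<omega>. \<Sum>l<m. c l * N l \<omega>)"
    using assms by (auto simp: gauss_span_def)
  then obtain m c where mc: "\<And>i. i < d \<Longrightarrow> Y i = (\<lambda>\<omega>. \<Sum>l<m i. c i l * N l \<omega>)"
    by metis
  define m' where "m' = (\<Sum>i<d. m i)"
  define c' where "c' i l = (if l < m i then c i l else 0)" for i l
  show thesis
  proof (rule that[of c' m'])
    fix i assume i: "i < d"
    then have "m i \<le> m'"
      unfolding m'_def by (intro member_le_sum) auto
    then have "(\<Sum>l<m i. c i l * N l \<omega>) = (\<Sum>l<m'. c' i l * N l \<omega>)" for \<omega>
      by (intro sum.mono_neutral_cong_left) (auto simp: c'_def)
    then show "Y i = (\<lambda>\<omega>. \<Sum>l<m'. c' i l * N l \<omega>)"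
      using mc[OF i] by auto
  qed
qed

lemma integrable_sum_N_square: "integrable M (\<lambda>\<omega>. (\<Sum>l<m. c l * N l \<omega>)\<^sup>2)"
proof (induction m)
  case (Suc m)
  have "integrable M (\<lambda>\<omega>. (c m * N m \<omega>)\<^sup>2)"
    using integrable_N_power[of m 2] by (simp add: power_mult_distrib)
  with Suc show ?case
    by (auto intro!: integrable_sum_of_squares)
qed simp

lemma gauss_span_square_integrable: "Z \<in> gauss_span \<Longrightarrow> integrable M (\<lambda>\<omega>. (Z \<omega>)\<^sup>2)"
  by (auto simp: gauss_span_def integrable_sum_N_square)

text \<open>Expand \<open>Y k\<close> in the \<open>N l\<close>, integrate by parts in each
  \<open>N l\<close>, and resum: the sums over \<open>l\<close> reassemble into covariances. For
  \<open>i = k\<close>, summed over \<open>i < d\<close>, the left side is minus the derivative in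
  \<open>s\<close> of the Laplace transform.\<close>

lemma laplace_derivative_identity:
  fixes c :: "nat \<Rightarrow> nat \<Rightarrow> real" and m d :: nat and s :: real
  defines "Y \<equiv> \<lambda>i \<omega>. \<Sum>l<m. c i l * N l \<omega>"
  defines "W \<equiv> \<lambda>\<omega>. exp (- s * (\<Sum>j<d. (Y j \<omega>)\<^sup>2))"
  assumes s: "s \<ge> 0"
  shows "expectation (\<lambda>\<omega>. Y i \<omega> * Y k \<omega> * W \<omega>) = (\<Sum>l<m. c i l * c k l) * expectation W
     - 2 * s * (\<Sum>j<d. (\<Sum>l<m. c k l * c j l) * expectation (\<lambda>\<omega>. Y i \<omega> * Y j \<omega> * W \<omega>))"
proof -
  have [measurable]: "Y j \<in> borel_measurable M" for j
    unfolding Y_def by simp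
  have Yk: "Y k \<omega> = (\<Sum>l<m. c k l * N l \<omega>)" for \<omega>
    by (simp add: Y_def)
  have sq: "integrable M (\<lambda>\<omega>. (Y j \<omega>)\<^sup>2)" for j
    unfolding Y_def by (rule integrable_sum_N_square)
  have iW: "integrable M (\<lambda>\<omega>. X \<omega> * W \<omega>)" if "integrable M X" for X
    unfolding W_def by (rule integrable_mult_exp_neg) (use that s in \<open>auto simp: sum_nonneg\<close>)
  have i1: "integrable M (\<lambda>\<omega>. Y i \<omega> * Y j \<omega> * W \<omega>)" for j
    by (intro iW integrable_mult_of_squares sq) auto
  have i2: "integrable M (\<lambda>\<omega>. N l \<omega> * Y i \<omega> * W \<omega>)" for l
    by (intro iW integrable_mult_of_squares sq integrable_N_power) auto
  have i3: "integrable M W"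
    using iW[of "\<lambda>_. 1"] by simp
  have eq: "expectation (\<lambda>\<omega>. N l \<omega> * Y i \<omega> * W \<omega>) = c i l * expectation W
      - 2 * s * (\<Sum>j<d. c j l * expectation (\<lambda>\<omega>. Y i \<omega> * Y j \<omega> * W \<omega>))" if l: "l < m" for l
  proof -
    have "0 = expectation (\<lambda>\<omega>. (N l \<omega> * Y i \<omega> - c i l + 2 * s * Y i \<omega> * (\<Sum>j<d. c j l * Y j \<omega>)) * W \<omega>)"
      unfolding W_def Y_def using gaussian_integration_by_parts[OF s l] by simp
    also have "\<dots> = expectation (\<lambda>\<omega>. N l \<omega> * Y i \<omega> * W \<omega> - c i l * W \<omega>
        + 2 * s * (\<Sum>j<d. c j l * (Y i \<omega> * Y j \<omega> * W \<omega>)))"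
      by (intro Bochner_Integration.integral_cong refl)
        (simp add: algebra_simps sum_distrib_left sum_distrib_right)
    also have "\<dots> = expectation (\<lambda>\<omega>. N l \<omega> * Y i \<omega> * W \<omega>) - c i l * expectation W
        + 2 * s * (\<Sum>j<d. c j l * expectation (\<lambda>\<omega>. Y i \<omega> * Y j \<omega> * W \<omega>))"
      using i1 i2 i3 by (subst Bochner_Integration.integral_add | subst Bochner_Integration.integral_diff
          | subst Bochner_Integration.integral_sum | simp)+
    finally show ?thesis by simp
  qed
  have "expectation (\<lambda>\<omega>. Y i \<omega> * Y k \<omega> * W \<omega>) = expectation (\<lambda>\<omega>. \<Sum>l<m. c k l * (N l \<omega> * Y i \<omega> * W \<omega>))"
    by (intro Bochner_Integration.integral_cong refl, subst Yk)
      (simp add: algebra_simps sum_distrib_left sum_distrib_right)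
  also have "\<dots> = (\<Sum>l<m. c k l * expectation (\<lambda>\<omega>. N l \<omega> * Y i \<omega> * W \<omega>))"
    using i2 by simp
  also have "\<dots> = (\<Sum>l<m. c k l * (c i l * expectation W
      - 2 * s * (\<Sum>j<d. c j l * expectation (\<lambda>\<omega>. Y i \<omega> * Y j \<omega> * W \<omega>))))"
    using eq by (intro sum.cong) auto
  also have "\<dots> = (\<Sum>l<m. c i l * c k l) * expectation W
      - 2 * s * (\<Sum>l<m. \<Sum>j<d. c k l * c j l * expectation (\<lambda>\<omega>. Y i \<omega> * Y j \<omega> * W \<omega>))"
    by (simp add: right_diff_distrib sum_subtractf sum_distrib_left sum_distrib_right mult_ac)
  also have "(\<Sum>l<m. \<Sum>j<d. c k l * c j l * expectation (\<lambda>\<omega>. Y i \<omega> * Y j \<omega> * W \<omega>))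
     = (\<Sum>j<d. (\<Sum>l<m. c k l * c j l) * expectation (\<lambda>\<omega>. Y i \<omega> * Y j \<omega> * W \<omega>))"
    by (subst sum.swap) (simp add: sum_distrib_right)
  finally show ?thesis .
qed

text \<open>At \<open>s = 0\<close> the exponential weight is 1 and the correction term
  disappears.\<close>

lemma covariance_gauss_span:
  fixes c :: "nat \<Rightarrow> nat \<Rightarrow> real"
  shows
  "expectation (\<lambda>\<omega>. (\<Sum>l<m. c i l * N l \<omega>) * (\<Sum>l<m. c j l * N l \<omega>)) = (\<Sum>l<m. c i l * c j l)"
  using laplace_derivative_identity[where s = 0 and m = m and c = c and i = i and k = j and d = 0] by (simp add: prob_space)

definition hs_covariance :: "nat \<Rightarrow> (nat \<Rightarrow> 'a \<Rightarrow> real) \<Rightarrow> real" where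
  "hs_covariance d Y = sqrt (\<Sum>i<d. \<Sum>j<d. (expectation (\<lambda>\<omega>. Y i \<omega> * Y j \<omega>))\<^sup>2)"

definition quad_laplace :: "nat \<Rightarrow> (nat \<Rightarrow> 'a \<Rightarrow> real) \<Rightarrow> real \<Rightarrow> real" where
  "quad_laplace d Y s = expectation (\<lambda>\<omega>. exp (- s * (\<Sum>i<d. (Y i \<omega>)\<^sup>2)))"

lemma hs_covariance_nonneg: "hs_covariance d Y \<ge> 0"
  by (simp add: hs_covariance_def sum_nonneg)

lemma quad_laplace_nonneg: "quad_laplace d Y s \<ge> 0"
  by (simp add: quad_laplace_def)

text \<open>Write g for the Laplace transform, h for the Hilbert-Schmidt norm and tr for the trace.
  Integration by parts yields tr g(t) \<le> - (1 + 2 t h) g'(t), and convexity of the exponential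
  turns this bound on the slope at t into a comparison of g(t) with g(s).\<close>

lemma quad_laplace_decrease_span:
  fixes d :: nat
  assumes Y: "\<And>i. i < d \<Longrightarrow> Y i \<in> gauss_span" and s: "0 \<le> s" "s \<le> t"
  shows "quad_laplace d Y t * (1 + (t - s) * (\<Sum>i<d. expectation (\<lambda>\<omega>. (Y i \<omega>)\<^sup>2)) / (1 + 2 * t * hs_covariance d Y))
         \<le> quad_laplace d Y s"
proof -
  obtain m c where c: "\<And>i. i < d \<Longrightarrow> Y i = (\<lambda>\<omega>. \<Sum>l<m. c i l * N l \<omega>)"
    by (rule gauss_span_common[where Y = Y and d = d]) (use Y in auto)
  define Q where "Q \<omega> = (\<Sum>i<d. (Y i \<omega>)\<^sup>2)" for \<omega>
  define W where "W \<omega> = exp (- t * Q \<omega>)" for \<omega>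
  define \<Gamma> where "\<Gamma> i j = expectation (\<lambda>\<omega>. Y i \<omega> * Y j \<omega>)" for i j
  define h where "h = hs_covariance d Y"
  define tr where "tr = (\<Sum>i<d. expectation (\<lambda>\<omega>. (Y i \<omega>)\<^sup>2))"
  have h0: "h \<ge> 0" by (simp add: h_def hs_covariance_nonneg)
  have t0: "t \<ge> 0" using s by simp
  have Ym [measurable]: "Y i \<in> borel_measurable M" if "i < d" for i
    using Y[OF that] by measurable
  have [measurable]: "Q \<in> borel_measurable M"
    unfolding Q_def[abs_def] by measurable
  have Q0: "Q \<omega> \<ge> 0" for \<omega> by (simp add: Q_def sum_nonneg)
  have sq: "integrable M (\<lambda>\<omega>. (Y i \<omega>)\<^sup>2)" if "i < d" for i
    using Y[OF that] by (rule gauss_span_square_integrable)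
  have iW: "integrable M (\<lambda>\<omega>. X \<omega> * exp (- r * Q \<omega>))" if "integrable M X" "r \<ge> 0" for X r
    by (rule integrable_mult_exp_neg) (use that Q0 in auto)
  have i1: "integrable M (\<lambda>\<omega>. Y i \<omega> * Y j \<omega> * W \<omega>)" if "i < d" "j < d" for i j
    unfolding W_def using that t0 by (intro iW integrable_mult_of_squares sq) auto
  have iS: "integrable M (\<lambda>\<omega>. \<Sum>j<d. \<Gamma> i j * (Y i \<omega> * Y j \<omega> * W \<omega>))" if "i < d" for i
    using that i1 by (intro Bochner_Integration.integrable_sum integrable_mult_right) auto
  then have iSS: "integrable M (\<lambda>\<omega>. \<Sum>i<d. \<Sum>j<d. \<Gamma> i j * (Y i \<omega> * Y j \<omega> * W \<omega>))"
    by - (rule Bochner_Integration.integrable_sum, simp)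
  have iQ: "integrable M Q"
    unfolding Q_def[abs_def] by (intro Bochner_Integration.integrable_sum sq) auto
  have iQW: "integrable M (\<lambda>\<omega>. Q \<omega> * W \<omega>)"
    unfolding W_def using iW[OF iQ t0] .
  have iE: "integrable M (\<lambda>\<omega>. exp (- r * Q \<omega>))" if "r \<ge> 0" for r
    using iW[of "\<lambda>_. 1" r] that by simp
  have cov: "\<Gamma> i j = (\<Sum>l<m. c i l * c j l)" if "i < d" "j < d" for i j
    using covariance_gauss_span[where c = c and i = i and j = j and m = m] that c by (simp add: \<Gamma>_def)
  have tr: "tr = (\<Sum>i<d. \<Gamma> i i)"
    by (simp add: tr_def \<Gamma>_def power2_eq_square)
  have eq: "expectation (\<lambda>\<omega>. (Y i \<omega>)\<^sup>2 * W \<omega>) = \<Gamma> i i * expectation W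
     - 2 * t * (\<Sum>j<d. \<Gamma> i j * expectation (\<lambda>\<omega>. Y i \<omega> * Y j \<omega> * W \<omega>))" if i: "i < d" for i
  proof -
    have W': "W = (\<lambda>\<omega>. exp (- t * (\<Sum>j<d. (\<Sum>l<m. c j l * N l \<omega>)\<^sup>2)))"
      unfolding W_def[abs_def] Q_def[abs_def] using c by (intro ext) simp
    have "expectation (\<lambda>\<omega>. Y i \<omega> * Y i \<omega> * W \<omega>) = (\<Sum>l<m. c i l * c i l) * expectation W
       - 2 * t * (\<Sum>j<d. (\<Sum>l<m. c i l * c j l) * expectation (\<lambda>\<omega>. Y i \<omega> * (\<Sum>l<m. c j l * N l \<omega>) * W \<omega>))"
      unfolding W' c[OF i] by (rule laplace_derivative_identity[OF t0, where m = m and c = c and i = i and k = i and d = d])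
    also have "(\<Sum>j<d. (\<Sum>l<m. c i l * c j l) * expectation (\<lambda>\<omega>. Y i \<omega> * (\<Sum>l<m. c j l * N l \<omega>) * W \<omega>))
        = (\<Sum>j<d. \<Gamma> i j * expectation (\<lambda>\<omega>. Y i \<omega> * Y j \<omega> * W \<omega>))"
      using c i by (intro sum.cong refl) (simp add: cov)
    finally show ?thesis
      using i by (simp add: cov power2_eq_square)
  qed
  have "expectation (\<lambda>\<omega>. Q \<omega> * W \<omega>) = (\<Sum>i<d. expectation (\<lambda>\<omega>. (Y i \<omega>)\<^sup>2 * W \<omega>))"
    using i1 by (simp add: Q_def sum_distrib_right power2_eq_square)
  also have "\<dots> = tr * expectation W
     - 2 * t * (\<Sum>i<d. \<Sum>j<d. \<Gamma> i j * expectation (\<lambda>\<omega>. Y i \<omega> * Y j \<omega> * W \<omega>))"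
    by (simp add: eq tr sum_subtractf sum_distrib_left sum_distrib_right)
  also have "(\<Sum>i<d. \<Sum>j<d. \<Gamma> i j * expectation (\<lambda>\<omega>. Y i \<omega> * Y j \<omega> * W \<omega>))
     = expectation (\<lambda>\<omega>. \<Sum>i<d. \<Sum>j<d. \<Gamma> i j * (Y i \<omega> * Y j \<omega> * W \<omega>))"
    using i1 iS by simp
  finally have id: "expectation (\<lambda>\<omega>. Q \<omega> * W \<omega>) = tr * expectation W
     - 2 * t * expectation (\<lambda>\<omega>. \<Sum>i<d. \<Sum>j<d. \<Gamma> i j * (Y i \<omega> * Y j \<omega> * W \<omega>))" .
  have "expectation (\<lambda>\<omega>. \<Sum>i<d. \<Sum>j<d. \<Gamma> i j * (Y i \<omega> * Y j \<omega> * W \<omega>)) \<le> expectation (\<lambda>\<omega>. h * (Q \<omega> * W \<omega>))"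
  proof (intro integral_mono)
    fix \<omega>
    have "(\<Sum>i<d. \<Sum>j<d. \<Gamma> i j * (Y i \<omega> * Y j \<omega> * W \<omega>)) = (\<Sum>i<d. \<Sum>j<d. \<Gamma> i j * (Y i \<omega> * Y j \<omega>)) * W \<omega>"
      by (simp add: sum_distrib_right mult.assoc)
    also have "\<dots> \<le> (h * Q \<omega>) * W \<omega>"
      using quadratic_form_le_hilbert_schmidt[of \<Gamma> "\<lambda>i. Y i \<omega>" d]
      by (intro mult_right_mono) (auto simp: h_def hs_covariance_def Q_def \<Gamma>_def W_def)
    finally show "(\<Sum>i<d. \<Sum>j<d. \<Gamma> i j * (Y i \<omega> * Y j \<omega> * W \<omega>)) \<le> h * (Q \<omega> * W \<omega>)"
      by (simp add: mult_ac)
  qed (use iSS iQW in auto)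
  then have "2 * t * expectation (\<lambda>\<omega>. \<Sum>i<d. \<Sum>j<d. \<Gamma> i j * (Y i \<omega> * Y j \<omega> * W \<omega>))
      \<le> 2 * t * (h * expectation (\<lambda>\<omega>. Q \<omega> * W \<omega>))"
    using t0 by (intro mult_left_mono) auto
  \<comment> \<open>The correction is at most a multiple of the very expectation being bounded from
    below, so it is absorbed on that side.\<close>
  with id have "tr * expectation W \<le> (1 + 2 * t * h) * expectation (\<lambda>\<omega>. Q \<omega> * W \<omega>)"
    by (simp add: algebra_simps)
  moreover have "1 + 2 * t * h > 0" using t0 h0 by (simp add: add_pos_nonneg)
  ultimately have "tr / (1 + 2 * t * h) * expectation W \<le> expectation (\<lambda>\<omega>. Q \<omega> * W \<omega>)"
    by (simp add: field_simps)
  then have A: "(t - s) * (tr / (1 + 2 * t * h) * expectation W) \<le> (t - s) * expectation (\<lambda>\<omega>. Q \<omega> * W \<omega>)"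
    using s by (intro mult_left_mono) auto
  have "expectation (\<lambda>\<omega>. W \<omega> + (t - s) * (Q \<omega> * W \<omega>)) \<le> expectation (\<lambda>\<omega>. exp (- s * Q \<omega>))"
  proof (intro integral_mono)
    fix \<omega>
    \<comment> \<open>Tangent line of the exponential at 0, evaluated at
      \<open>(t - s) * Q \<omega>\<close>; integrating it avoids differentiating under the
      expectation.\<close>
    have "exp (- s * Q \<omega>) = exp ((t - s) * Q \<omega>) * W \<omega>"
      by (simp add: W_def exp_add[symmetric] algebra_simps)
    also have "\<dots> \<ge> (1 + (t - s) * Q \<omega>) * W \<omega>"
      by (intro mult_right_mono exp_ge_add_one_self) (simp add: W_def)
    finally show "W \<omega> + (t - s) * (Q \<omega> * W \<omega>) \<le> exp (- s * Q \<omega>)"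
      by (simp add: algebra_simps)
  qed (use iE[OF t0] iE[OF s(1)] iQW in \<open>auto simp: W_def\<close>)
  also have "expectation (\<lambda>\<omega>. W \<omega> + (t - s) * (Q \<omega> * W \<omega>)) = expectation W + (t - s) * expectation (\<lambda>\<omega>. Q \<omega> * W \<omega>)"
    using iE[OF t0] iQW by (simp add: W_def[abs_def])
  finally have "expectation W + (t - s) * (tr / (1 + 2 * t * h) * expectation W) \<le> expectation (\<lambda>\<omega>. exp (- s * Q \<omega>))"
    using A by linarith
  then show ?thesis
    by (simp add: quad_laplace_def W_def[abs_def] Q_def[abs_def] tr_def[symmetric] h_def[symmetric] algebra_simps)
qed

end

section \<open>The first Wiener chaos\<close>

lemma (in prob_space) expectation_Cauchy_Schwarz:
  fixes X Y :: "'a \<Rightarrow> real"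
  assumes [measurable]: "X \<in> borel_measurable M" "Y \<in> borel_measurable M"
    and iX: "integrable M (\<lambda>\<omega>. (X \<omega>)\<^sup>2)" and iY: "integrable M (\<lambda>\<omega>. (Y \<omega>)\<^sup>2)"
  shows "\<bar>expectation (\<lambda>\<omega>. X \<omega> * Y \<omega>)\<bar>
      \<le> sqrt (expectation (\<lambda>\<omega>. (X \<omega>)\<^sup>2)) * sqrt (expectation (\<lambda>\<omega>. (Y \<omega>)\<^sup>2))"
proof -
  define a where "a = expectation (\<lambda>\<omega>. (X \<omega>)\<^sup>2)"
  define b where "b = expectation (\<lambda>\<omega>. (Y \<omega>)\<^sup>2)"
  define c where "c = expectation (\<lambda>\<omega>. X \<omega> * Y \<omega>)"
  have iXY: "integrable M (\<lambda>\<omega>. X \<omega> * Y \<omega>)"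
    by (rule integrable_mult_of_squares) (use assms in auto)
  have q: "0 \<le> u\<^sup>2 * a + 2 * u * v * c + v\<^sup>2 * b" for u v
  proof -
    have "0 \<le> expectation (\<lambda>\<omega>. (u * X \<omega> + v * Y \<omega>)\<^sup>2)" by simp
    also have "\<dots> = expectation (\<lambda>\<omega>. u\<^sup>2 * (X \<omega>)\<^sup>2 + 2 * u * v * (X \<omega> * Y \<omega>) + v\<^sup>2 * (Y \<omega>)\<^sup>2)"
      by (simp add: power2_eq_square algebra_simps)
    also have "\<dots> = u\<^sup>2 * a + 2 * u * v * c + v\<^sup>2 * b"
      using iX iY iXY by (simp add: a_def b_def c_def)
    finally show ?thesis .
  qed
  have a0: "a \<ge> 0" and b0: "b \<ge> 0" by (simp_all add: a_def b_def)
  have "c\<^sup>2 \<le> a * b"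
  proof (cases "a > 0")
    case True
    have "0 \<le> a * (a * b - c\<^sup>2)"
      using q[of "- c" a] by (simp add: power2_eq_square algebra_simps)
    with True show ?thesis by (simp add: zero_le_mult_iff)
  next
    case False
    then have a: "a = 0" using a0 by simp
    have "c = 0"
    proof (rule ccontr)
      assume "c \<noteq> 0"
      \<comment> \<open>With \<open>a = 0\<close> the quadratic form at (u, 1) is 2 u c + b, and the
        chosen u gives it the value -1.\<close>
      then show False
        using q[of "- (b + 1) / (2 * c)" 1] a by (simp add: field_simps)
    qed
    then show ?thesis using a by simp
  qed
  then have "sqrt (c\<^sup>2) \<le> sqrt (a * b)" by (rule real_sqrt_le_mono)
  then show ?thesis by (simp add: real_sqrt_mult a_def b_def c_def)
qed

lemma (in prob_space) expectation_abs_le_sqrt: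
  fixes X :: "'a \<Rightarrow> real"
  assumes [measurable]: "X \<in> borel_measurable M" and "integrable M (\<lambda>\<omega>. (X \<omega>)\<^sup>2)"
  shows "expectation (\<lambda>\<omega>. \<bar>X \<omega>\<bar>) \<le> sqrt (expectation (\<lambda>\<omega>. (X \<omega>)\<^sup>2))"
  using expectation_Cauchy_Schwarz[of "\<lambda>\<omega>. \<bar>X \<omega>\<bar>" "\<lambda>_. 1"] assms by (simp add: prob_space)

lemma (in prob_space) integrable_of_square:
  fixes X :: "'a \<Rightarrow> real"
  assumes "X \<in> borel_measurable M" "integrable M (\<lambda>\<omega>. (X \<omega>)\<^sup>2)"
  shows "integrable M X"
  using integrable_mult_of_squares[of X "\<lambda>_. 1"] assms by simp

lemma (in prob_space) integrable_diff_square: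
  fixes X Y :: "'a \<Rightarrow> real"
  assumes "X \<in> borel_measurable M" "Y \<in> borel_measurable M"
    and "integrable M (\<lambda>\<omega>. (X \<omega>)\<^sup>2)" "integrable M (\<lambda>\<omega>. (Y \<omega>)\<^sup>2)"
  shows "integrable M (\<lambda>\<omega>. (X \<omega> - Y \<omega>)\<^sup>2)"
  using integrable_sum_of_squares[of X "\<lambda>\<omega>. - Y \<omega>"] assms by simp

lemma (in prob_space) expectation_mult_tendsto_of_L2:
  fixes X Y :: "'a \<Rightarrow> real" and Xs Ys :: "nat \<Rightarrow> 'a \<Rightarrow> real"
  assumes [measurable]: "X \<in> borel_measurable M" "Y \<in> borel_measurable M"
      "\<And>k. Xs k \<in> borel_measurable M" "\<And>k. Ys k \<in> borel_measurable M"
    and iX: "integrable M (\<lambda>\<omega>. (X \<omega>)\<^sup>2)" and iY: "integrable M (\<lambda>\<omega>. (Y \<omega>)\<^sup>2)"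
    and iXs: "\<And>k. integrable M (\<lambda>\<omega>. (Xs k \<omega>)\<^sup>2)" and iYs: "\<And>k. integrable M (\<lambda>\<omega>. (Ys k \<omega>)\<^sup>2)"
    and limX: "(\<lambda>k. expectation (\<lambda>\<omega>. (X \<omega> - Xs k \<omega>)\<^sup>2)) \<longlonglongrightarrow> 0"
    and limY: "(\<lambda>k. expectation (\<lambda>\<omega>. (Y \<omega> - Ys k \<omega>)\<^sup>2)) \<longlonglongrightarrow> 0"
  shows "(\<lambda>k. expectation (\<lambda>\<omega>. Xs k \<omega> * Ys k \<omega>)) \<longlonglongrightarrow> expectation (\<lambda>\<omega>. X \<omega> * Y \<omega>)"
proof -
  define D where "D k \<omega> = X \<omega> - Xs k \<omega>" for k \<omega>
  define E where "E k \<omega> = Y \<omega> - Ys k \<omega>" for k \<omega>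
  have [measurable]: "D k \<in> borel_measurable M" "E k \<in> borel_measurable M" for k
    by (simp_all add: D_def[abs_def] E_def[abs_def])
  have iD: "integrable M (\<lambda>\<omega>. (D k \<omega>)\<^sup>2)" for k
    unfolding D_def by (rule integrable_diff_square) (use iX iXs in auto)
  have iE: "integrable M (\<lambda>\<omega>. (E k \<omega>)\<^sup>2)" for k
    unfolding E_def by (rule integrable_diff_square) (use iY iYs in auto)
  have sD: "(\<lambda>k. sqrt (expectation (\<lambda>\<omega>. (D k \<omega>)\<^sup>2))) \<longlonglongrightarrow> 0"
    using tendsto_real_sqrt[OF limX] by (simp add: D_def)
  have sE: "(\<lambda>k. sqrt (expectation (\<lambda>\<omega>. (E k \<omega>)\<^sup>2))) \<longlonglongrightarrow> 0"
    using tendsto_real_sqrt[OF limY] by (simp add: E_def)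
  have 1: "(\<lambda>k. expectation (\<lambda>\<omega>. X \<omega> * E k \<omega>)) \<longlonglongrightarrow> 0"
  proof (rule Lim_null_comparison)
    show "\<forall>\<^sub>F k in sequentially. norm (expectation (\<lambda>\<omega>. X \<omega> * E k \<omega>)) \<le> sqrt (expectation (\<lambda>\<omega>. (X \<omega>)\<^sup>2)) * sqrt (expectation (\<lambda>\<omega>. (E k \<omega>)\<^sup>2))"
      unfolding real_norm_def by (intro always_eventually allI expectation_Cauchy_Schwarz iX iE) auto
  qed (use tendsto_mult_right_zero[OF sE] in auto)
  have 2: "(\<lambda>k. expectation (\<lambda>\<omega>. Y \<omega> * D k \<omega>)) \<longlonglongrightarrow> 0"
  proof (rule Lim_null_comparison)
    show "\<forall>\<^sub>F k in sequentially. norm (expectation (\<lambda>\<omega>. Y \<omega> * D k \<omega>)) \<le> sqrt (expectation (\<lambda>\<omega>. (Y \<omega>)\<^sup>2)) * sqrt (expectation (\<lambda>\<omega>. (D k \<omega>)\<^sup>2))"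
      unfolding real_norm_def by (intro always_eventually allI expectation_Cauchy_Schwarz iY iD) auto
  qed (use tendsto_mult_right_zero[OF sD] in auto)
  have 3: "(\<lambda>k. expectation (\<lambda>\<omega>. D k \<omega> * E k \<omega>)) \<longlonglongrightarrow> 0"
  proof (rule Lim_null_comparison)
    show "\<forall>\<^sub>F k in sequentially. norm (expectation (\<lambda>\<omega>. D k \<omega> * E k \<omega>)) \<le> sqrt (expectation (\<lambda>\<omega>. (D k \<omega>)\<^sup>2)) * sqrt (expectation (\<lambda>\<omega>. (E k \<omega>)\<^sup>2))"
      unfolding real_norm_def by (intro always_eventually allI expectation_Cauchy_Schwarz iE iD) auto
  qed (use tendsto_mult[OF sD sE] in auto)
  have eq: "expectation (\<lambda>\<omega>. Xs k \<omega> * Ys k \<omega>) = expectation (\<lambda>\<omega>. X \<omega> * Y \<omega>) - expectation (\<lambda>\<omega>. X \<omega> * E k \<omega>)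
     - expectation (\<lambda>\<omega>. Y \<omega> * D k \<omega>) + expectation (\<lambda>\<omega>. D k \<omega> * E k \<omega>)" for k
  proof -
    have i: "integrable M (\<lambda>\<omega>. X \<omega> * Y \<omega>)" "integrable M (\<lambda>\<omega>. X \<omega> * E k \<omega>)" "integrable M (\<lambda>\<omega>. Y \<omega> * D k \<omega>)"
      "integrable M (\<lambda>\<omega>. D k \<omega> * E k \<omega>)"
      by (intro integrable_mult_of_squares iX iY iD iE; simp)+
    have "expectation (\<lambda>\<omega>. Xs k \<omega> * Ys k \<omega>) = expectation (\<lambda>\<omega>. X \<omega> * Y \<omega> - X \<omega> * E k \<omega> - Y \<omega> * D k \<omega> + D k \<omega> * E k \<omega>)"
      by (simp add: D_def E_def algebra_simps)
    then show ?thesis using i by simp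
  qed
  have "(\<lambda>k. expectation (\<lambda>\<omega>. X \<omega> * Y \<omega>) - expectation (\<lambda>\<omega>. X \<omega> * E k \<omega>)
     - expectation (\<lambda>\<omega>. Y \<omega> * D k \<omega>) + expectation (\<lambda>\<omega>. D k \<omega> * E k \<omega>)) \<longlonglongrightarrow> expectation (\<lambda>\<omega>. X \<omega> * Y \<omega>) - 0 - 0 + 0"
    by (intro tendsto_intros 1 2 3)
  then show ?thesis by (simp add: eq)
qed

text \<open>The slope has modulus 2|x| exp(- x^2), at most 1 because 2|x| \<le> 1 + x^2 \<le>
  exp(x^2). Although squares are not Lipschitz, this makes the Laplace transform of a sum of squares
  continuous for mean distances of the summands.\<close>

lemma exp_neg_square_lipschitz:
  fixes a b :: real
  shows "\<bar>exp (- a\<^sup>2) - exp (- b\<^sup>2)\<bar> \<le> \<bar>a - b\<bar>"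
proof -
  have "norm (exp (- a\<^sup>2) - exp (- b\<^sup>2)) \<le> 1 * norm (a - b)"
  proof (rule field_differentiable_bound[where S = UNIV and f' = "\<lambda>x. - 2 * x * exp (- x\<^sup>2)"])
    fix x :: real
    show "((\<lambda>x. exp (- x\<^sup>2)) has_real_derivative - 2 * x * exp (- x\<^sup>2)) (at x)"
      by (auto intro!: derivative_eq_intros)
    have "2 * \<bar>x\<bar> \<le> 1 + x\<^sup>2"
      using sum_squares_bound[of 1 "\<bar>x\<bar>"] by simp
    also have "\<dots> \<le> exp (x\<^sup>2)" by (rule exp_ge_add_one_self)
    finally show "norm (- 2 * x * exp (- x\<^sup>2)) \<le> 1"
      by (simp add: abs_mult exp_minus field_simps)
  qed auto
  then show ?thesis by simp
qed

section \<open>Passage from finite linear combinations to L2 limits\<close>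

context gaussian_sequence
begin

text \<open>The exponential of the sum splits into factors of modulus at most 1, so a difference of
  two products is at most the sum of the differences of factors. Each of these is Lipschitz in its
  argument, with scale \<open>sqrt s\<close>.\<close>

lemma quad_laplace_tendsto:
  fixes Y :: "nat \<Rightarrow> 'a \<Rightarrow> real" and Ys :: "nat \<Rightarrow> nat \<Rightarrow> 'a \<Rightarrow> real"
  assumes Y [measurable]: "\<And>i. i < d \<Longrightarrow> Y i \<in> borel_measurable M"
    and Ys [measurable]: "\<And>i k. i < d \<Longrightarrow> Ys k i \<in> borel_measurable M"
    and iY: "\<And>i. i < d \<Longrightarrow> integrable M (\<lambda>\<omega>. (Y i \<omega>)\<^sup>2)"
    and iYs: "\<And>i k. i < d \<Longrightarrow> integrable M (\<lambda>\<omega>. (Ys k i \<omega>)\<^sup>2)"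
    and lim: "\<And>i. i < d \<Longrightarrow> (\<lambda>k. expectation (\<lambda>\<omega>. (Y i \<omega> - Ys k i \<omega>)\<^sup>2)) \<longlonglongrightarrow> 0"
    and s: "s \<ge> 0"
  shows "(\<lambda>k. quad_laplace d (Ys k) s) \<longlonglongrightarrow> quad_laplace d Y s"
proof -
  have iD: "integrable M (\<lambda>\<omega>. (Y i \<omega> - Ys k i \<omega>)\<^sup>2)" if "i < d" for i k
    using that by (intro integrable_diff_square Y Ys iY iYs)
  have iD1: "integrable M (\<lambda>\<omega>. \<bar>Y i \<omega> - Ys k i \<omega>\<bar>)" if "i < d" for i k
    using that by - (rule integrable_abs, rule integrable_of_square, intro borel_measurable_diff Y Ys, auto intro: iD)
  have ie: "integrable M (\<lambda>\<omega>. exp (- s * (\<Sum>i<d. (Z i \<omega>)\<^sup>2)))"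
    if [measurable]: "\<And>i. i < d \<Longrightarrow> Z i \<in> borel_measurable M" for Z
    using integrable_mult_exp_neg[of "\<lambda>_. 1" "\<lambda>\<omega>. \<Sum>i<d. (Z i \<omega>)\<^sup>2" s] s by (simp add: sum_nonneg)
  have pw: "\<bar>exp (- s * (\<Sum>i<d. (y i)\<^sup>2)) - exp (- s * (\<Sum>i<d. (z i)\<^sup>2))\<bar> \<le> sqrt s * (\<Sum>i<d. \<bar>z i - y i\<bar>)"
    for y z :: "nat \<Rightarrow> real"
  proof -
    have e: "exp (- s * (\<Sum>i<d. (y i)\<^sup>2)) = (\<Prod>i<d. exp (- (sqrt s * y i)\<^sup>2))" for y :: "nat \<Rightarrow> real"
      using s by (simp add: exp_sum[symmetric] sum_distrib_left sum_negf power_mult_distrib)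
    have "norm ((\<Prod>i<d. exp (- (sqrt s * y i)\<^sup>2)) - (\<Prod>i<d. exp (- (sqrt s * z i)\<^sup>2)))
       \<le> (\<Sum>i<d. norm (exp (- (sqrt s * y i)\<^sup>2) - exp (- (sqrt s * z i)\<^sup>2)))"
      by (rule norm_prod_diff) auto
    also have "\<dots> \<le> (\<Sum>i<d. \<bar>sqrt s * y i - sqrt s * z i\<bar>)"
      unfolding real_norm_def by (intro sum_mono exp_neg_square_lipschitz)
    also have "\<dots> = sqrt s * (\<Sum>i<d. \<bar>z i - y i\<bar>)"
      using s by (simp add: sum_distrib_left right_diff_distrib[symmetric] abs_mult abs_minus_commute)
    finally show ?thesis unfolding e real_norm_def .
  qed
  have bound: "norm (quad_laplace d (Ys k) s - quad_laplace d Y s) \<le> sqrt s * (\<Sum>i<d. sqrt (expectation (\<lambda>\<omega>. (Y i \<omega> - Ys k i \<omega>)\<^sup>2)))" for k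
  proof -
    have "quad_laplace d (Ys k) s - quad_laplace d Y s
       = expectation (\<lambda>\<omega>. exp (- s * (\<Sum>i<d. (Ys k i \<omega>)\<^sup>2)) - exp (- s * (\<Sum>i<d. (Y i \<omega>)\<^sup>2)))"
      unfolding quad_laplace_def by (intro Bochner_Integration.integral_diff[symmetric] ie) auto
    then have "norm (quad_laplace d (Ys k) s - quad_laplace d Y s) \<le> expectation (\<lambda>\<omega>. norm (exp (- s * (\<Sum>i<d. (Ys k i \<omega>)\<^sup>2)) - exp (- s * (\<Sum>i<d. (Y i \<omega>)\<^sup>2))))"
      by (simp only: integral_norm_bound)
    also have "\<dots> \<le> expectation (\<lambda>\<omega>. sqrt s * (\<Sum>i<d. \<bar>Y i \<omega> - Ys k i \<omega>\<bar>))"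
      unfolding real_norm_def
      by (intro integral_mono pw integrable_abs Bochner_Integration.integrable_diff ie integrable_mult_right
          Bochner_Integration.integrable_sum iD1) auto
    also have "\<dots> = sqrt s * (\<Sum>i<d. expectation (\<lambda>\<omega>. \<bar>Y i \<omega> - Ys k i \<omega>\<bar>))"
      using iD1 by simp
    also have "\<dots> \<le> sqrt s * (\<Sum>i<d. sqrt (expectation (\<lambda>\<omega>. (Y i \<omega> - Ys k i \<omega>)\<^sup>2)))"
      using s by (intro mult_left_mono sum_mono expectation_abs_le_sqrt iD) auto
    finally show ?thesis .
  qed
  have "(\<lambda>k. sqrt s * (\<Sum>i<d. sqrt (expectation (\<lambda>\<omega>. (Y i \<omega> - Ys k i \<omega>)\<^sup>2)))) \<longlonglongrightarrow> sqrt s * (\<Sum>i<d. sqrt 0)"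
    by (intro tendsto_mult tendsto_const tendsto_sum tendsto_real_sqrt lim) auto
  then have "(\<lambda>k. quad_laplace d (Ys k) s - quad_laplace d Y s) \<longlonglongrightarrow> 0"
    by (intro Lim_null_comparison[OF always_eventually[OF allI[OF bound]]]) simp
  then show ?thesis by (simp add: LIM_zero_iff)
qed

lemma chaos_measurable [measurable_dest]: "X \<in> first_wiener_chaos M N \<Longrightarrow> X \<in> borel_measurable M"
  by (simp add: first_wiener_chaos_def)

lemma chaos_square_integrable: "X \<in> first_wiener_chaos M N \<Longrightarrow> integrable M (\<lambda>\<omega>. (X \<omega>)\<^sup>2)"
  by (simp add: first_wiener_chaos_def)

text \<open>Differences of square integrable functions are square integrable, so the extended
  integrals of the definition are finite and may be replaced by expectations.\<close>

lemma chaos_iff: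
  "X \<in> first_wiener_chaos M N \<longleftrightarrow> X \<in> borel_measurable M \<and> integrable M (\<lambda>\<omega>. (X \<omega>)\<^sup>2) \<and>
    (\<exists>Z. (\<forall>k. Z k \<in> gauss_span) \<and> (\<lambda>k. expectation (\<lambda>\<omega>. (X \<omega> - Z k \<omega>)\<^sup>2)) \<longlonglongrightarrow> 0)"
proof -
  have eq: "(\<lambda>k. \<integral>\<^sup>+\<omega>. ennreal ((X \<omega> - Z k \<omega>)\<^sup>2) \<partial>M) \<longlonglongrightarrow> 0 \<longleftrightarrow> (\<lambda>k. expectation (\<lambda>\<omega>. (X \<omega> - Z k \<omega>)\<^sup>2)) \<longlonglongrightarrow> 0"
    if X: "X \<in> borel_measurable M" "integrable M (\<lambda>\<omega>. (X \<omega>)\<^sup>2)" and Z: "\<And>k. Z k \<in> gauss_span" for Z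
  proof -
    have "(\<integral>\<^sup>+\<omega>. ennreal ((X \<omega> - Z k \<omega>)\<^sup>2) \<partial>M) = ennreal (expectation (\<lambda>\<omega>. (X \<omega> - Z k \<omega>)\<^sup>2))" for k
      by (intro nn_integral_eq_integral integrable_diff_square X gauss_span_square_integrable gauss_span_measurable Z) auto
    then show ?thesis by (simp add: ennreal_tendsto_0_iff)
  qed
  show ?thesis
  proof
    assume X: "X \<in> first_wiener_chaos M N"
    then obtain m c where mc: "(\<lambda>k. \<integral>\<^sup>+\<omega>. ennreal ((X \<omega> - (\<Sum>i<m k. c k i * N i \<omega>))\<^sup>2) \<partial>M) \<longlonglongrightarrow> 0"
      unfolding first_wiener_chaos_def by blast
    define Z where "Z k \<omega> = (\<Sum>i<m k. c k i * N i \<omega>)" for k \<omega>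
    have Z: "Z k \<in> gauss_span" for k
      by (auto simp: gauss_span_def Z_def[abs_def])
    have "(\<lambda>k. expectation (\<lambda>\<omega>. (X \<omega> - Z k \<omega>)\<^sup>2)) \<longlonglongrightarrow> 0"
      using eq[of Z] mc Z chaos_measurable[OF X] chaos_square_integrable[OF X] by (simp add: Z_def)
    with Z show "X \<in> borel_measurable M \<and> integrable M (\<lambda>\<omega>. (X \<omega>)\<^sup>2) \<and>
       (\<exists>Z. (\<forall>k. Z k \<in> gauss_span) \<and> (\<lambda>k. expectation (\<lambda>\<omega>. (X \<omega> - Z k \<omega>)\<^sup>2)) \<longlonglongrightarrow> 0)"
      using chaos_measurable[OF X] chaos_square_integrable[OF X] by blast
  next
    assume A: "X \<in> borel_measurable M \<and> integrable M (\<lambda>\<omega>. (X \<omega>)\<^sup>2) \<and>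
       (\<exists>Z. (\<forall>k. Z k \<in> gauss_span) \<and> (\<lambda>k. expectation (\<lambda>\<omega>. (X \<omega> - Z k \<omega>)\<^sup>2)) \<longlonglongrightarrow> 0)"
    then obtain Z where Z: "\<And>k. Z k \<in> gauss_span" "(\<lambda>k. \<integral>\<^sup>+\<omega>. ennreal ((X \<omega> - Z k \<omega>)\<^sup>2) \<partial>M) \<longlonglongrightarrow> 0"
      using eq by blast
    have "\<forall>k. \<exists>m c. Z k = (\<lambda>\<omega>. \<Sum>i<m. c i * N i \<omega>)"
      using Z(1) by (simp add: gauss_span_def)
    then obtain m c where "\<And>k. Z k = (\<lambda>\<omega>. \<Sum>i<m k. c k i * N i \<omega>)"
      by metis
    with Z(2) A show "X \<in> first_wiener_chaos M N"
      unfolding first_wiener_chaos_def by auto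
  qed
qed

lemma gauss_span_zero: "(\<lambda>_. 0) \<in> gauss_span"
  unfolding gauss_span_def by (auto intro!: exI[of _ 0])

lemma gauss_span_scale: "Z \<in> gauss_span \<Longrightarrow> (\<lambda>\<omega>. a * Z \<omega>) \<in> gauss_span"
  unfolding gauss_span_def by (auto simp: sum_distrib_left mult.assoc[symmetric] intro!: exI[of _ "\<lambda>i. a * _ i"])

lemma gauss_span_add:
  assumes "Z \<in> gauss_span" "Z' \<in> gauss_span"
  shows "(\<lambda>\<omega>. Z \<omega> + Z' \<omega>) \<in> gauss_span"
proof -
  define Y where "Y i = (if i = 0 then Z else Z')" for i :: nat
  obtain m c where c: "\<And>i. i < 2 \<Longrightarrow> Y i = (\<lambda>\<omega>. \<Sum>l<m. c i l * N l \<omega>)"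
    by (rule gauss_span_common[where Y = Y and d = 2]) (use assms in \<open>auto simp: Y_def\<close>)
  have "(\<lambda>\<omega>. Z \<omega> + Z' \<omega>) = (\<lambda>\<omega>. \<Sum>l<m. (c 0 l + c 1 l) * N l \<omega>)"
    using c[of 0] c[of 1] by (auto simp: Y_def sum.distrib distrib_right)
  then show ?thesis
    unfolding gauss_span_def by (intro CollectI exI[of _ m] exI[of _ "\<lambda>l. c 0 l + c 1 l"])
qed

lemma chaos_zero: "(\<lambda>_. 0) \<in> first_wiener_chaos M N"
  unfolding chaos_iff by (auto intro!: exI[of _ "\<lambda>_ _. 0"] gauss_span_zero)

lemma chaos_scale:
  assumes X: "X \<in> first_wiener_chaos M N"
  shows "(\<lambda>\<omega>. a * X \<omega>) \<in> first_wiener_chaos M N"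
proof -
  obtain Z where Z: "\<And>k. Z k \<in> gauss_span" "(\<lambda>k. expectation (\<lambda>\<omega>. (X \<omega> - Z k \<omega>)\<^sup>2)) \<longlonglongrightarrow> 0"
    using X unfolding chaos_iff by blast
  have "expectation (\<lambda>\<omega>. (a * X \<omega> - a * Z k \<omega>)\<^sup>2) = a\<^sup>2 * expectation (\<lambda>\<omega>. (X \<omega> - Z k \<omega>)\<^sup>2)" for k
    by (simp add: right_diff_distrib[symmetric] power_mult_distrib)
  then have "(\<lambda>k. expectation (\<lambda>\<omega>. (a * X \<omega> - a * Z k \<omega>)\<^sup>2)) \<longlonglongrightarrow> 0"
    using tendsto_mult_right_zero[OF Z(2), of "a\<^sup>2"] by simp
  then show ?thesis
    using chaos_measurable[OF X] chaos_square_integrable[OF X] Z(1) unfolding chaos_iff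
    by (auto simp: power_mult_distrib intro!: exI[of _ "\<lambda>k \<omega>. a * Z k \<omega>"] gauss_span_scale)
qed

lemma chaos_add:
  assumes X: "X \<in> first_wiener_chaos M N" and Y: "Y \<in> first_wiener_chaos M N"
  shows "(\<lambda>\<omega>. X \<omega> + Y \<omega>) \<in> first_wiener_chaos M N"
proof -
  note mX [measurable] = chaos_measurable[OF X] and mY [measurable] = chaos_measurable[OF Y]
  obtain Z where Z: "\<And>k. Z k \<in> gauss_span" "(\<lambda>k. expectation (\<lambda>\<omega>. (X \<omega> - Z k \<omega>)\<^sup>2)) \<longlonglongrightarrow> 0"
    using X unfolding chaos_iff by blast
  obtain Z' where Z': "\<And>k. Z' k \<in> gauss_span" "(\<lambda>k. expectation (\<lambda>\<omega>. (Y \<omega> - Z' k \<omega>)\<^sup>2)) \<longlonglongrightarrow> 0"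
    using Y unfolding chaos_iff by blast
  note [measurable] = gauss_span_measurable[OF Z(1)] gauss_span_measurable[OF Z'(1)]
  have i: "integrable M (\<lambda>\<omega>. (X \<omega> - Z k \<omega>)\<^sup>2)" "integrable M (\<lambda>\<omega>. (Y \<omega> - Z' k \<omega>)\<^sup>2)" for k
    by (intro integrable_diff_square chaos_square_integrable X Y gauss_span_square_integrable Z Z'; measurable)+
  have "expectation (\<lambda>\<omega>. (X \<omega> + Y \<omega> - (Z k \<omega> + Z' k \<omega>))\<^sup>2)
     \<le> 2 * expectation (\<lambda>\<omega>. (X \<omega> - Z k \<omega>)\<^sup>2) + 2 * expectation (\<lambda>\<omega>. (Y \<omega> - Z' k \<omega>)\<^sup>2)" for k
  proof -
    have p: "(a + b - (c + d))\<^sup>2 \<le> 2 * (a - c)\<^sup>2 + 2 * (b - d)\<^sup>2" for a b c d :: real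
      using sum_squares_bound[of "a - c" "b - d"] by (simp add: power2_eq_square algebra_simps)
    have "integrable M (\<lambda>\<omega>. ((X \<omega> - Z k \<omega>) + (Y \<omega> - Z' k \<omega>))\<^sup>2)"
      by (intro integrable_sum_of_squares i; measurable)
    then have "integrable M (\<lambda>\<omega>. (X \<omega> + Y \<omega> - (Z k \<omega> + Z' k \<omega>))\<^sup>2)"
      by (simp add: algebra_simps)
    then have "expectation (\<lambda>\<omega>. (X \<omega> + Y \<omega> - (Z k \<omega> + Z' k \<omega>))\<^sup>2) \<le> expectation (\<lambda>\<omega>. 2 * (X \<omega> - Z k \<omega>)\<^sup>2 + 2 * (Y \<omega> - Z' k \<omega>)\<^sup>2)"
      using i[of k] by (intro integral_mono p) auto
    then show ?thesis using i[of k] by simp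
  qed
  then have "\<forall>\<^sub>F k in sequentially. norm (expectation (\<lambda>\<omega>. (X \<omega> + Y \<omega> - (Z k \<omega> + Z' k \<omega>))\<^sup>2))
     \<le> 2 * expectation (\<lambda>\<omega>. (X \<omega> - Z k \<omega>)\<^sup>2) + 2 * expectation (\<lambda>\<omega>. (Y \<omega> - Z' k \<omega>)\<^sup>2)"
    by (simp add: always_eventually)
  then have "(\<lambda>k. expectation (\<lambda>\<omega>. (X \<omega> + Y \<omega> - (Z k \<omega> + Z' k \<omega>))\<^sup>2)) \<longlonglongrightarrow> 0"
    by (rule Lim_null_comparison)
      (use tendsto_add[OF tendsto_mult_right_zero[OF Z(2), of 2] tendsto_mult_right_zero[OF Z'(2), of 2]] in simp)
  moreover have "integrable M (\<lambda>\<omega>. (X \<omega> + Y \<omega>)\<^sup>2)"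
    by (intro integrable_sum_of_squares chaos_square_integrable X Y mX mY)
  ultimately show ?thesis
    using Z(1) Z'(1) unfolding chaos_iff
    by (auto intro!: exI[of _ "\<lambda>k \<omega>. Z k \<omega> + Z' k \<omega>"] gauss_span_add)
qed

lemma chaos_sum:
  assumes "finite I" "\<And>i. i \<in> I \<Longrightarrow> X i \<in> first_wiener_chaos M N"
  shows "(\<lambda>\<omega>. \<Sum>i\<in>I. a i * X i \<omega>) \<in> first_wiener_chaos M N"
  using assms by (induction rule: finite_induct) (auto intro!: chaos_zero chaos_add chaos_scale)

text \<open>The Laplace transform, the trace and the Hilbert-Schmidt norm are all continuous under
  L2 convergence of the finitely many coordinates, so the inequality passes to the limit.\<close>

lemma quad_laplace_decrease:
  fixes d :: nat
  assumes Y: "\<And>i. i < d \<Longrightarrow> Y i \<in> first_wiener_chaos M N" and s: "0 \<le> s" "s \<le> t"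
  shows "quad_laplace d Y t * (1 + (t - s) * (\<Sum>i<d. expectation (\<lambda>\<omega>. (Y i \<omega>)\<^sup>2)) / (1 + 2 * t * hs_covariance d Y))
         \<le> quad_laplace d Y s"
proof -
  let ?P = "\<lambda>i Z. (\<forall>k. Z k \<in> gauss_span) \<and> (\<lambda>k. expectation (\<lambda>\<omega>. (Y i \<omega> - Z k \<omega>)\<^sup>2)) \<longlonglongrightarrow> 0"
  define Z where "Z i = (SOME Z. ?P i Z)" for i
  have "?P i (Z i)" if "i < d" for i
    unfolding Z_def using Y[OF that] by (intro someI_ex[of "?P i"]) (simp add: chaos_iff)
  then have Z: "\<And>i k. i < d \<Longrightarrow> Z i k \<in> gauss_span"
      "\<And>i. i < d \<Longrightarrow> (\<lambda>k. expectation (\<lambda>\<omega>. (Y i \<omega> - Z i k \<omega>)\<^sup>2)) \<longlonglongrightarrow> 0"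
    by simp_all
  define Ys where "Ys k i = Z i k" for k i
  have Ys: "\<And>i k. i < d \<Longrightarrow> Ys k i \<in> gauss_span"
      "\<And>i. i < d \<Longrightarrow> (\<lambda>k. expectation (\<lambda>\<omega>. (Y i \<omega> - Ys k i \<omega>)\<^sup>2)) \<longlonglongrightarrow> 0"
    using Z by (auto simp: Ys_def)
  have cov: "(\<lambda>k. expectation (\<lambda>\<omega>. Ys k i \<omega> * Ys k j \<omega>)) \<longlonglongrightarrow> expectation (\<lambda>\<omega>. Y i \<omega> * Y j \<omega>)"
    if "i < d" "j < d" for i j
    using that by (intro expectation_mult_tendsto_of_L2 chaos_measurable chaos_square_integrable
        gauss_span_measurable gauss_span_square_integrable Y Ys)
  have g: "(\<lambda>k. quad_laplace d (Ys k) r) \<longlonglongrightarrow> quad_laplace d Y r" if "r \<ge> 0" for r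
    using that by (intro quad_laplace_tendsto chaos_measurable chaos_square_integrable
        gauss_span_measurable gauss_span_square_integrable Y Ys)
  have h: "(\<lambda>k. hs_covariance d (Ys k)) \<longlonglongrightarrow> hs_covariance d Y"
    unfolding hs_covariance_def by (intro tendsto_real_sqrt tendsto_sum tendsto_power cov) auto
  have tr: "(\<lambda>k. \<Sum>i<d. expectation (\<lambda>\<omega>. (Ys k i \<omega>)\<^sup>2)) \<longlonglongrightarrow> (\<Sum>i<d. expectation (\<lambda>\<omega>. (Y i \<omega>)\<^sup>2))"
    unfolding power2_eq_square by (intro tendsto_sum cov) auto
  have t0: "t \<ge> 0" using s by simp
  have "1 + 2 * t * hs_covariance d Y > 0"
    using t0 hs_covariance_nonneg[of d Y] by (simp add: add_pos_nonneg)
  then have "(\<lambda>k. quad_laplace d (Ys k) t * (1 + (t - s) * (\<Sum>i<d. expectation (\<lambda>\<omega>. (Ys k i \<omega>)\<^sup>2)) / (1 + 2 * t * hs_covariance d (Ys k))))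
     \<longlonglongrightarrow> quad_laplace d Y t * (1 + (t - s) * (\<Sum>i<d. expectation (\<lambda>\<omega>. (Y i \<omega>)\<^sup>2)) / (1 + 2 * t * hs_covariance d Y))"
    by (intro tendsto_intros g h tr t0) auto
  then show ?thesis
    by (rule LIMSEQ_le[OF _ g[OF s(1)]]) (use quad_laplace_decrease_span[OF Ys(1) s] in auto)
qed

end

section \<open>Polynomial decay of the Laplace transform\<close>

context gaussian_sequence
begin

text \<open>Doubling \<open>1 + 2 * s * h\<close> divides the Laplace transform by at least 1 + m/2,
  hence by at least 2^r: over such a step the increment of \<open>s\<close> is (1 + 2 s h) / (4 h),
  the trace is at least 2 h m, and their product divided by 1 + 2 s h is at least m/2. Iterating
  over powers of 2 gives decay of order r; the base 2 in the bound pays for rounding down to a power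
  of 2.\<close>

lemma quad_laplace_decay:
  fixes d r :: nat
  assumes Y: "\<And>i. i < d \<Longrightarrow> Y i \<in> first_wiener_chaos M N"
    and h: "h > 0" "hs_covariance d Y \<le> h"
    and m: "m \<ge> 0" "2 * h * m \<le> (\<Sum>i<d. expectation (\<lambda>\<omega>. (Y i \<omega>)\<^sup>2))"
    and r: "2 ^ r \<le> 1 + m / 2" and s: "s \<ge> 0"
  shows "quad_laplace d Y s \<le> (2 / (1 + 2 * s * h)) ^ r"
proof -
  let ?g = "quad_laplace d Y" and ?hs = "hs_covariance d Y"
  define tr where "tr = (\<Sum>i<d. expectation (\<lambda>\<omega>. (Y i \<omega>)\<^sup>2))"
  have tr: "2 * h * m \<le> tr" using m by (simp add: tr_def)
  then have tr0: "tr \<ge> 0"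
    using mult_nonneg_nonneg[of "2 * h" m] h m by linarith
  have hs0: "?hs \<ge> 0" by (rule hs_covariance_nonneg)
  have dec: "?g t * (1 + (t - s) * tr / (1 + 2 * t * ?hs)) \<le> ?g s" if "0 \<le> s" "s \<le> t" for s t
    using quad_laplace_decrease[OF Y that] by (simp add: tr_def)
  have mono: "?g t \<le> ?g s" if st: "0 \<le> s" "s \<le> t" for s t
  proof -
    have "0 \<le> (t - s) * tr / (1 + 2 * t * ?hs)"
      using st tr0 hs0 by (intro divide_nonneg_nonneg mult_nonneg_nonneg add_nonneg_nonneg) auto
    then have "?g t * 1 \<le> ?g t * (1 + (t - s) * tr / (1 + 2 * t * ?hs))"
      by (intro mult_left_mono quad_laplace_nonneg) auto
    with dec[OF st] show ?thesis by simp
  qed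
  have g1: "?g s \<le> 1" if "s \<ge> 0" for s
    using mono[of 0 s] that by (simp add: quad_laplace_def prob_space)
  \<comment> \<open>The threshold for \<open>s\<close> is the point where
    \<open>1 + 2 * s * h\<close> reaches 2^j.\<close>
  have geo: "\<forall>s\<ge>(2 ^ j - 1) / (2 * h). ?g s \<le> (1 / 2 ^ r) ^ j" for j :: nat
  proof (induction j)
    case 0
    then show ?case using g1 by simp
  next
    case (Suc j)
    show ?case
    proof (intro allI impI)
      fix s assume s: "(2 ^ Suc j - 1) / (2 * h) \<le> s"
      have "(1::real) \<le> 2 ^ j" by simp
      then have p: "0 \<le> (2 ^ j - 1) / (2 * h)" using h by simp
      have "0 \<le> (2 ^ Suc j - 1) / (2 * h)"
        using h one_le_power[of "2::real" "Suc j"] by (intro divide_nonneg_nonneg) auto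
      then have s0: "s \<ge> 0" using s by linarith
      \<comment> \<open>Chosen so that \<open>1 + 2 * u * h\<close> is half of
        \<open>1 + 2 * s * h\<close>.\<close>
      define u where "u = (s - 1 / (2 * h)) / 2"
      have u: "(2 ^ j - 1) / (2 * h) \<le> u" 
      proof -
        have "(2 ^ j - 1) / (2 * h) = ((2 ^ Suc j - 1) / (2 * h) - 1 / (2 * h)) / 2"
          using h by (simp add: field_simps)
        also have "\<dots> \<le> u"
          unfolding u_def using s by (intro divide_right_mono diff_right_mono) auto
        finally show ?thesis .
      qed
      have "0 \<le> 1 / (2 * h)" using h by simp
      moreover have "(s - e) / 2 \<le> s" if "0 \<le> e" for e
        using s0 that by simp
      ultimately have us: "u \<le> s" unfolding u_def by blast
      have d1: "s - u = (1 + 2 * s * h) / (4 * h)" using h by (simp add: u_def field_simps)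
      have pos: "1 + 2 * s * ?hs > 0" using s0 hs0 by (simp add: add_pos_nonneg)
      have le: "1 + 2 * s * ?hs \<le> 1 + 2 * s * h" using s0 h by (simp add: mult_left_mono)
      have "m / 2 = (1 + 2 * s * h) / (4 * h) * (2 * h * m) / (1 + 2 * s * h)"
      proof -
        have "m / 2 = D / (4 * h) * (2 * h * m) / D" if "D > 0" for D
          using that h by (simp add: field_simps)
        then show ?thesis using pos le by (meson less_le_trans)
      qed
      also have "\<dots> \<le> (s - u) * tr / (1 + 2 * s * ?hs)"
        unfolding d1[symmetric] using us tr pos le tr0
        by (intro frac_le mult_left_mono mult_nonneg_nonneg) auto
      finally have "1 + m / 2 \<le> 1 + (s - u) * tr / (1 + 2 * s * ?hs)"
        by (rule add_left_mono)
      with r have "2 ^ r \<le> 1 + (s - u) * tr / (1 + 2 * s * ?hs)"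
        by (rule order_trans)
      then have "?g s * 2 ^ r \<le> ?g s * (1 + (s - u) * tr / (1 + 2 * s * ?hs))"
        by (intro mult_left_mono quad_laplace_nonneg)
      also have "\<dots> \<le> ?g u" using dec[of u s] us u p by linarith
      also have "\<dots> \<le> (1 / 2 ^ r) ^ j" using Suc u by blast
      finally show "?g s \<le> (1 / 2 ^ r) ^ Suc j"
        by (simp add: field_simps)
    qed
  qed
  define x where "x = 1 + 2 * s * h"
  have x1: "x \<ge> 1" using s h by (simp add: x_def)
  \<comment> \<open>Minimality places \<open>x\<close> between 2^(n-1) and 2^n; since x \<ge> 1,
    \<open>n\<close> is a successor.\<close>
  define n where "n = (LEAST n. x < 2 ^ n)"
  have n: "x < 2 ^ n"
  proof -
    have "\<exists>n. x < 2 ^ n" by (rule real_arch_pow) simp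
    then show ?thesis unfolding n_def by (rule LeastI_ex)
  qed
  with x1 obtain j where j: "n = Suc j" by (cases n) auto
  then have xj: "2 ^ j \<le> x"
    using not_less_Least[of j "\<lambda>n. x < 2 ^ n", folded n_def] by simp
  then have "(2 ^ j - 1) / (2 * h) \<le> s" using h by (simp add: x_def field_simps)
  then have "?g s \<le> (1 / 2 ^ r) ^ j" using geo by blast
  also have "\<dots> = (1 / 2 ^ j) ^ r" by (simp add: power_divide power_mult[symmetric] mult.commute)
  also have "\<dots> \<le> (2 / x) ^ r"
    using n j x1 by (intro power_mono) (auto simp: field_simps)
  finally show ?thesis by (simp add: x_def)
qed

section \<open>Gaussian laws and even moments of chaos elements\<close>

lemma char_gauss_span:
  assumes "Z \<in> gauss_span"
  shows "char (distr M borel Z) t = exp (- (t\<^sup>2 * expectation (\<lambda>\<omega>. (Z \<omega>)\<^sup>2)) / 2)"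
proof -
  obtain m c where Z: "Z = (\<lambda>\<omega>. \<Sum>i<m. c i * N i \<omega>)"
    using assms by (auto simp: gauss_span_def)
  have E: "expectation (\<lambda>\<omega>. (Z \<omega>)\<^sup>2) = (\<Sum>i<m. (c i)\<^sup>2)"
    using covariance_gauss_span[where c = "\<lambda>_. c" and m = m and i = 0 and j = 0]
    by (simp add: Z power2_eq_square)
  have ind: "indep_vars (\<lambda>_. borel) (\<lambda>i \<omega>. c i * N i \<omega>) {..<m}"
    by (rule indep_vars_compose2[OF indep_vars_subset[OF indep]]) auto
  have one: "char (distr M borel (\<lambda>\<omega>. c i * N i \<omega>)) t = exp (- ((t * c i)\<^sup>2) / 2)" for i
  proof -
    have "char (distr M borel (\<lambda>\<omega>. c i * N i \<omega>)) t = char (distr M borel (N i)) (t * c i)"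
      unfolding char_def by (subst (1 2) integral_distr) (auto simp: mult_ac)
    then show ?thesis by (simp add: distr_N char_std_normal_distribution)
  qed
  have "char (distr M borel Z) t = (\<Prod>i<m. complex_of_real (exp (- ((t * c i)\<^sup>2) / 2)))"
    unfolding Z by (subst char_distr_sum[OF ind]) (simp add: one)
  also have "\<dots> = complex_of_real (exp (\<Sum>i<m. - ((t * c i)\<^sup>2) / 2))"
    by (simp add: exp_sum)
  also have "(\<Sum>i<m. - ((t * c i)\<^sup>2) / 2) = - (t\<^sup>2 * expectation (\<lambda>\<omega>. (Z \<omega>)\<^sup>2)) / 2"
    by (simp add: E sum_negf sum_divide_distrib[symmetric] power_mult_distrib sum_distrib_left)
  finally show ?thesis .
qed

text \<open>The function exp(i t x) of x is |t|-Lipschitz, so L2 convergence implies convergence of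
  characteristic functions, while the variances converge as well.\<close>

lemma char_chaos:
  assumes X: "X \<in> first_wiener_chaos M N"
  shows "char (distr M borel X) t = exp (- (t\<^sup>2 * expectation (\<lambda>\<omega>. (X \<omega>)\<^sup>2)) / 2)"
proof -
  note [measurable] = chaos_measurable[OF X]
  obtain Z where Z: "\<And>k. Z k \<in> gauss_span" and lim: "(\<lambda>k. expectation (\<lambda>\<omega>. (X \<omega> - Z k \<omega>)\<^sup>2)) \<longlonglongrightarrow> 0"
    using X unfolding chaos_iff by blast
  have Zm [measurable]: "Z k \<in> borel_measurable M" for k
    by (rule gauss_span_measurable[OF Z])
  have iD: "integrable M (\<lambda>\<omega>. (X \<omega> - Z k \<omega>)\<^sup>2)" for k
    by (intro integrable_diff_square chaos_square_integrable X gauss_span_square_integrable Z) simp_all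
  have iD1: "integrable M (\<lambda>\<omega>. X \<omega> - Z k \<omega>)" for k
    by (rule integrable_of_square) (use iD in auto)
  have ii: "integrable M (\<lambda>\<omega>. iexp (t * Y \<omega>))" if [measurable]: "Y \<in> borel_measurable M" for Y
    by (rule integrable_const_bound[where B = 1]) auto
  have "(\<lambda>k. expectation (\<lambda>\<omega>. Z k \<omega> * Z k \<omega>)) \<longlonglongrightarrow> expectation (\<lambda>\<omega>. X \<omega> * X \<omega>)"
    by (intro expectation_mult_tendsto_of_L2 chaos_square_integrable X gauss_span_square_integrable Z lim) auto
  then have "(\<lambda>k. complex_of_real (exp (- (t\<^sup>2 * expectation (\<lambda>\<omega>. (Z k \<omega>)\<^sup>2)) / 2)))
      \<longlonglongrightarrow> complex_of_real (exp (- (t\<^sup>2 * expectation (\<lambda>\<omega>. (X \<omega>)\<^sup>2)) / 2))"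
    unfolding power2_eq_square by (intro tendsto_intros) auto
  then have 1: "(\<lambda>k. char (distr M borel (Z k)) t) \<longlonglongrightarrow> complex_of_real (exp (- (t\<^sup>2 * expectation (\<lambda>\<omega>. (X \<omega>)\<^sup>2)) / 2))"
    by (simp add: char_gauss_span[OF Z])
  have bound: "norm (char (distr M borel (Z k)) t - char (distr M borel X) t) \<le> \<bar>t\<bar> * sqrt (expectation (\<lambda>\<omega>. (X \<omega> - Z k \<omega>)\<^sup>2))" for k
  proof -
    have pw: "cmod (iexp (t * z) - iexp (t * x)) \<le> \<bar>t\<bar> * \<bar>x - z\<bar>" for x z
    proof -
      have "iexp (t * z) - iexp (t * x) = iexp (t * x) * (iexp (t * (z - x)) - 1)"
        by (simp add: right_diff_distrib exp_add[symmetric] algebra_simps)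
      then have "cmod (iexp (t * z) - iexp (t * x)) = cmod (iexp (t * (z - x)) - 1)"
        by (simp add: norm_mult)
      also have "\<dots> \<le> \<bar>t * (z - x)\<bar>"
        using iexp_approx1[of "t * (z - x)" 0] by simp
      finally show ?thesis by (simp add: abs_mult abs_minus_commute)
    qed
    have "char (distr M borel (Z k)) t - char (distr M borel X) t = (CLINT \<omega>|M. iexp (t * Z k \<omega>) - iexp (t * X \<omega>))"
      using ii[of "Z k"] ii[of X] unfolding char_def
      by (subst (1 2) integral_distr) (auto intro!: Bochner_Integration.integral_diff[symmetric])
    then have "norm (char (distr M borel (Z k)) t - char (distr M borel X) t) \<le> expectation (\<lambda>\<omega>. cmod (iexp (t * Z k \<omega>) - iexp (t * X \<omega>)))"
      by (simp only: integral_norm_bound)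
    also have "\<dots> \<le> expectation (\<lambda>\<omega>. \<bar>t\<bar> * \<bar>X \<omega> - Z k \<omega>\<bar>)"
      using iD1[of k] by (intro integral_mono pw integrable_norm Bochner_Integration.integrable_diff ii) auto
    also have "\<dots> \<le> \<bar>t\<bar> * sqrt (expectation (\<lambda>\<omega>. (X \<omega> - Z k \<omega>)\<^sup>2))"
      using expectation_abs_le_sqrt[OF _ iD[of k]] by (simp add: mult_left_mono)
    finally show ?thesis .
  qed
  have "(\<lambda>k. \<bar>t\<bar> * sqrt (expectation (\<lambda>\<omega>. (X \<omega> - Z k \<omega>)\<^sup>2))) \<longlonglongrightarrow> 0"
    using tendsto_mult_right_zero[OF tendsto_real_sqrt[OF lim, unfolded real_sqrt_zero]] .
  then have "(\<lambda>k. char (distr M borel (Z k)) t - char (distr M borel X) t) \<longlonglongrightarrow> 0"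
    by (rule Lim_null_comparison[OF always_eventually[OF allI[OF bound]]])
  then have "(\<lambda>k. char (distr M borel (Z k)) t) \<longlonglongrightarrow> char (distr M borel X) t"
    by (simp add: LIM_zero_iff)
  with 1 show ?thesis using LIMSEQ_unique by blast
qed

text \<open>The law is written as the image of the standard normal under scaling, rather than by a
  density, so that variance 0 is included.\<close>

lemma distr_chaos:
  assumes X: "X \<in> first_wiener_chaos M N"
  shows "distr M borel X = distr std_normal_distribution borel (\<lambda>x. sqrt (expectation (\<lambda>\<omega>. (X \<omega>)\<^sup>2)) * x)"
proof (rule Levy_uniqueness)
  interpret S: real_distribution std_normal_distribution by (rule real_dist_normal_dist)
  let ?\<sigma> = "sqrt (expectation (\<lambda>\<omega>. (X \<omega>)\<^sup>2))"
  show "real_distribution (distr M borel X)"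
    by (rule real_distribution_distr) (rule chaos_measurable[OF X])
  show "real_distribution (distr std_normal_distribution borel (\<lambda>x. ?\<sigma> * x))"
    by (rule S.real_distribution_distr) simp
  show "char (distr M borel X) = char (distr std_normal_distribution borel (\<lambda>x. ?\<sigma> * x))"
  proof
    fix t
    have "char (distr std_normal_distribution borel (\<lambda>x. ?\<sigma> * x)) t = char std_normal_distribution (t * ?\<sigma>)"
      unfolding char_def by (subst integral_distr) (auto simp: mult_ac)
    also have "\<dots> = exp (- (t\<^sup>2 * expectation (\<lambda>\<omega>. (X \<omega>)\<^sup>2)) / 2)"
      by (simp add: char_std_normal_distribution power_mult_distrib)
    finally show "char (distr M borel X) t = char (distr std_normal_distribution borel (\<lambda>x. ?\<sigma> * x)) t"
      by (simp add: char_chaos[OF X])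
  qed
qed

text \<open>The factor (2k)! / (2^k k!) is the moment of order 2k of the standard normal law. Hence
  the variance alone controls every even moment, with constants independent of the element.\<close>

lemma chaos_moment:
  assumes X: "X \<in> first_wiener_chaos M N"
  shows "integrable M (\<lambda>\<omega>. X \<omega> ^ (2 * k))"
    and "expectation (\<lambda>\<omega>. X \<omega> ^ (2 * k)) = fact (2 * k) / (2 ^ k * fact k) * expectation (\<lambda>\<omega>. (X \<omega>)\<^sup>2) ^ k"
proof -
  note [measurable] = chaos_measurable[OF X]
  define \<sigma> where "\<sigma> = sqrt (expectation (\<lambda>\<omega>. (X \<omega>)\<^sup>2))"
  have \<sigma>: "\<sigma> ^ (2 * k) = expectation (\<lambda>\<omega>. (X \<omega>)\<^sup>2) ^ k"
    by (simp add: \<sigma>_def power_mult)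
  have D: "distr M borel X = distr std_normal_distribution borel (\<lambda>x. \<sigma> * x)"
    using distr_chaos[OF X] by (simp add: \<sigma>_def)
  have "has_bochner_integral lborel (\<lambda>x. \<sigma> ^ (2 * k) * (std_normal_density x * x ^ (2 * k))) (\<sigma> ^ (2 * k) * (fact (2 * k) / (2 ^ k * fact k)))"
    by (intro has_bochner_integral_mult_right std_normal_moment_even)
  then have "has_bochner_integral lborel (\<lambda>x. std_normal_density x *\<^sub>R (\<sigma> * x) ^ (2 * k)) (\<sigma> ^ (2 * k) * (fact (2 * k) / (2 ^ k * fact k)))"
    by (simp add: power_mult_distrib mult_ac)
  then have "has_bochner_integral std_normal_distribution (\<lambda>x. (\<sigma> * x) ^ (2 * k)) (\<sigma> ^ (2 * k) * (fact (2 * k) / (2 ^ k * fact k)))"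
    by (intro has_bochner_integral_density) auto
  then have "has_bochner_integral (distr std_normal_distribution borel (\<lambda>x. \<sigma> * x)) (\<lambda>y. y ^ (2 * k)) (\<sigma> ^ (2 * k) * (fact (2 * k) / (2 ^ k * fact k)))"
    by (intro has_bochner_integral_distr) auto
  then have H: "has_bochner_integral (distr M borel X) (\<lambda>y. y ^ (2 * k)) (\<sigma> ^ (2 * k) * (fact (2 * k) / (2 ^ k * fact k)))"
    by (simp only: D)
  have i: "integrable (distr M borel X) (\<lambda>y. y ^ (2 * k))"
    using H by (rule integrable.intros)
  then show "integrable M (\<lambda>\<omega>. X \<omega> ^ (2 * k))"
    by (subst (asm) integrable_distr_eq) auto
  have "expectation (\<lambda>\<omega>. X \<omega> ^ (2 * k)) = integral\<^sup>L (distr M borel X) (\<lambda>y. y ^ (2 * k))"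
    by (subst integral_distr) auto
  then show "expectation (\<lambda>\<omega>. X \<omega> ^ (2 * k)) = fact (2 * k) / (2 ^ k * fact k) * expectation (\<lambda>\<omega>. (X \<omega>)\<^sup>2) ^ k"
    using has_bochner_integral_integral_eq[OF H] \<sigma> by (metis mult.commute)
qed

end

section \<open>Moments of Gaussian quadratic forms\<close>

text \<open>With S the mean and E the event, integrating one pointwise inequality gives S \<le> S/2
  + S/4 + K S P(E), which is the claim.\<close>

lemma (in prob_space) paley_zygmund:
  fixes R :: "'a \<Rightarrow> real"
  assumes iR: "integrable M R" and iR2: "integrable M (\<lambda>\<omega>. (R \<omega>)\<^sup>2)"
    and R0: "\<And>\<omega>. R \<omega> \<ge> 0" and pos: "expectation R > 0" "K > 0"
    and K: "expectation (\<lambda>\<omega>. (R \<omega>)\<^sup>2) \<le> K * (expectation R)\<^sup>2"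
  shows "prob {\<omega> \<in> space M. R \<omega> \<ge> expectation R / 2} \<ge> 1 / (4 * K)"
proof -
  define S where "S = expectation R"
  define E where "E = {\<omega> \<in> space M. R \<omega> \<ge> S / 2}"
  have [measurable]: "R \<in> borel_measurable M" using iR by simp
  have [measurable]: "E \<in> sets M" unfolding E_def by measurable
  have iE: "integrable M (indicator E :: 'a \<Rightarrow> real)"
    by (rule integrable_real_indicator) (simp_all add: less_top[symmetric])
  have S: "S > 0" using pos by (simp add: S_def)
  \<comment> \<open>Off \<open>E\<close> the term S/2 suffices; on \<open>E\<close> the
    arithmetic-geometric mean inequality bounds R by its square over 4 K S, plus K S.\<close>
  have pw: "R \<omega> \<le> S / 2 + (R \<omega>)\<^sup>2 / (4 * K * S) + K * S * indicator E \<omega>" if "\<omega> \<in> space M" for \<omega>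
  proof (cases "\<omega> \<in> E")
    case True
    have "0 \<le> (R \<omega> - 2 * K * S)\<^sup>2 / (4 * K * S)"
      using S pos by simp
    also have "\<dots> = (R \<omega>)\<^sup>2 / (4 * K * S) - R \<omega> + K * S"
      using S pos by (simp add: field_simps power2_eq_square)
    finally show ?thesis using True S by simp
  next
    case False
    then have "R \<omega> \<le> S / 2" using that by (simp add: E_def)
    moreover have "0 \<le> (R \<omega>)\<^sup>2 / (4 * K * S)" using S pos by simp
    ultimately show ?thesis using False by simp
  qed
  have "S \<le> expectation (\<lambda>\<omega>. S / 2 + (R \<omega>)\<^sup>2 / (4 * K * S) + K * S * indicator E \<omega>)"
    unfolding S_def using iR
    by (intro integral_mono Bochner_Integration.integrable_add integrable_const integrable_divide iR2
        integrable_mult_right iE pw[unfolded S_def]) auto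
  also have "\<dots> = S / 2 + expectation (\<lambda>\<omega>. (R \<omega>)\<^sup>2) / (4 * K * S) + K * S * prob E"
    using iR2 iE by (simp add: prob_space)
  also have "expectation (\<lambda>\<omega>. (R \<omega>)\<^sup>2) / (4 * K * S) \<le> K * S\<^sup>2 / (4 * K * S)"
    using K S pos by (intro divide_right_mono) (auto simp: S_def)
  also have "K * S\<^sup>2 / (4 * K * S) = S / 4"
    using S pos by (simp add: field_simps power2_eq_square)
  finally have "S * (1 / 4) \<le> S * (K * prob E)" by (simp add: algebra_simps)
  then have "1 / 4 \<le> K * prob E" using S by simp
  then show ?thesis using pos by (simp add: E_def S_def field_simps)
qed

text \<open>Bounded moments of order 2r prevent mass from escaping. Where f exceeds \<epsilon>,
  Young's inequality splits \<open>f ^ r\<close> into a small multiple of \<open>f ^ (2 * r)\<close>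
  and a large constant, and the constant is multiplied by a vanishing probability.\<close>

lemma (in prob_space) expectation_power_tendsto_zero:
  fixes f :: "nat \<Rightarrow> 'a \<Rightarrow> real" and r :: nat
  assumes [measurable]: "\<And>n. f n \<in> borel_measurable M" and f0: "\<And>n \<omega>. f n \<omega> \<ge> 0"
    and P: "\<And>\<epsilon>. \<epsilon> > 0 \<Longrightarrow> (\<lambda>n. prob {\<omega> \<in> space M. f n \<omega> > \<epsilon>}) \<longlonglongrightarrow> 0"
    and int: "\<And>n. integrable M (\<lambda>\<omega>. f n \<omega> ^ (2 * r))"
    and K: "\<forall>\<^sub>F n in sequentially. expectation (\<lambda>\<omega>. f n \<omega> ^ (2 * r)) \<le> K" and r: "r > 0"
  shows "(\<lambda>n. expectation (\<lambda>\<omega>. f n \<omega> ^ r)) \<longlonglongrightarrow> 0"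
proof -
  have int2: "integrable M (\<lambda>\<omega>. (f n \<omega> ^ r)\<^sup>2)" for n
    using int[of n] by (simp add: power_mult[symmetric] mult.commute)
  have int1: "integrable M (\<lambda>\<omega>. f n \<omega> ^ r)" for n
    by (rule integrable_of_square) (use int2 in auto)
  have bound: "expectation (\<lambda>\<omega>. f n \<omega> ^ r) \<le> \<epsilon> ^ r + \<eta> * expectation (\<lambda>\<omega>. f n \<omega> ^ (2 * r))
      + 1 / (4 * \<eta>) * prob {\<omega> \<in> space M. f n \<omega> > \<epsilon>}" if "\<epsilon> > 0" "\<eta> > 0" for \<epsilon> \<eta> n
  proof -
    define E where "E = {\<omega> \<in> space M. f n \<omega> > \<epsilon>}"
    have [measurable]: "E \<in> sets M" unfolding E_def by measurable
    have iE: "integrable M (indicator E :: 'a \<Rightarrow> real)"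
      by (rule integrable_real_indicator) (simp_all add: less_top[symmetric])
    have pw: "f n \<omega> ^ r \<le> \<epsilon> ^ r + \<eta> * f n \<omega> ^ (2 * r) + 1 / (4 * \<eta>) * indicator E \<omega>" if "\<omega> \<in> space M" for \<omega>
    proof (cases "\<omega> \<in> E")
      case True
      have "0 \<le> \<eta> * (f n \<omega> ^ r - 1 / (2 * \<eta>))\<^sup>2"
        using \<open>\<eta> > 0\<close> by simp
      also have "\<eta> * (g - 1 / (2 * \<eta>))\<^sup>2 = \<eta> * g\<^sup>2 - g + 1 / (4 * \<eta>)" for g
        using \<open>\<eta> > 0\<close> by (simp add: power2_eq_square field_simps)
      finally have "0 \<le> \<eta> * f n \<omega> ^ (2 * r) - f n \<omega> ^ r + 1 / (4 * \<eta>)"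
        by (simp only: power_even_eq)
      moreover have "0 \<le> \<epsilon> ^ r" using \<open>\<epsilon> > 0\<close> by simp
      moreover have "indicator E \<omega> = (1::real)" using True by simp
      ultimately show ?thesis by simp
    next
      case False
      then have "f n \<omega> ^ r \<le> \<epsilon> ^ r"
        using that f0 by (intro power_mono) (auto simp: E_def)
      moreover have "0 \<le> \<eta> * f n \<omega> ^ (2 * r)"
        using \<open>\<eta> > 0\<close> by (simp add: power_mult)
      ultimately show ?thesis using False by simp
    qed
    have "expectation (\<lambda>\<omega>. f n \<omega> ^ r) \<le> expectation (\<lambda>\<omega>. \<epsilon> ^ r + \<eta> * f n \<omega> ^ (2 * r) + 1 / (4 * \<eta>) * indicator E \<omega>)"
      by (intro integral_mono Bochner_Integration.integrable_add integrable_const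
          integrable_mult_right iE pw int int1)
    also have "\<dots> = \<epsilon> ^ r + \<eta> * expectation (\<lambda>\<omega>. f n \<omega> ^ (2 * r)) + 1 / (4 * \<eta>) * prob E"
      using int iE by (simp add: prob_space)
    finally show ?thesis by (simp add: E_def)
  qed
  have nonneg: "expectation (\<lambda>\<omega>. f n \<omega> ^ r) \<ge> 0" for n
    using f0 by (intro integral_nonneg_AE) auto
  define K' where "K' = max K 1"
  have ev: "\<forall>\<^sub>F n in sequentially. expectation (\<lambda>\<omega>. f n \<omega> ^ r) < e" if e: "e > 0" for e
  proof -
    \<comment> \<open>Both parameters are fixed before n: each of the three terms of
      \<open>bound\<close> becomes at most e/4. Taking \<open>K'\<close> at least 1 keeps \<eta>
      finite and positive.\<close>
    define \<epsilon> where "\<epsilon> = min 1 (e / 4)"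
    define \<eta> where "\<eta> = e / (4 * K')"
    have K'1: "K' \<ge> 1" by (simp add: K'_def)
    have \<epsilon>: "\<epsilon> > 0" "\<epsilon> ^ r \<le> e / 4"
    proof -
      show "\<epsilon> > 0" using e by (simp add: \<epsilon>_def)
      have "\<epsilon> ^ r \<le> \<epsilon> ^ 1"
        using e r by (intro power_decreasing) (auto simp: \<epsilon>_def)
      then show "\<epsilon> ^ r \<le> e / 4" by (simp add: \<epsilon>_def)
    qed
    have \<eta>: "\<eta> > 0" using e K'1 by (simp add: \<eta>_def)
    have "\<forall>\<^sub>F n in sequentially. prob {\<omega> \<in> space M. f n \<omega> > \<epsilon>} < \<eta> * e"
      using P[OF \<epsilon>(1)] e \<eta> by (intro order_tendstoD) auto
    with K show ?thesis
    proof eventually_elim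
      case (elim n)
      have "\<eta> * expectation (\<lambda>\<omega>. f n \<omega> ^ (2 * r)) \<le> \<eta> * K'"
        using elim \<eta> by (intro mult_left_mono) (auto simp: K'_def)
      also have "\<dots> = e / 4" using K'1 by (simp add: \<eta>_def)
      finally have 1: "\<eta> * expectation (\<lambda>\<omega>. f n \<omega> ^ (2 * r)) \<le> e / 4" .
      have "1 / (4 * \<eta>) * prob {\<omega> \<in> space M. f n \<omega> > \<epsilon>} \<le> 1 / (4 * \<eta>) * (\<eta> * e)"
        using elim \<eta> by (intro mult_left_mono) auto
      also have "\<dots> = e / 4" using \<eta> by simp
      finally show ?case
        using bound[OF \<epsilon>(1) \<eta>, of n] 1 \<epsilon>(2) e by linarith
    qed
  qed
  show ?thesis
  proof (rule order_tendstoI)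
    fix a :: real assume "a < 0"
    then show "\<forall>\<^sub>F n in sequentially. a < expectation (\<lambda>\<omega>. f n \<omega> ^ r)"
      using nonneg by (intro always_eventually allI) (rule less_le_trans)
  qed (rule ev)
qed

lemma convex_on_power_nonneg: "convex_on {0::real..} (\<lambda>x. x ^ k)"
  by (cases "even k") (auto intro: convex_power_odd convex_on_subset[OF convex_power_even])

context gaussian_sequence
begin

text \<open>Wick's formula for X, X, Y, Y. Polarisation writes the product of squares through fourth
  powers of X + Y, X - Y, X and Y; these all lie in the chaos, where the fourth moment is 3 times
  the squared variance.\<close>

lemma chaos_fourth_moment:
  assumes X: "X \<in> first_wiener_chaos M N" and Y: "Y \<in> first_wiener_chaos M N"
  shows "integrable M (\<lambda>\<omega>. (X \<omega>)\<^sup>2 * (Y \<omega>)\<^sup>2)"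
    and "expectation (\<lambda>\<omega>. (X \<omega>)\<^sup>2 * (Y \<omega>)\<^sup>2)
      = expectation (\<lambda>\<omega>. (X \<omega>)\<^sup>2) * expectation (\<lambda>\<omega>. (Y \<omega>)\<^sup>2) + 2 * (expectation (\<lambda>\<omega>. X \<omega> * Y \<omega>))\<^sup>2"
proof -
  note [measurable] = chaos_measurable[OF X] chaos_measurable[OF Y]
  define a where "a = expectation (\<lambda>\<omega>. (X \<omega>)\<^sup>2)"
  define b where "b = expectation (\<lambda>\<omega>. (Y \<omega>)\<^sup>2)"
  define c where "c = expectation (\<lambda>\<omega>. X \<omega> * Y \<omega>)"
  note i = chaos_square_integrable[OF X] chaos_square_integrable[OF Y]
  have ixy: "integrable M (\<lambda>\<omega>. X \<omega> * Y \<omega>)"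
    by (intro integrable_mult_of_squares i) simp_all
  have f4: "fact (2 * 2) / (2 ^ 2 * fact 2) = (3::real)" by (simp add: fact_numeral)
  have m4: "integrable M (\<lambda>\<omega>. Z \<omega> ^ 4)" "expectation (\<lambda>\<omega>. Z \<omega> ^ 4) = 3 * (expectation (\<lambda>\<omega>. (Z \<omega>)\<^sup>2))\<^sup>2"
    if "Z \<in> first_wiener_chaos M N" for Z
    using chaos_moment[OF that, of 2] unfolding f4 by simp_all
  have P: "(\<lambda>\<omega>. X \<omega> + Y \<omega>) \<in> first_wiener_chaos M N"
    by (rule chaos_add[OF X Y])
  have D: "(\<lambda>\<omega>. X \<omega> - Y \<omega>) \<in> first_wiener_chaos M N"
    using chaos_add[OF X chaos_scale[OF Y, of "- 1"]] by simp
  have eP: "expectation (\<lambda>\<omega>. (X \<omega> + Y \<omega>)\<^sup>2) = a + b + 2 * c"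
    using i ixy by (simp add: power2_sum a_def b_def c_def mult.assoc)
  have eD: "expectation (\<lambda>\<omega>. (X \<omega> - Y \<omega>)\<^sup>2) = a + b - 2 * c"
    using i ixy by (simp add: power2_diff a_def b_def c_def mult.assoc)
  have pw: "x\<^sup>2 * y\<^sup>2 = (1 / 12) * ((x + y) ^ 4 + (x - y) ^ 4 - 2 * x ^ 4 - 2 * y ^ 4)" for x y :: real
    by (simp add: power4_eq_xxxx power2_eq_square algebra_simps)
  show "integrable M (\<lambda>\<omega>. (X \<omega>)\<^sup>2 * (Y \<omega>)\<^sup>2)"
    unfolding pw using m4(1)[OF X] m4(1)[OF Y] m4(1)[OF P] m4(1)[OF D] by simp
  have "expectation (\<lambda>\<omega>. (X \<omega>)\<^sup>2 * (Y \<omega>)\<^sup>2) = (1 / 12) * (3 * (a + b + 2 * c)\<^sup>2 + 3 * (a + b - 2 * c)\<^sup>2 - 2 * (3 * a\<^sup>2) - 2 * (3 * b\<^sup>2))"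
    unfolding pw using m4[OF X] m4[OF Y] m4[OF P] m4[OF D] by (simp add: eP eD a_def b_def)
  also have "\<dots> = a * b + 2 * c\<^sup>2"
    by (simp add: power2_eq_square algebra_simps)
  finally show "expectation (\<lambda>\<omega>. (X \<omega>)\<^sup>2 * (Y \<omega>)\<^sup>2)
      = expectation (\<lambda>\<omega>. (X \<omega>)\<^sup>2) * expectation (\<lambda>\<omega>. (Y \<omega>)\<^sup>2) + 2 * (expectation (\<lambda>\<omega>. X \<omega> * Y \<omega>))\<^sup>2"
    by (simp only: a_def b_def c_def)
qed

text \<open>Summing Wick's formula over all pairs, the products of variances form the squared mean
  and the squared covariances remain. Thus an upper bound on the fluctuation of Q is one on the
  Hilbert-Schmidt norm.\<close>

lemma chaos_quad_variance:
  fixes d :: nat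
  assumes Y: "\<And>i. i < d \<Longrightarrow> Y i \<in> first_wiener_chaos M N"
  defines "Q \<equiv> \<lambda>\<omega>. \<Sum>i<d. (Y i \<omega>)\<^sup>2"
  shows "integrable M Q" "integrable M (\<lambda>\<omega>. (Q \<omega>)\<^sup>2)" "variance Q = 2 * (hs_covariance d Y)\<^sup>2"
proof -
  have i1: "integrable M (\<lambda>\<omega>. (Y i \<omega>)\<^sup>2)" if "i < d" for i
    using Y[OF that] by (rule chaos_square_integrable)
  show iQ: "integrable M Q"
    unfolding Q_def using i1 by (intro Bochner_Integration.integrable_sum) auto
  have Q2: "(Q \<omega>)\<^sup>2 = (\<Sum>i<d. \<Sum>j<d. (Y i \<omega>)\<^sup>2 * (Y j \<omega>)\<^sup>2)" for \<omega>
    by (simp add: Q_def power2_eq_square[of "sum _ _"] sum_product)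
  have ij: "integrable M (\<lambda>\<omega>. (Y i \<omega>)\<^sup>2 * (Y j \<omega>)\<^sup>2)" if "i < d" "j < d" for i j
    using chaos_fourth_moment(1) Y that by blast
  have ii: "integrable M (\<lambda>\<omega>. \<Sum>j<d. (Y i \<omega>)\<^sup>2 * (Y j \<omega>)\<^sup>2)" if "i < d" for i
    using ij that by (intro Bochner_Integration.integrable_sum) auto
  show iQ2: "integrable M (\<lambda>\<omega>. (Q \<omega>)\<^sup>2)"
    unfolding Q2 using ii by - (rule Bochner_Integration.integrable_sum, simp)
  have EQ: "expectation Q = (\<Sum>i<d. expectation (\<lambda>\<omega>. (Y i \<omega>)\<^sup>2))"
    unfolding Q_def using i1 by simp
  have "expectation (\<lambda>\<omega>. (Q \<omega>)\<^sup>2) = (\<Sum>i<d. \<Sum>j<d. expectation (\<lambda>\<omega>. (Y i \<omega>)\<^sup>2 * (Y j \<omega>)\<^sup>2))"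
    unfolding Q2 using ii ij by simp
  also have "\<dots> = (\<Sum>i<d. \<Sum>j<d. expectation (\<lambda>\<omega>. (Y i \<omega>)\<^sup>2) * expectation (\<lambda>\<omega>. (Y j \<omega>)\<^sup>2) + 2 * (expectation (\<lambda>\<omega>. Y i \<omega> * Y j \<omega>))\<^sup>2)"
    using Y by (intro sum.cong refl chaos_fourth_moment(2)) auto
  also have "\<dots> = (\<Sum>i<d. \<Sum>j<d. expectation (\<lambda>\<omega>. (Y i \<omega>)\<^sup>2) * expectation (\<lambda>\<omega>. (Y j \<omega>)\<^sup>2))
      + 2 * (\<Sum>i<d. \<Sum>j<d. (expectation (\<lambda>\<omega>. Y i \<omega> * Y j \<omega>))\<^sup>2)"
    by (simp add: sum.distrib sum_distrib_left)
  also have "(\<Sum>i<d. \<Sum>j<d. expectation (\<lambda>\<omega>. (Y i \<omega>)\<^sup>2) * expectation (\<lambda>\<omega>. (Y j \<omega>)\<^sup>2)) = (expectation Q)\<^sup>2"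
    unfolding EQ power2_eq_square[of "sum _ _"] sum_product ..
  also have "(\<Sum>i<d. \<Sum>j<d. (expectation (\<lambda>\<omega>. Y i \<omega> * Y j \<omega>))\<^sup>2) = (hs_covariance d Y)\<^sup>2"
    by (simp add: hs_covariance_def sum_nonneg)
  finally show "variance Q = 2 * (hs_covariance d Y)\<^sup>2"
    using variance_eq[OF iQ iQ2] by simp
qed

text \<open>Jensen's inequality with weights proportional to the variances; the summand
  \<open>1 / card I\<close> only keeps the weights positive.\<close>

lemma chaos_quad_moment:
  fixes X :: "'i \<Rightarrow> 'a \<Rightarrow> real" and k :: nat
  assumes I: "finite I" "I \<noteq> {}" and X: "\<And>i. i \<in> I \<Longrightarrow> X i \<in> first_wiener_chaos M N"
  defines "R \<equiv> \<lambda>\<omega>. \<Sum>i\<in>I. (X i \<omega>)\<^sup>2"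
  shows "integrable M (\<lambda>\<omega>. R \<omega> ^ k)"
    and "expectation (\<lambda>\<omega>. R \<omega> ^ k) \<le> fact (2 * k) / (2 ^ k * fact k) * (expectation R + 1) ^ k"
proof -
  have [measurable]: "X i \<in> borel_measurable M" if "i \<in> I" for i
    using X[OF that] by (rule chaos_measurable)
  have [measurable]: "R \<in> borel_measurable M" unfolding R_def by measurable
  define C :: real where "C = fact (2 * k) / (2 ^ k * fact k)"
  define v where "v i = expectation (\<lambda>\<omega>. (X i \<omega>)\<^sup>2)" for i
  define w where "w i = v i + 1 / real (card I)" for i
  define S where "S = (\<Sum>i\<in>I. w i)"
  have v0: "v i \<ge> 0" for i by (simp add: v_def)
  have c0: "card I > 0" using I by (simp add: card_gt_0_iff)
  then have w0: "w i > 0" for i using v0[of i] by (simp add: w_def add_nonneg_pos)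
  then have S0: "S > 0" unfolding S_def using I by (intro sum_pos) auto
  have ER: "expectation R = (\<Sum>i\<in>I. v i)"
    unfolding R_def v_def using X chaos_square_integrable by simp
  have S: "S = expectation R + 1"
    using c0 by (simp add: S_def w_def sum.distrib ER)
  \<comment> \<open>Jensen for the k-th power with weights \<open>w i / S\<close>, at the points
    where the square of \<open>X i \<omega>\<close> is multiplied by \<open>S / w i\<close>; their
    weighted mean is \<open>R \<omega>\<close>.\<close>
  have pw: "R \<omega> ^ k \<le> (\<Sum>i\<in>I. w i / S * (S / w i) ^ k * X i \<omega> ^ (2 * k))" for \<omega>
  proof -
    have "(\<lambda>x. x ^ k) (\<Sum>i\<in>I. (w i / S) *\<^sub>R ((X i \<omega>)\<^sup>2 * (S / w i))) \<le> (\<Sum>i\<in>I. w i / S * (\<lambda>x. x ^ k) ((X i \<omega>)\<^sup>2 * (S / w i)))"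
    proof (rule convex_on_sum[OF I convex_on_power_nonneg])
      show "(\<Sum>i\<in>I. w i / S) = 1"
        using S0 by (simp add: S_def[symmetric] sum_divide_distrib[symmetric])
    qed (auto intro!: mult_nonneg_nonneg divide_nonneg_nonneg less_imp_le[OF w0] less_imp_le[OF S0])
    moreover have "(\<Sum>i\<in>I. (w i / S) *\<^sub>R ((X i \<omega>)\<^sup>2 * (S / w i))) = R \<omega>"
      unfolding R_def using w0 S0 less_imp_neq[OF w0] by (intro sum.cong) (auto simp: field_simps)
    moreover have "w i / S * ((X i \<omega>)\<^sup>2 * (S / w i)) ^ k = w i / S * (S / w i) ^ k * X i \<omega> ^ (2 * k)" for i
      unfolding power_mult_distrib power_mult by (simp only: mult_ac)
    ultimately show ?thesis by (simp only:)
  qed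
  have im: "integrable M (\<lambda>\<omega>. \<Sum>i\<in>I. w i / S * (S / w i) ^ k * X i \<omega> ^ (2 * k))"
    using X by (intro Bochner_Integration.integrable_sum integrable_mult_right chaos_moment(1))
  have R0: "R \<omega> \<ge> 0" for \<omega> by (simp add: R_def sum_nonneg)
  show iR: "integrable M (\<lambda>\<omega>. R \<omega> ^ k)"
    by (rule Bochner_Integration.integrable_bound[OF im])
      (use pw R0 in \<open>auto intro!: AE_I2 order_trans[OF pw]\<close>)
  have "expectation (\<lambda>\<omega>. R \<omega> ^ k) \<le> expectation (\<lambda>\<omega>. \<Sum>i\<in>I. w i / S * (S / w i) ^ k * X i \<omega> ^ (2 * k))"
    by (intro integral_mono iR im pw)
  also have "\<dots> = (\<Sum>i\<in>I. w i / S * (S / w i) ^ k * (C * v i ^ k))"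
    using chaos_moment[OF X] by (simp add: C_def v_def mult_ac)
  also have "\<dots> \<le> (\<Sum>i\<in>I. w i / S * (C * S ^ k))"
  proof (rule sum_mono)
    fix i
    \<comment> \<open>Since v \<le> w, the factor \<open>(S / w i) ^ k\<close> cancels against the
      moment bound, so the estimate does not depend on the number of summands.\<close>
    have "(S / w i) ^ k * (C * v i ^ k) \<le> (S / w i) ^ k * (C * w i ^ k)"
      using v0[of i] w0[of i] S0 c0
      by (intro mult_left_mono power_mono) (auto simp: C_def w_def)
    also have "\<dots> = C * S ^ k"
      using w0[of i] by (simp add: power_divide)
    finally show "w i / S * (S / w i) ^ k * (C * v i ^ k) \<le> w i / S * (C * S ^ k)"
      unfolding mult.assoc using w0[of i] S0 by (intro mult_left_mono) auto
  qed
  also have "\<dots> = C * S ^ k"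
    using S0 by (simp add: sum_distrib_right[symmetric] sum_divide_distrib[symmetric] S_def[symmetric])
  finally show "expectation (\<lambda>\<omega>. R \<omega> ^ k) \<le> fact (2 * k) / (2 ^ k * fact k) * (expectation R + 1) ^ k"
    by (simp add: C_def S)
qed

end

section \<open>Gram matrices and coercivity\<close>

text \<open>The norm of a matrix as a vector of rows is the Frobenius norm; Cauchy-Schwarz applies
  row by row.\<close>

lemma norm_matrix_vector_mult_le:
  fixes A :: "real^'n^'m"
  shows "norm (A *v x) \<le> norm A * norm x"
proof -
  have "norm (A *v x) = L2_set (\<lambda>i. norm (inner (A $ i) x)) UNIV"
    by (simp add: norm_vec_def[of "A *v x"] matrix_vector_mul_component)
  also have "\<dots> \<le> L2_set (\<lambda>i. norm (A $ i) * norm x) UNIV"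
    by (intro L2_set_mono) (auto simp: Cauchy_Schwarz_ineq2)
  also have "\<dots> = norm A * norm x"
    by (simp add: norm_vec_def[of A] L2_set_left_distrib[symmetric])
  finally show ?thesis .
qed

lemma abs_inner_matrix_vector_le:
  fixes A :: "real^'n^'n"
  shows "\<bar>inner x (A *v x)\<bar> \<le> norm A * (norm x)\<^sup>2"
proof -
  have "\<bar>inner x (A *v x)\<bar> \<le> norm x * norm (A *v x)"
    by (rule Cauchy_Schwarz_ineq2)
  also have "\<dots> \<le> norm x * (norm A * norm x)"
    by (intro mult_left_mono norm_matrix_vector_mult_le) simp
  finally show ?thesis by (simp add: power2_eq_square mult_ac)
qed

lemma abs_matrix_entry_le:
  fixes A :: "real^'n^'m"
  shows "\<bar>A $ i $ j\<bar> \<le> norm A"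
  using component_le_norm_cart[of "A $ i" j] Finite_Cartesian_Product.norm_nth_le[of A i] by linarith

lemma norm_matrix_le_entries:
  fixes A :: "real^'n^'m"
  assumes "\<And>i j. \<bar>A $ i $ j\<bar> \<le> K"
  shows "norm A \<le> real (CARD('m)) * real (CARD('n)) * K"
proof -
  have "norm A \<le> (\<Sum>i\<in>UNIV. norm (A $ i))"
    unfolding norm_vec_def[of A] by (rule L2_set_le_sum) simp
  also have "\<dots> \<le> (\<Sum>i\<in>(UNIV::'m set). \<Sum>j\<in>(UNIV::'n set). K)"
    by (intro sum_mono order_trans[OF norm_le_l1_cart] assms)
  finally show ?thesis by simp
qed

lemma gram_quadratic_form:
  fixes b :: "nat \<Rightarrow> 'p::finite \<Rightarrow> real"
  shows "inner x (gram_matrix n b *v x) = (\<Sum>i<n. (\<Sum>j\<in>UNIV. x $ j * b i j)\<^sup>2)"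
proof -
  have "inner x (gram_matrix n b *v x) = (\<Sum>j\<in>UNIV. x $ j * (\<Sum>k\<in>UNIV. (\<Sum>i<n. b i j * b i k) * x $ k))"
    by (simp add: inner_vec_def matrix_vector_mult_def gram_matrix_def)
  also have "\<dots> = (\<Sum>j\<in>UNIV. \<Sum>k\<in>UNIV. \<Sum>i<n. (x $ j * b i j) * (x $ k * b i k))"
    by (simp add: sum_distrib_left sum_distrib_right mult_ac)
  also have "\<dots> = (\<Sum>j\<in>UNIV. \<Sum>i<n. \<Sum>k\<in>UNIV. (x $ j * b i j) * (x $ k * b i k))"
    by (intro sum.cong refl sum.swap)
  also have "\<dots> = (\<Sum>i<n. \<Sum>j\<in>UNIV. \<Sum>k\<in>UNIV. (x $ j * b i j) * (x $ k * b i k))"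
    by (rule sum.swap)
  finally show ?thesis
    by (simp add: power2_eq_square sum_product)
qed

lemma gram_trace:
  fixes b :: "nat \<Rightarrow> 'p::finite \<Rightarrow> real"
  shows "(\<Sum>j\<in>UNIV. gram_matrix n b $ j $ j) = (\<Sum>i<n. \<Sum>j\<in>UNIV. (b i j)\<^sup>2)"
  unfolding gram_matrix_def by (simp add: power2_eq_square) (rule sum.swap)

text \<open>A Gram matrix is a sum of rank-one matrices built from the rows of \<open>b\<close>, and
  the Frobenius norm of each is the squared length of its row.\<close>

lemma norm_gram_le:
  fixes b :: "nat \<Rightarrow> 'p::finite \<Rightarrow> real"
  shows "norm (gram_matrix n b) \<le> (\<Sum>i<n. \<Sum>j\<in>UNIV. (b i j)\<^sup>2)"
proof -
  have r: "norm (\<chi> j k. u j * u k :: real^'p^'p) = (\<Sum>j\<in>UNIV. (u j)\<^sup>2)" for u :: "'p \<Rightarrow> real"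
  proof -
    have "norm (\<chi> k. u j * u k :: real^'p) = \<bar>u j\<bar> * L2_set u UNIV" for j
      by (simp add: norm_vec_def L2_set_right_distrib abs_mult) (simp add: L2_set_def power_mult_distrib)
    then have "norm (\<chi> j k. u j * u k :: real^'p^'p) = L2_set (\<lambda>j. \<bar>u j\<bar> * L2_set u UNIV) UNIV"
      by (simp add: norm_vec_def[of "\<chi> j k. u j * u k :: real^'p^'p"])
    also have "\<dots> = L2_set u UNIV * L2_set u UNIV"
      by (simp add: L2_set_left_distrib[symmetric]) (simp add: L2_set_def)
    also have "\<dots> = (\<Sum>j\<in>UNIV. (u j)\<^sup>2)"
      by (simp add: L2_set_def sum_nonneg)
    finally show ?thesis .
  qed
  have "gram_matrix n b = (\<Sum>i<n. (\<chi> j k. b i j * b i k))"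
    by (simp add: gram_matrix_def vec_eq_iff)
  then have "norm (gram_matrix n b) \<le> (\<Sum>i<n. norm (\<chi> j k. b i j * b i k :: real^'p^'p))"
    by (simp add: norm_sum)
  then show ?thesis by (simp only: r)
qed

text \<open>This is |B^T (B x)|^2 \<le> |B|^2 |B x|^2 in the Frobenius norm, written through the
  Gram matrix alone. In that form it passes to limits of Gram matrices, where no B is
  available.\<close>

lemma gram_image_norm_le:
  fixes b :: "nat \<Rightarrow> 'p::finite \<Rightarrow> real"
  shows "(norm (gram_matrix n b *v x))\<^sup>2 \<le> (\<Sum>j\<in>UNIV. gram_matrix n b $ j $ j) * inner x (gram_matrix n b *v x)"
proof -
  define y where "y i = (\<Sum>j\<in>UNIV. x $ j * b i j)" for i
  have comp: "(gram_matrix n b *v x) $ j = (\<Sum>i<n. b i j * y i)" for j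
  proof -
    have "(gram_matrix n b *v x) $ j = (\<Sum>k\<in>UNIV. \<Sum>i<n. b i j * (x $ k * b i k))"
      by (simp add: matrix_vector_mult_def gram_matrix_def sum_distrib_left sum_distrib_right mult_ac)
    also have "\<dots> = (\<Sum>i<n. b i j * y i)"
      by (subst sum.swap) (simp add: y_def sum_distrib_left)
    finally show ?thesis .
  qed
  have "(norm (gram_matrix n b *v x))\<^sup>2 = (\<Sum>j\<in>UNIV. (\<Sum>i<n. b i j * y i)\<^sup>2)"
    unfolding power2_norm_eq_inner inner_vec_def comp by (simp add: power2_eq_square)
  also have "\<dots> \<le> (\<Sum>j\<in>UNIV. (\<Sum>i<n. (b i j)\<^sup>2) * (\<Sum>i<n. (y i)\<^sup>2))"
    by (intro sum_mono Cauchy_Schwarz_ineq_sum)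
  also have "\<dots> = (\<Sum>j\<in>UNIV. gram_matrix n b $ j $ j) * (\<Sum>i<n. (y i)\<^sup>2)"
    unfolding sum_distrib_right[symmetric] by (simp add: gram_matrix_def power2_eq_square)
  also have "(\<Sum>i<n. (y i)\<^sup>2) = inner x (gram_matrix n b *v x)"
    by (simp only: gram_quadratic_form y_def)
  finally show ?thesis .
qed

section \<open>Inverses and determinants of coercive matrices\<close>

lemma matrix_inv_inverse:
  fixes A :: "real^'p^'p"
  assumes "invertible A"
  shows matrix_inv_right: "A ** matrix_inv A = mat 1" and matrix_inv_left: "matrix_inv A ** A = mat 1"
  using someI_ex[OF assms[unfolded invertible_def]] by (simp_all add: matrix_inv_def)

text \<open>On a unit vector Cauchy-Schwarz bounds |A v| below by 1/\<kappa>; by homogeneity A is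
  injective, hence invertible in finite dimension, and the same bound read backwards controls the
  inverse.\<close>

lemma coercive_imp_inverse_bound:
  fixes A :: "real^'p^'p"
  assumes \<kappa>: "\<kappa> > 0" and A: "\<And>v. norm v = 1 \<Longrightarrow> 1 / \<kappa> \<le> inner v (A *v v)"
  shows "invertible A" and "norm (matrix_inv A *v y) \<le> \<kappa> * norm y"
proof -
  have low: "norm x \<le> \<kappa> * norm (A *v x)" for x
  proof (cases "x = 0")
    case False
    define v where "v = (1 / norm x) *\<^sub>R x"
    have v: "norm v = 1" using False by (simp add: v_def)
    have "1 / \<kappa> \<le> inner v (A *v v)" by (rule A[OF v])
    also have "\<dots> \<le> norm v * norm (A *v v)" by (rule norm_cauchy_schwarz)
    also have "\<dots> = norm (A *v x) / norm x"
      using False by (simp add: v_def matrix_vector_mult_scaleR)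
    finally show ?thesis using False \<kappa> by (simp add: field_simps)
  qed simp
  have "A *v x = 0 \<Longrightarrow> x = 0" for x
    using low[of x] by simp
  then show inv: "invertible A"
    unfolding invertible_left_inverse matrix_left_invertible_ker by blast
  have "A *v (matrix_inv A *v y) = y"
    by (simp add: matrix_vector_mul_assoc matrix_inv_right[OF inv])
  then show "norm (matrix_inv A *v y) \<le> \<kappa> * norm y"
    using low[of "matrix_inv A *v y"] by simp
qed

lemma abs_matrix_entry_le_of_operator_bound:
  fixes C :: "real^'n^'m"
  assumes "\<And>y. norm (C *v y) \<le> K * norm y"
  shows "\<bar>C $ i $ j\<bar> \<le> K"
proof -
  have "\<bar>C $ i $ j\<bar> = \<bar>(C *v axis j 1) $ i\<bar>"
    by (simp add: matrix_vector_mult_basis column_def)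
  also have "\<dots> \<le> norm (C *v axis j 1)"
    by (rule component_le_norm_cart)
  also have "\<dots> \<le> K" using assms[of "axis j 1"] by simp
  finally show ?thesis .
qed

lemma abs_det_le_entries:
  fixes C :: "real^'p^'p"
  assumes "\<And>i j. \<bar>C $ i $ j\<bar> \<le> K"
  shows "\<bar>det C\<bar> \<le> fact (CARD('p)) * K ^ CARD('p)"
proof -
  have K: "K \<ge> 0" using assms[of undefined undefined] by linarith
  have "\<bar>det C\<bar> \<le> (\<Sum>p | p permutes (UNIV::'p set). \<bar>of_int (sign p) * (\<Prod>i\<in>UNIV. C $ i $ p i)\<bar>)"
    unfolding det_def by (rule sum_abs)
  also have "\<dots> \<le> (\<Sum>p | p permutes (UNIV::'p set). K ^ CARD('p))"
  proof (rule sum_mono)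
    fix p :: "'p \<Rightarrow> 'p"
    have "\<bar>of_int (sign p) * (\<Prod>i\<in>UNIV. C $ i $ p i)\<bar> = (\<Prod>i\<in>UNIV. \<bar>C $ i $ p i\<bar>)"
      by (simp add: abs_mult abs_prod sign_def)
    also have "\<dots> \<le> (\<Prod>i\<in>(UNIV::'p set). K)"
      by (intro prod_mono) (use assms in auto)
    finally show "\<bar>of_int (sign p) * (\<Prod>i\<in>UNIV. C $ i $ p i)\<bar> \<le> K ^ CARD('p)" by simp
  qed
  also have "\<dots> = fact (CARD('p)) * K ^ CARD('p)"
    by (simp add: card_permutations)
  finally show ?thesis .
qed

text \<open>1/|det A| is the determinant of the inverse up to sign. All entries of the inverse are
  at most \<kappa>, and the Leibniz formula has p! terms.\<close>

lemma coercive_imp_det_bound: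
  fixes A :: "real^'p^'p"
  assumes \<kappa>: "\<kappa> > 0" and A: "\<And>v. norm v = 1 \<Longrightarrow> 1 / \<kappa> \<le> inner v (A *v v)"
  shows "det A \<noteq> 0" and "1 / \<bar>det A\<bar> \<le> fact (CARD('p)) * \<kappa> ^ CARD('p)"
proof -
  note inv = coercive_imp_inverse_bound(1)[OF \<kappa> A] and bd = coercive_imp_inverse_bound(2)[OF \<kappa> A]
  show d: "det A \<noteq> 0" using inv by (simp add: invertible_det_nz)
  have "det A * det (matrix_inv A) = 1"
    using arg_cong[OF matrix_inv_right[OF inv], of det] by (simp add: det_mul)
  then have "1 / \<bar>det A\<bar> = \<bar>det (matrix_inv A)\<bar>"
    using d by (simp add: field_simps abs_mult[symmetric])
  also have "\<dots> \<le> fact (CARD('p)) * \<kappa> ^ CARD('p)"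
    by (intro abs_det_le_entries abs_matrix_entry_le_of_operator_bound bd)
  finally show "1 / \<bar>det A\<bar> \<le> fact (CARD('p)) * \<kappa> ^ CARD('p)" .
qed

text \<open>Resolvent identity: the difference of the inverses is the inverse of A times S - A times
  the inverse of S. The factor p^2 arises from recovering the Frobenius norm from single
  entries.\<close>

lemma coercive_imp_inverse_diff_bound:
  fixes A S :: "real^'p^'p"
  assumes \<kappa>: "\<kappa> > 0" and A: "\<And>v. norm v = 1 \<Longrightarrow> 1 / \<kappa> \<le> inner v (A *v v)" and S: "invertible S"
  shows "norm (matrix_inv A - matrix_inv S) \<le> (real (CARD('p)))\<^sup>2 * norm (matrix_inv S) * (\<kappa> * norm (A - S))"
proof -
  note inv = coercive_imp_inverse_bound(1)[OF \<kappa> A] and bd = coercive_imp_inverse_bound(2)[OF \<kappa> A]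
  have "norm ((matrix_inv A - matrix_inv S) *v y) \<le> (norm (matrix_inv S) * (\<kappa> * norm (A - S))) * norm y" for y
  proof -
    have "(matrix_inv A - matrix_inv S) *v y = matrix_inv A *v ((S - A) *v (matrix_inv S *v y))"
    proof -
      have "matrix_inv A *v (S *v (matrix_inv S *v y)) = matrix_inv A *v y"
        by (simp add: matrix_vector_mul_assoc matrix_inv_right[OF S])
      moreover have "matrix_inv A *v (A *v (matrix_inv S *v y)) = matrix_inv S *v y"
        by (simp add: matrix_vector_mul_assoc matrix_mul_assoc matrix_inv_left[OF inv])
      ultimately show ?thesis
        by (simp add: matrix_vector_mult_diff_rdistrib matrix_vector_mult_diff_distrib)
    qed
    then have "norm ((matrix_inv A - matrix_inv S) *v y) \<le> \<kappa> * norm ((S - A) *v (matrix_inv S *v y))"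
      using bd by simp
    also have "\<dots> \<le> \<kappa> * (norm (S - A) * (norm (matrix_inv S) * norm y))"
      using \<kappa> by (intro mult_left_mono order_trans[OF norm_matrix_vector_mult_le] norm_matrix_vector_mult_le) auto
    finally show ?thesis by (simp add: norm_minus_commute mult_ac)
  qed
  then have "\<bar>(matrix_inv A - matrix_inv S) $ i $ j\<bar> \<le> norm (matrix_inv S) * (\<kappa> * norm (A - S))" for i j
    by (rule abs_matrix_entry_le_of_operator_bound)
  from norm_matrix_le_entries[OF this] show ?thesis
    by (simp add: power2_eq_square mult_ac)
qed

section \<open>Coercivity of a quadratic form from an integral over the whole space\<close>

lemma nn_integral_inverse_power_finite:
  "(\<integral>\<^sup>+x. ennreal (1 / (1 + norm (x::'b::euclidean_space)) ^ (DIM('b) + 2)) \<partial>lborel) < \<infinity>"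
proof -
  let ?p = "DIM('b)"
  define c where "c = measure lborel (ball (0::'b) 1)"
  \<comment> \<open>The integrand is dominated by a sum over whole balls of integer radius instead
    of shells: the volume takes DIM of the DIM + 2 powers, and the remaining two make the series
    summable.\<close>
  define g where "g k x = ennreal (1 / real (k + 1) ^ (?p + 2)) * indicator (ball (0::'b) (real (k + 1))) x" for k x
  have "(\<integral>\<^sup>+x. ennreal (1 / (1 + norm (x::'b)) ^ (?p + 2)) \<partial>lborel) \<le> (\<integral>\<^sup>+x. (\<Sum>k. g k x) \<partial>lborel)"
  proof (rule nn_integral_mono)
    fix x :: 'b
    define k where "k = nat \<lfloor>norm x\<rfloor>"
    have k: "real k \<le> norm x" "norm x < real k + 1"
      by (simp_all add: k_def)
    have "ennreal (1 / (1 + norm x) ^ (?p + 2)) \<le> ennreal (1 / real (k + 1) ^ (?p + 2))"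
      using k by (intro ennreal_leI divide_left_mono power_mono) auto
    also have "\<dots> = g k x" using k by (simp add: g_def)
    also have "\<dots> = (\<Sum>k\<in>{k}. g k x)" by simp
    also have "\<dots> \<le> (\<Sum>k. g k x)" by (rule sum_le_suminf) auto
    finally show "ennreal (1 / (1 + norm x) ^ (?p + 2)) \<le> (\<Sum>k. g k x)" .
  qed
  also have "\<dots> = (\<Sum>k. \<integral>\<^sup>+x. g k x \<partial>lborel)"
    by (rule nn_integral_suminf) (unfold g_def[abs_def], intro borel_measurable_times_ennreal borel_measurable_indicator, auto)
  also have "\<dots> = (\<Sum>k. ennreal (c * inverse ((real (k + 1))\<^sup>2)))"
  proof (rule arg_cong[where f = suminf], rule ext)
    fix k
    have "(\<integral>\<^sup>+x. g k x \<partial>lborel) = ennreal (1 / real (k + 1) ^ (?p + 2)) * emeasure lborel (ball (0::'b) (real (k + 1)))"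
      by (simp add: g_def nn_integral_cmult_indicator)
    also have "emeasure lborel (ball (0::'b) (real (k + 1))) = ennreal (real (k + 1) ^ ?p * c)"
      using content_ball_conv_unit_ball[of "real (k + 1)" "0::'b"] emeasure_lborel_ball_finite[of "0::'b" "real (k + 1)"]
      by (simp add: emeasure_eq_ennreal_measure c_def less_top)
    also have "ennreal (1 / real (k + 1) ^ (?p + 2)) * ennreal (real (k + 1) ^ ?p * c)
        = ennreal (1 / real (k + 1) ^ (?p + 2) * (real (k + 1) ^ ?p * c))"
      by (rule ennreal_mult'[symmetric]) simp
    also have "1 / real (k + 1) ^ (?p + 2) * (real (k + 1) ^ ?p * c) = c * inverse ((real (k + 1))\<^sup>2)"
    proof -
      have "1 / t ^ (?p + 2) * (t ^ ?p * c) = c * inverse (t\<^sup>2)" if "t > 0" for t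
        using that by (simp add: power_add power2_eq_square field_simps)
      then show ?thesis by (metis of_nat_0_less_iff zero_less_Suc Suc_eq_plus1)
    qed
    finally show "(\<integral>\<^sup>+x. g k x \<partial>lborel) = ennreal (c * inverse ((real (k + 1))\<^sup>2))" .
  qed
  also have "\<dots> < \<infinity>"
  proof -
    have "summable (\<lambda>k. inverse ((real (k + 1))\<^sup>2))"
      using inverse_power_summable[of 2, where 'a = real] summable_Suc_iff[of "\<lambda>k. inverse ((real k)\<^sup>2)"] by simp
    then have "summable (\<lambda>k. c * inverse ((real (k + 1))\<^sup>2))" by (rule summable_mult)
    then show ?thesis
      by (subst suminf_ennreal2) (auto simp: c_def)
  qed
  finally show ?thesis .
qed

text \<open>If \<open>q v\<close> is tiny, then \<open>exp (- q)\<close> is bounded below on a ball centred far out at \<open>T v\<close>,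
  which makes the weighted integral large.\<close>

lemma quadratic_form_integral_lower_bound:
  fixes q :: "'b::euclidean_space \<Rightarrow> real"
  assumes q_add: "\<And>x y. q (x + y) \<le> 2 * q x + 2 * q y" and q_scale: "\<And>t x. q (t *\<^sub>R x) = t\<^sup>2 * q x"
    and q_le: "\<And>x. q x \<le> \<Lambda> * (norm x)\<^sup>2" and \<Lambda>: "\<Lambda> \<ge> 1"
    and v: "norm v = 1" and T: "T \<ge> 2" "T\<^sup>2 * q v \<le> 1"
  shows "ennreal (exp (- 4) * (T / 2) ^ a * ((1 / \<Lambda>) ^ DIM('b) * measure lborel (ball (0::'b) 1)))
    \<le> (\<integral>\<^sup>+x. ennreal (norm x ^ a * exp (- q x)) \<partial>lborel)"
proof -
  let ?U = "ball (T *\<^sub>R v) (1 / \<Lambda>)"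
  have em: "emeasure lborel ?U = ennreal ((1 / \<Lambda>) ^ DIM('b) * measure lborel (ball (0::'b) 1))"
    using content_ball_conv_unit_ball[of "1 / \<Lambda>" "T *\<^sub>R v"] emeasure_lborel_ball_finite[of "T *\<^sub>R v" "1 / \<Lambda>"] \<Lambda>
    by (simp add: emeasure_eq_ennreal_measure less_top)
  have "ennreal (exp (- 4) * (T / 2) ^ a * ((1 / \<Lambda>) ^ DIM('b) * measure lborel (ball (0::'b) 1)))
    = ennreal (exp (- 4) * (T / 2) ^ a) * emeasure lborel ?U"
    using T \<Lambda> by (simp add: em ennreal_mult')
  also have "\<dots> = (\<integral>\<^sup>+x. ennreal (exp (- 4) * (T / 2) ^ a) * indicator ?U x \<partial>lborel)"
    by (simp add: nn_integral_cmult_indicator)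
  also have "\<dots> \<le> (\<integral>\<^sup>+x. ennreal (norm x ^ a * exp (- q x)) \<partial>lborel)"
  proof (rule nn_integral_mono)
    fix x
    show "ennreal (exp (- 4) * (T / 2) ^ a) * indicator ?U x \<le> ennreal (norm x ^ a * exp (- q x))"
    proof (cases "x \<in> ?U")
      case True
      define y where "y = x - T *\<^sub>R v"
      have y: "norm y \<le> 1 / \<Lambda>" using True by (simp add: y_def dist_norm norm_minus_commute)
      also have "\<dots> \<le> 1" using \<Lambda> by simp
      finally have y1: "norm y \<le> 1" .
      have x: "x = T *\<^sub>R v + y" by (simp add: y_def)
      \<comment> \<open>The radius 1/\<Lambda> of the ball serves to make \<open>q y\<close> at most
        1; with \<open>T\<^sup>2 * q v \<le> 1\<close> this gives the constant 4.\<close>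
      have "q y \<le> \<Lambda> * (norm y)\<^sup>2" by (rule q_le)
      also have "\<dots> \<le> \<Lambda> * (1 / \<Lambda> * 1)"
        unfolding power2_eq_square using \<Lambda> y y1 by (intro mult_left_mono mult_mono) auto
      finally have "q y \<le> 1" using \<Lambda> by simp
      then have "q x \<le> 4"
        using q_add[of "T *\<^sub>R v" y] T(2) q_scale[of T v] by (simp add: x)
      \<comment> \<open>Every point of the ball has norm at least T - 1, and T \<ge> 2.\<close>
      moreover have "T / 2 \<le> norm x"
      proof -
        have "T = norm (x - y)" using v T by (simp add: x)
        also have "\<dots> \<le> norm x + norm y" by (rule norm_triangle_ineq4)
        finally show ?thesis using y1 T by simp
      qed
      ultimately have "exp (- 4) * (T / 2) ^ a \<le> exp (- q x) * norm x ^ a"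
        using T by (intro mult_mono power_mono) auto
      then show ?thesis using True by (simp add: mult.commute ennreal_leI)
    qed simp
  qed
  finally show ?thesis .
qed

text \<open>The constant that appears when the lower bound on the weighted integral with
  \<open>a = 4 * b\<close> is solved for \<open>T ^ (4 * b)\<close>. The type argument carries the
  dimension of the unit ball.\<close>

definition coercivity_constant :: "nat \<Rightarrow> 'b::euclidean_space itself \<Rightarrow> real" where
  "coercivity_constant b _ = exp 4 * 2 ^ (4 * b) / measure lborel (ball (0::'b) 1)"

text \<open>Take T to be the inverse square root of \<open>q v\<close> in the integral bound. The
  exponent 4b pays twice: one factor 2 turns T into 1 / q v, the other allows a square root that
  splits the product of J and the power of \<Lambda> into a sum. A sum has an expectation that can
  be bounded term by term. The term \<open>4 ^ b\<close> covers \<open>q v > 1 / 4\<close>, where T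
  would be below 2.\<close>

lemma quadratic_form_coercive:
  fixes q :: "'b::euclidean_space \<Rightarrow> real" and b :: nat
  assumes q_add: "\<And>x y. q (x + y) \<le> 2 * q x + 2 * q y" and q_scale: "\<And>t x. q (t *\<^sub>R x) = t\<^sup>2 * q x"
    and q_le: "\<And>x. q x \<le> \<Lambda> * (norm x)\<^sup>2" and q0: "\<And>x. q x \<ge> 0" and \<Lambda>: "\<Lambda> \<ge> 1" and b: "b > 0"
    and J: "(\<integral>\<^sup>+x. ennreal (norm x ^ (4 * b) * exp (- q x)) \<partial>lborel) = ennreal J" "J \<ge> 0"
    and v: "norm v = 1"
  shows "q v > 0" and "(1 / q v) ^ b \<le> 4 ^ b + coercivity_constant b TYPE('b) * J + \<Lambda> ^ DIM('b)"
proof -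
  define K where "K = coercivity_constant b TYPE('b)"
  define \<omega> where "\<omega> = measure lborel (ball (0::'b) 1)"
  have \<omega>: "\<omega> > 0" by (simp add: \<omega>_def content_ball_pos)
  have K: "K = exp 4 * 2 ^ (4 * b) / \<omega>" by (simp add: K_def coercivity_constant_def \<omega>_def)
  have K0: "K > 0" using \<omega> by (simp add: K)
  have main: "T ^ (4 * b) \<le> K * J * \<Lambda> ^ DIM('b)" if T: "T \<ge> 2" "T\<^sup>2 * q v \<le> 1" for T
  proof -
    have "exp (- 4) * (T / 2) ^ (4 * b) * ((1 / \<Lambda>) ^ DIM('b) * \<omega>) \<le> J"
      using quadratic_form_integral_lower_bound[OF q_add q_scale q_le \<Lambda> v T, of "4 * b"] J
      by (simp add: \<omega>_def[symmetric] ennreal_le_iff)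
    moreover have "exp (- 4) * (T / 2) ^ (4 * b) * ((1 / \<Lambda>) ^ DIM('b) * \<omega>) = T ^ (4 * b) / (K * \<Lambda> ^ DIM('b))"
      using \<omega> \<Lambda> by (simp add: K power_divide exp_minus field_simps)
    ultimately have "T ^ (4 * b) / (K * \<Lambda> ^ DIM('b)) \<le> J" by (simp only:)
    moreover have "K * \<Lambda> ^ DIM('b) > 0" using K0 \<Lambda> by simp
    ultimately show ?thesis by (simp only: pos_divide_le_eq mult_ac)
  qed
  show pos: "q v > 0"
  proof (rule ccontr)
    assume "\<not> q v > 0"
    then have qv: "q v = 0" using q0[of v] by simp
    \<comment> \<open>If \<open>q v\<close> vanished, every T \<ge> 2 would be admissible, so T may
      exceed the fixed upper bound of its own power.\<close>
    define T where "T = max 2 (K * J * \<Lambda> ^ DIM('b) + 1)"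
    have T2: "T \<ge> 2" by (simp add: T_def)
    have "T \<le> T ^ (4 * b)" using T2 b by (intro self_le_power) auto
    also have "\<dots> \<le> K * J * \<Lambda> ^ DIM('b)" using main[OF T2] qv by simp
    finally show False by (simp add: T_def)
  qed
  have KJ: "K * J \<ge> 0" using K0 J by simp
  have L1: "\<Lambda> ^ DIM('b) \<ge> 0" using \<Lambda> by simp
  show "(1 / q v) ^ b \<le> 4 ^ b + coercivity_constant b TYPE('b) * J + \<Lambda> ^ DIM('b)"
    unfolding K_def[symmetric]
  proof (cases "q v \<le> 1 / 4")
    case False
    then have "(1 / q v) ^ b \<le> 4 ^ b"
      using pos by (intro power_mono) (auto simp: field_simps)
    then show "(1 / q v) ^ b \<le> 4 ^ b + K * J + \<Lambda> ^ DIM('b)" using KJ L1 by linarith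
  next
    case True
    define T where "T = sqrt (1 / q v)"
    have T2: "T\<^sup>2 = 1 / q v" using pos by (simp add: T_def)
    have "2 \<le> T" unfolding T_def using True pos by (intro real_le_rsqrt) (simp add: field_simps)
    then have "T ^ (4 * b) \<le> K * J * \<Lambda> ^ DIM('b)"
      using main[of T] T2 pos by simp
    also have "T ^ (4 * b) = ((1 / q v) ^ b)\<^sup>2"
      by (simp add: T2[symmetric] power_mult[symmetric] mult_ac)
    also have "K * J * \<Lambda> ^ DIM('b) \<le> (K * J + \<Lambda> ^ DIM('b))\<^sup>2"
    proof -
      have "x * y \<le> (x + y)\<^sup>2" if "0 \<le> x * y" for x y :: real
        using that zero_le_power2[of x] zero_le_power2[of y] unfolding power2_sum by linarith
      then show ?thesis using KJ L1 by simp
    qed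
    finally have "(1 / q v) ^ b \<le> K * J + \<Lambda> ^ DIM('b)"
      by (rule power2_le_imp_le) (use KJ L1 in simp)
    moreover have "0 \<le> (4::real) ^ b" by simp
    ultimately show "(1 / q v) ^ b \<le> 4 ^ b + K * J + \<Lambda> ^ DIM('b)" by linarith
  qed
qed

section \<open>Convergence of Gram matrices\<close>

lemma power_add_le_two_power:
  fixes x y :: real
  assumes "x \<ge> 0" "y \<ge> 0"
  shows "(x + y) ^ k \<le> 2 ^ k * (x ^ k + y ^ k)"
proof -
  have "(x + y) ^ k \<le> (2 * max x y) ^ k"
    using assms by (intro power_mono) auto
  also have "\<dots> = 2 ^ k * max x y ^ k" by (simp add: power_mult_distrib)
  also have "max x y ^ k \<le> x ^ k + y ^ k"
    using assms by (simp add: max_def)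
  finally show ?thesis by simp
qed

lemma norm_matrix_eq_sqrt:
  fixes A :: "real^'n^'m"
  shows "norm A = sqrt (\<Sum>i\<in>UNIV. \<Sum>j\<in>UNIV. (A $ i $ j)\<^sup>2)"
  by (simp add: norm_vec_def L2_set_def sum_nonneg)

lemma trace_le_norm:
  fixes A :: "real^'p^'p"
  shows "(\<Sum>j\<in>UNIV. A $ j $ j) \<le> real (CARD('p)) * norm A"
proof -
  have "(\<Sum>j\<in>UNIV. A $ j $ j) \<le> (\<Sum>j\<in>(UNIV::'p set). norm A)"
    by (intro sum_mono) (use abs_matrix_entry_le in \<open>auto intro: order_trans[OF abs_ge_self]\<close>)
  then show ?thesis by simp
qed

text \<open>The limit inherits nonnegativity of the form and the inequality |S x|^2 \<le> tr(S) (x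
  \<bullet> S x) from Gram matrices. Invertibility bounds |x| by a multiple of |S x|, so the
  reciprocal of |S^-1|^2 tr(S) is a coercivity constant.\<close>

lemma gram_limit_coercive:
  fixes S :: "real^'p^'p"
  assumes S: "invertible S"
    and approx: "\<And>\<epsilon>. \<epsilon> > 0 \<Longrightarrow> \<exists>n b. norm (gram_matrix n b - S) \<le> \<epsilon>"
  obtains c where "c > 0" "\<And>x. c * (norm x)\<^sup>2 \<le> inner x (S *v x)"
proof -
  have "\<forall>k. \<exists>G. (\<exists>n b. G = gram_matrix n b) \<and> norm (G - S) \<le> inverse (real (Suc k))"
    using approx by (metis inverse_positive_iff_positive of_nat_0_less_iff zero_less_Suc)
  then obtain G where G: "\<And>k. \<exists>n b. G k = gram_matrix n b" and GS: "\<And>k. norm (G k - S) \<le> inverse (real (Suc k))"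
    by metis
  have limG: "G \<longlonglongrightarrow> S"
  proof -
    have "(\<lambda>k. G k - S) \<longlonglongrightarrow> 0"
      by (rule Lim_null_comparison[OF always_eventually[OF allI[OF GS]] LIMSEQ_inverse_real_of_nat])
    then show ?thesis by (simp add: LIM_zero_iff)
  qed
  have limx: "(\<lambda>k. G k *v x) \<longlonglongrightarrow> S *v x" for x
  proof -
    have "(\<lambda>k. (G k - S) *v x) \<longlonglongrightarrow> 0"
    proof (rule Lim_null_comparison)
      show "\<forall>\<^sub>F k in sequentially. norm ((G k - S) *v x) \<le> inverse (real (Suc k)) * norm x"
        by (intro always_eventually allI order_trans[OF norm_matrix_vector_mult_le] mult_right_mono GS) simp
      show "(\<lambda>k. inverse (real (Suc k)) * norm x) \<longlonglongrightarrow> 0"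
        using tendsto_mult_left_zero[OF LIMSEQ_inverse_real_of_nat] .
    qed
    then show ?thesis by (simp add: LIM_zero_iff matrix_vector_mult_diff_rdistrib)
  qed
  define \<tau> where "\<tau> = (\<Sum>j\<in>UNIV. S $ j $ j)"
  have lim\<tau>: "(\<lambda>k. \<Sum>j\<in>UNIV. G k $ j $ j) \<longlonglongrightarrow> \<tau>"
    unfolding \<tau>_def by (intro tendsto_sum tendsto_vec_nth limG)
  have limq: "(\<lambda>k. inner x (G k *v x)) \<longlonglongrightarrow> inner x (S *v x)" for x
    by (intro tendsto_inner tendsto_const limx)
  have ineq: "(norm (S *v x))\<^sup>2 \<le> \<tau> * inner x (S *v x)" for x
  proof (rule LIMSEQ_le)
    show "(\<lambda>k. (norm (G k *v x))\<^sup>2) \<longlonglongrightarrow> (norm (S *v x))\<^sup>2"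
      by (intro tendsto_power tendsto_norm limx)
    show "(\<lambda>k. (\<Sum>j\<in>UNIV. G k $ j $ j) * inner x (G k *v x)) \<longlonglongrightarrow> \<tau> * inner x (S *v x)"
      by (intro tendsto_mult lim\<tau> limq)
    show "\<exists>N. \<forall>k\<ge>N. (norm (G k *v x))\<^sup>2 \<le> (\<Sum>j\<in>UNIV. G k $ j $ j) * inner x (G k *v x)"
      using G gram_image_norm_le by metis
  qed
  have "0 \<le> inner x (G k *v x)" for k x
    using G[of k] by (auto simp: gram_quadratic_form sum_nonneg)
  then have q0: "0 \<le> inner x (S *v x)" for x
    by (intro LIMSEQ_le_const[OF limq]) auto
  define a where "a = (norm (matrix_inv S))\<^sup>2 * \<tau>"
  have main: "(norm x)\<^sup>2 \<le> a * inner x (S *v x)" for x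
  proof -
    have "x = matrix_inv S *v (S *v x)"
      by (simp add: matrix_vector_mul_assoc matrix_inv_left[OF S])
    then have "norm x \<le> norm (matrix_inv S) * norm (S *v x)"
      using norm_matrix_vector_mult_le[of "matrix_inv S" "S *v x"] by simp
    then have "(norm x)\<^sup>2 \<le> (norm (matrix_inv S) * norm (S *v x))\<^sup>2"
      by (intro power_mono) auto
    also have "\<dots> \<le> (norm (matrix_inv S))\<^sup>2 * (\<tau> * inner x (S *v x))"
      unfolding power_mult_distrib by (intro mult_left_mono ineq) simp
    finally show ?thesis by (simp add: a_def mult.assoc)
  qed
  obtain x0 :: "real^'p" where x0: "norm x0 = 1"
    using vector_choose_size[of 1] by auto
  \<comment> \<open>At a unit vector, \<open>a \<le> 0\<close> would make the right side of
    \<open>main\<close> nonpositive while the left side is 1.\<close>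
  have "a > 0"
    using main[of x0] q0[of x0] x0 mult_nonpos_nonneg[of a "inner x0 (S *v x0)"] by (cases "a > 0") auto
  show thesis
  proof (rule that[of "1 / a"])
    show "1 / a > 0" using \<open>a > 0\<close> by simp
    show "1 / a * (norm x)\<^sup>2 \<le> inner x (S *v x)" for x
      using main[of x] \<open>a > 0\<close> by (simp add: field_simps)
  qed
qed

section \<open>Moments of the deviation of Gram matrices\<close>

context gaussian_sequence
begin

lemma chaos_energy_moment:
  fixes B :: "nat \<Rightarrow> 'p::finite \<Rightarrow> 'a \<Rightarrow> real" and k n :: nat
  assumes B: "\<And>i j. i < n \<Longrightarrow> B i j \<in> first_wiener_chaos M N"
  defines "R \<equiv> \<lambda>\<omega>. \<Sum>i<n. \<Sum>j\<in>UNIV. (B i j \<omega>)\<^sup>2"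
  shows "integrable M (\<lambda>\<omega>. R \<omega> ^ k)"
    and "expectation (\<lambda>\<omega>. R \<omega> ^ k) \<le> fact (2 * k) / (2 ^ k * fact k) * (expectation R + 1) ^ k"
proof -
  let ?I = "{..<n} \<times> (UNIV :: 'p set)"
  have R: "R = (\<lambda>\<omega>. \<Sum>i\<in>?I. ((\<lambda>(i, j). B i j) i \<omega>)\<^sup>2)"
    unfolding R_def by (simp add: sum.cartesian_product case_prod_unfold)
  have "integrable M (\<lambda>\<omega>. R \<omega> ^ k) \<and>
    expectation (\<lambda>\<omega>. R \<omega> ^ k) \<le> fact (2 * k) / (2 ^ k * fact k) * (expectation R + 1) ^ k"
  \<comment> \<open>Jensen's inequality requires a nonempty index set, so the empty Gram matrix is
    treated by hand.\<close>
  proof (cases "n = 0")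
    case True
    then show ?thesis by (cases "k = 0") (auto simp: R_def prob_space zero_power)
  next
    case False
    then have I: "finite ?I" "?I \<noteq> {}" by auto
    show ?thesis
      unfolding R by (intro conjI chaos_quad_moment[OF I]) (use B in auto)
  qed
  then show "integrable M (\<lambda>\<omega>. R \<omega> ^ k)"
    and "expectation (\<lambda>\<omega>. R \<omega> ^ k) \<le> fact (2 * k) / (2 ^ k * fact k) * (expectation R + 1) ^ k"
    by auto
qed

lemma measurable_gram_norm:
  fixes B :: "nat \<Rightarrow> 'p::finite \<Rightarrow> 'a \<Rightarrow> real"
  assumes "\<And>i j. i < n \<Longrightarrow> B i j \<in> borel_measurable M"
  shows "(\<lambda>\<omega>. norm (gram_matrix n (\<lambda>i j. B i j \<omega>) - S)) \<in> borel_measurable M"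
proof -
  have [measurable]: "(\<lambda>\<omega>. gram_matrix n (\<lambda>i j. B i j \<omega>) $ j $ k) \<in> borel_measurable M" for j k
    unfolding gram_matrix_def vec_lambda_beta
    by (intro borel_measurable_sum borel_measurable_times assms) auto
  show ?thesis
    unfolding norm_matrix_eq_sqrt vector_minus_component by measurable
qed

text \<open>The deviation is at most R plus the norm of S, where the energy R is the trace of the
  Gram matrix. All moments of R are controlled by its mean.\<close>

lemma gram_deviation_moment:
  fixes B :: "nat \<Rightarrow> 'p::finite \<Rightarrow> 'a \<Rightarrow> real" and S :: "real^'p^'p" and k n :: nat
  assumes B: "\<And>i j. i < n \<Longrightarrow> B i j \<in> first_wiener_chaos M N"
  defines "f \<equiv> \<lambda>\<omega>. norm (gram_matrix n (\<lambda>i j. B i j \<omega>) - S)"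
    and "R \<equiv> \<lambda>\<omega>. \<Sum>i<n. \<Sum>j\<in>UNIV. (B i j \<omega>)\<^sup>2"
  shows "integrable M (\<lambda>\<omega>. f \<omega> ^ k)"
    and "expectation (\<lambda>\<omega>. f \<omega> ^ k)
      \<le> 2 ^ k * (fact (2 * k) / (2 ^ k * fact k) * (expectation R + 1) ^ k + norm S ^ k)"
proof -
  have [measurable]: "f \<in> borel_measurable M"
    unfolding f_def by (intro measurable_gram_norm chaos_measurable B)
  have R: "integrable M (\<lambda>\<omega>. R \<omega> ^ k)"
    "expectation (\<lambda>\<omega>. R \<omega> ^ k) \<le> fact (2 * k) / (2 ^ k * fact k) * (expectation R + 1) ^ k"
    unfolding R_def by (intro chaos_energy_moment B; assumption)+
  have pw: "f \<omega> ^ k \<le> 2 ^ k * (R \<omega> ^ k + norm S ^ k)" for \<omega>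
  proof -
    have R0: "R \<omega> \<ge> 0" by (simp add: R_def sum_nonneg)
    have "f \<omega> \<le> norm (gram_matrix n (\<lambda>i j. B i j \<omega>)) + norm S"
      unfolding f_def by (rule norm_triangle_ineq4)
    also have "\<dots> \<le> R \<omega> + norm S"
      using norm_gram_le[of n "\<lambda>i j. B i j \<omega>"] by (simp add: R_def)
    finally have "f \<omega> ^ k \<le> (R \<omega> + norm S) ^ k"
      by (intro power_mono) (simp_all add: f_def)
    also have "\<dots> \<le> 2 ^ k * (R \<omega> ^ k + norm S ^ k)"
      using R0 by (intro power_add_le_two_power) auto
    finally show ?thesis .
  qed
  have im: "integrable M (\<lambda>\<omega>. 2 ^ k * (R \<omega> ^ k + norm S ^ k))"
    using R(1) by (intro integrable_mult_right Bochner_Integration.integrable_add integrable_const)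
  show i: "integrable M (\<lambda>\<omega>. f \<omega> ^ k)"
  proof (rule Bochner_Integration.integrable_bound[OF im])
    show "AE \<omega> in M. norm (f \<omega> ^ k) \<le> norm (2 ^ k * (R \<omega> ^ k + norm S ^ k))"
    proof (rule AE_I2)
      fix \<omega>
      have "norm (f \<omega> ^ k) = f \<omega> ^ k" by (simp add: f_def)
      also note pw[of \<omega>]
      also have "2 ^ k * (R \<omega> ^ k + norm S ^ k) \<le> norm (2 ^ k * (R \<omega> ^ k + norm S ^ k))"
        unfolding real_norm_def by (rule abs_ge_self)
      finally show "norm (f \<omega> ^ k) \<le> norm (2 ^ k * (R \<omega> ^ k + norm S ^ k))" .
    qed
  qed simp
  have "expectation (\<lambda>\<omega>. f \<omega> ^ k) \<le> expectation (\<lambda>\<omega>. 2 ^ k * (R \<omega> ^ k + norm S ^ k))"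
    by (intro integral_mono i im pw)
  also have "\<dots> = 2 ^ k * (expectation (\<lambda>\<omega>. R \<omega> ^ k) + norm S ^ k)"
    using R(1) by (simp add: prob_space)
  also have "\<dots> \<le> 2 ^ k * (fact (2 * k) / (2 ^ k * fact k) * (expectation R + 1) ^ k + norm S ^ k)"
    using R(2) by (intro mult_left_mono add_right_mono) auto
  finally show "expectation (\<lambda>\<omega>. f \<omega> ^ k)
      \<le> 2 ^ k * (fact (2 * k) / (2 ^ k * fact k) * (expectation R + 1) ^ k + norm S ^ k)" .
qed

text \<open>Boundedness in probability of Gaussian quadratic forms already bounds their means,
  because the second moment is controlled by the square of the mean.\<close>

lemma energy_expectation_bounded:
  fixes B :: "nat \<Rightarrow> nat \<Rightarrow> 'p::finite \<Rightarrow> 'a \<Rightarrow> real" and S :: "real^'p^'p"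
  assumes B: "\<And>n i j. i < n \<Longrightarrow> B n i j \<in> first_wiener_chaos M N"
    and conv: "\<And>\<epsilon>. \<epsilon> > 0 \<Longrightarrow>
       (\<lambda>n. prob {\<omega> \<in> space M. norm (gram_matrix n (\<lambda>i j. B n i j \<omega>) - S) > \<epsilon>}) \<longlonglongrightarrow> 0"
  shows "\<forall>\<^sub>F n in sequentially. expectation (\<lambda>\<omega>. \<Sum>i<n. \<Sum>j\<in>UNIV. (B n i j \<omega>)\<^sup>2)
      \<le> 2 * real (CARD('p)) * (norm S + 1) + 1"
proof -
  \<comment> \<open>1/48 is 1/(4K) for K = 12 in the Paley-Zygmund bound: 3 is the fourth-moment
    factor, and 4 comes from replacing the mean plus 1 by twice the mean.\<close>
  have "\<forall>\<^sub>F n in sequentially. prob {\<omega> \<in> space M. norm (gram_matrix n (\<lambda>i j. B n i j \<omega>) - S) > 1} < 1 / 48"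
    using conv[of 1] by (intro order_tendstoD) auto
  then show ?thesis
  proof eventually_elim
    case (elim n)
    define R where "R \<omega> = (\<Sum>i<n. \<Sum>j\<in>UNIV. (B n i j \<omega>)\<^sup>2)" for \<omega>
    define f where "f \<omega> = norm (gram_matrix n (\<lambda>i j. B n i j \<omega>) - S)" for \<omega>
    have [measurable]: "f \<in> borel_measurable M"
      unfolding f_def[abs_def] by (intro measurable_gram_norm chaos_measurable B)
    have m: "integrable M (\<lambda>\<omega>. R \<omega> ^ k)"
      "expectation (\<lambda>\<omega>. R \<omega> ^ k) \<le> fact (2 * k) / (2 ^ k * fact k) * (expectation R + 1) ^ k" for k
      unfolding R_def[abs_def] by (intro chaos_energy_moment B; assumption)+
    have iR: "integrable M R" using m(1)[of 1] by simp
    have iR2: "integrable M (\<lambda>\<omega>. (R \<omega>)\<^sup>2)" by (rule m(1))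
    have [measurable]: "R \<in> borel_measurable M" using iR by simp
    show ?case
      unfolding R_def[symmetric]
    proof (rule ccontr)
      assume "\<not> expectation R \<le> 2 * real (CARD('p)) * (norm S + 1) + 1"
      then have big: "expectation R > 2 * real (CARD('p)) * (norm S + 1) + 1" by simp
      moreover have "0 \<le> 2 * real (CARD('p)) * (norm S + 1)" by simp
      ultimately have big1: "expectation R \<ge> 1" by linarith
      have "fact (2 * 2) / (2 ^ 2 * fact 2) = (3::real)" by (simp add: fact_numeral)
      then have "expectation (\<lambda>\<omega>. (R \<omega>)\<^sup>2) \<le> 3 * (expectation R + 1)\<^sup>2"
        using m(2)[of 2] by simp
      also have "\<dots> \<le> 3 * (2 * expectation R)\<^sup>2"
        using big1 by (intro mult_left_mono power_mono) auto
      also have "\<dots> = 12 * (expectation R)\<^sup>2" by (simp add: power_mult_distrib)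
      finally have "1 / (4 * 12) \<le> prob {\<omega> \<in> space M. R \<omega> \<ge> expectation R / 2}"
        using big1 by (intro paley_zygmund iR iR2) (auto simp: R_def sum_nonneg)
      also have "\<dots> \<le> prob {\<omega> \<in> space M. f \<omega> > 1}"
      proof (rule finite_measure_mono)
        \<comment> \<open>The trace is at most p times the norm, so a large energy forces the Gram
          matrix more than distance 1 away from S.\<close>
        show "{\<omega> \<in> space M. R \<omega> \<ge> expectation R / 2} \<subseteq> {\<omega> \<in> space M. f \<omega> > 1}"
        proof safe
          fix \<omega> assume "expectation R / 2 \<le> R \<omega>"
          also have "R \<omega> \<le> real (CARD('p)) * norm (gram_matrix n (\<lambda>i j. B n i j \<omega>))"
            unfolding R_def gram_trace[symmetric] by (rule trace_le_norm)
          also have "\<dots> \<le> real (CARD('p)) * (norm S + f \<omega>)"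
            unfolding f_def by (intro mult_left_mono) (use norm_triangle_sub[of _ S] in auto)
          finally have "real (CARD('p)) * (norm S + 1) < real (CARD('p)) * (norm S + f \<omega>)"
            using big unfolding mult.assoc by linarith
          then show "f \<omega> > 1" by (simp add: mult_less_cancel_left)
        qed
      qed measurable
      finally show False using elim by (simp add: f_def)
    qed
  qed
qed

text \<open>The eventually bounded mean energy bounds the moments of order 2k of the deviation,
  which upgrades convergence in probability to moments of order k.\<close>

lemma gram_deviation_moment_tendsto_zero:
  fixes B :: "nat \<Rightarrow> nat \<Rightarrow> 'p::finite \<Rightarrow> 'a \<Rightarrow> real" and S :: "real^'p^'p" and k :: nat
  assumes B: "\<And>n i j. i < n \<Longrightarrow> B n i j \<in> first_wiener_chaos M N"
    and conv: "\<And>\<epsilon>. \<epsilon> > 0 \<Longrightarrow>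
       (\<lambda>n. prob {\<omega> \<in> space M. norm (gram_matrix n (\<lambda>i j. B n i j \<omega>) - S) > \<epsilon>}) \<longlonglongrightarrow> 0"
    and k: "k > 0"
  shows "(\<lambda>n. expectation (\<lambda>\<omega>. norm (gram_matrix n (\<lambda>i j. B n i j \<omega>) - S) ^ k)) \<longlonglongrightarrow> 0"
proof (rule expectation_power_tendsto_zero[OF _ _ conv _ _ k])
  fix n
  show "(\<lambda>\<omega>. norm (gram_matrix n (\<lambda>i j. B n i j \<omega>) - S)) \<in> borel_measurable M"
    by (intro measurable_gram_norm chaos_measurable B)
  show "integrable M (\<lambda>\<omega>. norm (gram_matrix n (\<lambda>i j. B n i j \<omega>) - S) ^ (2 * k))"
    by (intro gram_deviation_moment(1) B)
next
  define C :: real where "C = fact (2 * (2 * k)) / (2 ^ (2 * k) * fact (2 * k))"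
  define K where "K = 2 * real (CARD('p)) * (norm S + 1) + 1"
  show "\<forall>\<^sub>F n in sequentially. expectation (\<lambda>\<omega>. norm (gram_matrix n (\<lambda>i j. B n i j \<omega>) - S) ^ (2 * k))
     \<le> 2 ^ (2 * k) * (C * (K + 1) ^ (2 * k) + norm S ^ (2 * k))"
  proof -
    have "\<forall>\<^sub>F n in sequentially. expectation (\<lambda>\<omega>. \<Sum>i<n. \<Sum>j\<in>UNIV. (B n i j \<omega>)\<^sup>2) \<le> K"
      unfolding K_def by (intro energy_expectation_bounded B conv)
    then show ?thesis
    proof eventually_elim
      case (elim n)
      have "expectation (\<lambda>\<omega>. norm (gram_matrix n (\<lambda>i j. B n i j \<omega>) - S) ^ (2 * k))
        \<le> 2 ^ (2 * k) * (C * (expectation (\<lambda>\<omega>. \<Sum>i<n. \<Sum>j\<in>UNIV. (B n i j \<omega>)\<^sup>2) + 1) ^ (2 * k) + norm S ^ (2 * k))"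
        unfolding C_def by (intro gram_deviation_moment(2) B)
      also have "\<dots> \<le> 2 ^ (2 * k) * (C * (K + 1) ^ (2 * k) + norm S ^ (2 * k))"
        using elim by (intro mult_left_mono add_right_mono power_mono add_nonneg_nonneg integral_nonneg_AE)
          (auto simp: C_def sum_nonneg)
      finally show ?case .
    qed
  qed
qed simp

text \<open>For fixed x the vector B x is a family in the chaos with sum of squares Q, and |Q - x
  \<bullet> S x| is at most f times |x|^2. So the mean of Q is at least c |x|^2 / 2 and its variance
  at most h^2 |x|^4. The conditions on h, m and r do not involve x because both bounds have matching
  homogeneity.\<close>

lemma gram_laplace_bound:
  fixes B :: "nat \<Rightarrow> 'p::finite \<Rightarrow> 'a \<Rightarrow> real" and S :: "real^'p^'p" and n r :: nat
  assumes B: "\<And>i j. i < n \<Longrightarrow> B i j \<in> first_wiener_chaos M N"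
    and c: "\<And>x. c * (norm x)\<^sup>2 \<le> inner x (S *v x)"
    and h: "h > 0" and m: "m \<ge> 0" "4 * h * m \<le> c" and r: "2 ^ r \<le> 1 + m / 2"
    and E1: "expectation (\<lambda>\<omega>. norm (gram_matrix n (\<lambda>i j. B i j \<omega>) - S)) \<le> c / 2"
    and E2: "expectation (\<lambda>\<omega>. (norm (gram_matrix n (\<lambda>i j. B i j \<omega>) - S))\<^sup>2) \<le> h\<^sup>2"
  shows "expectation (\<lambda>\<omega>. exp (- inner x (gram_matrix n (\<lambda>i j. B i j \<omega>) *v x))) \<le> (2 / (1 + 2 * h * (norm x)\<^sup>2)) ^ r"
proof (cases "x = 0")
  \<comment> \<open>At the origin the expectation is 1 and the right side is 2^r; away from it
    \<open>h * u\<close> is positive, as the decay bound requires.\<close>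
  case True
  then show ?thesis by (simp add: prob_space)
next
  case False
  define f where "f \<omega> = norm (gram_matrix n (\<lambda>i j. B i j \<omega>) - S)" for \<omega>
  define Y where "Y i \<omega> = (\<Sum>j\<in>UNIV. x $ j * B i j \<omega>)" for i \<omega>
  define Q where "Q \<omega> = (\<Sum>i<n. (Y i \<omega>)\<^sup>2)" for \<omega>
  define s where "s = inner x (S *v x)"
  define u where "u = (norm x)\<^sup>2"
  have u: "u > 0" using False by (simp add: u_def)
  have Q: "inner x (gram_matrix n (\<lambda>i j. B i j \<omega>) *v x) = Q \<omega>" for \<omega>
    by (simp add: gram_quadratic_form Q_def Y_def)
  have Y: "Y i \<in> first_wiener_chaos M N" if "i < n" for i
    unfolding Y_def using that B by (intro chaos_sum) auto
  have V: "integrable M Q" "integrable M (\<lambda>\<omega>. (Q \<omega>)\<^sup>2)" "variance Q = 2 * (hs_covariance n Y)\<^sup>2"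
    unfolding Q_def[abs_def] by (intro chaos_quad_variance Y; assumption)+
  have if1: "integrable M f"
    using gram_deviation_moment(1)[where n = n and B = B and S = S and k = 1, OF B] by (simp add: f_def[abs_def])
  have if2: "integrable M (\<lambda>\<omega>. (f \<omega>)\<^sup>2)"
    using gram_deviation_moment(1)[where n = n and B = B and S = S and k = 2, OF B] by (simp add: f_def[abs_def])
  have dev: "\<bar>Q \<omega> - s\<bar> \<le> f \<omega> * u" for \<omega>
    using abs_inner_matrix_vector_le[of x "gram_matrix n (\<lambda>i j. B i j \<omega>) - S"]
    by (simp add: Q[symmetric] s_def f_def u_def matrix_vector_mult_diff_rdistrib inner_diff_right)
  have "s - u * (c / 2) \<le> s - u * expectation f"
    using E1 u by (intro diff_left_mono mult_left_mono) (auto simp: f_def[abs_def])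
  also have "\<dots> = expectation (\<lambda>\<omega>. s - f \<omega> * u)"
    using if1 by (simp add: prob_space)
  also have "\<dots> \<le> expectation Q"
    using if1 V(1) dev by (intro integral_mono) (auto simp: abs_le_iff algebra_simps)
  finally have EQ: "s - u * (c / 2) \<le> expectation Q" .
  have EQ': "expectation Q = (\<Sum>i<n. expectation (\<lambda>\<omega>. (Y i \<omega>)\<^sup>2))"
    unfolding Q_def using Y chaos_square_integrable by simp
  have "u * (4 * h * m) \<le> u * c" using m u by (intro mult_left_mono) auto
  then have tr: "2 * (h * u) * m \<le> (\<Sum>i<n. expectation (\<lambda>\<omega>. (Y i \<omega>)\<^sup>2))"
    using EQ c[of x] unfolding EQ'[symmetric] s_def[symmetric] u_def[symmetric] by (simp add: algebra_simps)
  have "2 * (hs_covariance n Y)\<^sup>2 = expectation (\<lambda>\<omega>. (Q \<omega>)\<^sup>2) - (expectation Q)\<^sup>2"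
    using V(3) variance_eq[OF V(1,2)] by simp
  \<comment> \<open>The variance is at most the mean squared distance to any constant, here the
    deterministic value s.\<close>
  also have "\<dots> \<le> expectation (\<lambda>\<omega>. (Q \<omega>)\<^sup>2) - 2 * s * expectation Q + s\<^sup>2"
    using zero_le_power2[of "expectation Q - s"] by (simp add: power2_diff algebra_simps)
  also have "\<dots> = expectation (\<lambda>\<omega>. (Q \<omega>)\<^sup>2 - 2 * s * Q \<omega> + s\<^sup>2)"
    using V(1,2) by (simp add: prob_space)
  also have "\<dots> \<le> expectation (\<lambda>\<omega>. (f \<omega>)\<^sup>2 * u\<^sup>2)"
  proof (intro integral_mono)
    fix \<omega>
    have "(Q \<omega>)\<^sup>2 - 2 * s * Q \<omega> + s\<^sup>2 = \<bar>Q \<omega> - s\<bar>\<^sup>2"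
      by (simp add: power2_diff algebra_simps)
    also have "\<dots> \<le> (f \<omega> * u)\<^sup>2" using dev by (intro power_mono) auto
    finally show "(Q \<omega>)\<^sup>2 - 2 * s * Q \<omega> + s\<^sup>2 \<le> (f \<omega>)\<^sup>2 * u\<^sup>2" by (simp add: power_mult_distrib)
  qed (use V(1,2) if2 in auto)
  also have "\<dots> \<le> h\<^sup>2 * u\<^sup>2"
    using E2 by (simp add: f_def mult_right_mono)
  finally have "2 * (hs_covariance n Y)\<^sup>2 \<le> (h * u)\<^sup>2" by (simp add: power_mult_distrib)
  then have "(hs_covariance n Y)\<^sup>2 \<le> (h * u)\<^sup>2"
    using zero_le_power2[of "hs_covariance n Y"] by linarith
  then have hs: "hs_covariance n Y \<le> h * u"
    by (rule power2_le_imp_le) (use h u in simp)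
  \<comment> \<open>The Laplace parameter stays 1; the size of x enters through the Hilbert-Schmidt
    bound \<open>h * u\<close>.\<close>
  have "quad_laplace n Y 1 \<le> (2 / (1 + 2 * 1 * (h * u))) ^ r"
    using h u m r by (intro quad_laplace_decay[where m = m] Y hs tr) auto
  then show ?thesis
    unfolding Q by (simp add: quad_laplace_def Q_def u_def mult.assoc)
qed

end

section \<open>Negative moments\<close>

text \<open>The right side of the coercivity bound for the form of the Gram matrix, with \<Lambda>
  equal to 1 plus its norm. It is extended-valued because the integral diverges for a singular
  matrix; such matrices then need no separate treatment.\<close>

definition inverse_dominator :: "nat \<Rightarrow> nat \<Rightarrow> (nat \<Rightarrow> 'p::finite \<Rightarrow> real) \<Rightarrow> ennreal" where
  "inverse_dominator b n \<beta> = ennreal (4 ^ b)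
    + ennreal (coercivity_constant b TYPE(real^'p))
      * (\<integral>\<^sup>+x. ennreal (norm x ^ (4 * b) * exp (- inner x (gram_matrix n \<beta> *v x))) \<partial>lborel)
    + ennreal ((1 + norm (gram_matrix n \<beta>)) ^ CARD('p))"

lemma coercivity_constant_pos: "coercivity_constant b TYPE('b::euclidean_space) > 0"
  by (simp add: coercivity_constant_def content_ball_pos)

text \<open>A finite value forces the integral to be finite, which excludes degeneracy; taking the
  b-th root of the coercivity bound gives the constant \<kappa> used for inverses and determinants.
  The bound w \<ge> 1 allows exponents of w to be raised later.\<close>

lemma inverse_dominator_coercive:
  fixes \<beta> :: "nat \<Rightarrow> 'p::finite \<Rightarrow> real"
  assumes b: "b > 0" and w: "inverse_dominator b n \<beta> = ennreal w" "w \<ge> 0"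
  shows "w \<ge> 1" and "norm v = 1 \<Longrightarrow> 1 / (w powr (1 / real b)) \<le> inner v (gram_matrix n \<beta> *v v)"
proof -
  define K where "K = coercivity_constant b TYPE(real^'p)"
  define \<Lambda> where "\<Lambda> = 1 + norm (gram_matrix n \<beta>)"
  define q where "q x = inner x (gram_matrix n \<beta> *v x)" for x
  define I where "I = (\<integral>\<^sup>+x. ennreal (norm x ^ (4 * b) * exp (- q x)) \<partial>lborel)"
  have K0: "K > 0" by (simp add: K_def coercivity_constant_pos)
  have \<Lambda>: "\<Lambda> \<ge> 1" by (simp add: \<Lambda>_def)
  have eq: "ennreal (4 ^ b) + ennreal K * I + ennreal (\<Lambda> ^ CARD('p)) = ennreal w"
    using w(1) by (simp add: inverse_dominator_def K_def \<Lambda>_def q_def I_def)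
  have "I \<noteq> \<infinity>"
  proof
    assume "I = \<infinity>"
    then have "ennreal K * I = \<infinity>" using K0 by (simp add: ennreal_mult_top)
    then show False using eq by simp
  qed
  then obtain J where J: "I = ennreal J" "J \<ge> 0"
    by (cases I) auto
  have "ennreal (4 ^ b + K * J + \<Lambda> ^ CARD('p)) = ennreal w"
    using eq J K0 \<Lambda> by (simp add: ennreal_mult'' ennreal_mult ennreal_plus)
  then have L: "4 ^ b + K * J + \<Lambda> ^ CARD('p) = w"
    using J K0 \<Lambda> w(2) by (subst (asm) ennreal_inj) auto
  have "(1::real) \<le> 4 ^ b" "0 \<le> K * J" "0 \<le> \<Lambda> ^ CARD('p)"
    using J K0 \<Lambda> by auto
  then show w1: "w \<ge> 1" using L by linarith
  assume v: "norm v = 1"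
  have qf: "q x = (\<Sum>i<n. (\<Sum>j\<in>UNIV. x $ j * \<beta> i j)\<^sup>2)" for x
    by (simp add: q_def gram_quadratic_form)
  have q_add: "q (x + y) \<le> 2 * q x + 2 * q y" for x y
  proof -
    have p: "(s + t)\<^sup>2 \<le> 2 * s\<^sup>2 + 2 * t\<^sup>2" for s t :: real
      using sum_squares_bound[of s t] by (simp add: power2_sum)
    have "q (x + y) = (\<Sum>i<n. ((\<Sum>j\<in>UNIV. x $ j * \<beta> i j) + (\<Sum>j\<in>UNIV. y $ j * \<beta> i j))\<^sup>2)"
      by (simp add: qf distrib_right sum.distrib)
    also have "\<dots> \<le> (\<Sum>i<n. 2 * (\<Sum>j\<in>UNIV. x $ j * \<beta> i j)\<^sup>2 + 2 * (\<Sum>j\<in>UNIV. y $ j * \<beta> i j)\<^sup>2)"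
      by (intro sum_mono p)
    also have "\<dots> = 2 * q x + 2 * q y"
      by (simp add: qf sum.distrib sum_distrib_left)
    finally show ?thesis .
  qed
  have q_scale: "q (t *\<^sub>R x) = t\<^sup>2 * q x" for t x
    by (simp add: q_def matrix_vector_mult_scaleR power2_eq_square)
  have q_le: "q x \<le> \<Lambda> * (norm x)\<^sup>2" for x
  proof -
    have "q x \<le> norm (gram_matrix n \<beta>) * (norm x)\<^sup>2"
      using abs_inner_matrix_vector_le[of x "gram_matrix n \<beta>"] by (simp add: q_def)
    also have "\<dots> \<le> \<Lambda> * (norm x)\<^sup>2"
      by (intro mult_right_mono) (auto simp: \<Lambda>_def)
    finally show ?thesis .
  qed
  have q0: "q x \<ge> 0" for x by (simp add: qf sum_nonneg)
  have J': "(\<integral>\<^sup>+x. ennreal (norm x ^ (4 * b) * exp (- q x)) \<partial>lborel) = ennreal J"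
    using J by (simp add: I_def)
  note co = quadratic_form_coercive[OF q_add q_scale q_le q0 \<Lambda> b J' J(2) v]
  have qv: "q v > 0" by (rule co(1))
  have "(1 / q v) ^ b \<le> w"
    using co(2) L by (simp add: K_def)
  then have "((1 / q v) powr real b) powr (1 / real b) \<le> w powr (1 / real b)"
    using qv by (intro powr_mono2) (auto simp: powr_realpow)
  then have "1 / q v \<le> w powr (1 / real b)"
    using qv b by (simp add: powr_powr)
  then show "1 / (w powr (1 / real b)) \<le> inner v (gram_matrix n \<beta> *v v)"
    using qv w1 unfolding q_def[symmetric] by (simp add: field_simps)
qed

text \<open>For h \<le> 1/2 one has h (1 + t)^2 \<le> 1 + 2 h t^2, so each decay factor gains two
  powers of 1 + t. Of these 2r powers, a compensate the weight and p + 2 remain for integrability in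
  dimension p.\<close>

lemma laplace_weight_le:
  fixes t h :: real
  assumes t: "t \<ge> 0" and h: "0 < h" "h \<le> 1 / 2" and r: "a + p + 2 \<le> 2 * r"
  shows "t ^ a * (2 / (1 + 2 * h * t\<^sup>2)) ^ r \<le> (2 / h) ^ r * (1 / (1 + t) ^ (p + 2))"
proof -
  have "h * (1 + t)\<^sup>2 \<le> h * (2 + 2 * t\<^sup>2)"
    using h sum_squares_bound[of 1 t] by (intro mult_left_mono) (auto simp: power2_sum)
  also have "\<dots> \<le> 1 + 2 * h * t\<^sup>2" using h by (simp add: algebra_simps)
  finally have le: "h * (1 + t)\<^sup>2 \<le> 1 + 2 * h * t\<^sup>2" .
  have pos: "h * (1 + t)\<^sup>2 > 0" using h t by simp
  with le have pos2: "1 + 2 * h * t\<^sup>2 > 0" by linarith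
  have "(2 / (1 + 2 * h * t\<^sup>2)) ^ r \<le> (2 / (h * (1 + t)\<^sup>2)) ^ r"
    using le pos2 by (intro power_mono divide_left_mono mult_pos_pos[OF pos2 pos]) auto
  also have "\<dots> = (2 / h) ^ r * (1 / (1 + t) ^ (2 * r))"
    by (simp add: power_divide power_mult_distrib power_mult[symmetric])
  also have "\<dots> \<le> (2 / h) ^ r * (1 / (1 + t) ^ (a + p + 2))"
    using t h r by (intro mult_left_mono divide_left_mono power_increasing) auto
  finally have "t ^ a * (2 / (1 + 2 * h * t\<^sup>2)) ^ r \<le> (1 + t) ^ a * ((2 / h) ^ r * (1 / (1 + t) ^ (a + p + 2)))"
    using t pos le by (intro mult_mono power_mono) auto
  also have "\<dots> = (2 / h) ^ r * (1 / (1 + t) ^ (p + 2))"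
    using t by (simp add: power_add)
  finally show ?thesis .
qed

section \<open>Uniform bound on the expected dominator\<close>

context gaussian_sequence
begin

lemma gram_exp_measurable:
  fixes \<beta> :: "nat \<Rightarrow> 'p::finite \<Rightarrow> 'a \<Rightarrow> real"
  assumes B: "\<And>i j. i < n \<Longrightarrow> \<beta> i j \<in> borel_measurable M"
  shows "(\<lambda>(x, \<omega>). ennreal (norm x ^ a * exp (- inner x (gram_matrix n (\<lambda>i j. \<beta> i j \<omega>) *v x))))
     \<in> borel_measurable (lborel \<Otimes>\<^sub>M M)"
proof -
  have [measurable]: "\<beta> i j \<in> borel_measurable M" if "i \<in> {..<n}" for i j
    using that by (intro B) simp
  have [measurable]: "(\<lambda>x::real^'p. x $ j) \<in> borel_measurable borel" for j
    by (auto intro!: borel_measurable_continuous_onI continuous_intros)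
  show ?thesis
    unfolding gram_quadratic_form by measurable
qed

lemma inverse_dominator_measurable:
  fixes \<beta> :: "nat \<Rightarrow> 'p::finite \<Rightarrow> 'a \<Rightarrow> real"
  assumes B: "\<And>i j. i < n \<Longrightarrow> \<beta> i j \<in> borel_measurable M"
  shows "(\<lambda>\<omega>. inverse_dominator b n (\<lambda>i j. \<beta> i j \<omega>)) \<in> borel_measurable M"
proof -
  have "(\<lambda>\<omega>. \<integral>\<^sup>+x. ennreal (norm x ^ (4 * b) * exp (- inner x (gram_matrix n (\<lambda>i j. \<beta> i j \<omega>) *v x))) \<partial>lborel)
      \<in> borel_measurable M"
    using measurable_pair_swap[OF gram_exp_measurable[where n = n and \<beta> = \<beta> and a = "4 * b", OF B]]
    by (intro lborel.borel_measurable_nn_integral) (simp add: case_prod_unfold)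
  moreover have "(\<lambda>\<omega>. norm (gram_matrix n (\<lambda>i j. \<beta> i j \<omega>))) \<in> borel_measurable M"
    using measurable_gram_norm[where n = n and B = \<beta> and S = 0, OF B] by simp
  ultimately show ?thesis
    unfolding inverse_dominator_def by measurable
qed

text \<open>Tonelli moves the expectation inside the integral over x, where the Laplace bound
  produces an integrable majorant independent of n. The remaining norm term is handled by moments of
  the deviation.\<close>

lemma nn_integral_inverse_dominator_bounded:
  fixes B :: "nat \<Rightarrow> nat \<Rightarrow> 'p::finite \<Rightarrow> 'a \<Rightarrow> real" and S :: "real^'p^'p" and b :: nat
  assumes B: "\<And>n i j. i < n \<Longrightarrow> B n i j \<in> first_wiener_chaos M N"
    and conv: "\<And>\<epsilon>. \<epsilon> > 0 \<Longrightarrow>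
       (\<lambda>n. prob {\<omega> \<in> space M. norm (gram_matrix n (\<lambda>i j. B n i j \<omega>) - S) > \<epsilon>}) \<longlonglongrightarrow> 0"
    and c: "c > 0" "\<And>x. c * (norm x)\<^sup>2 \<le> inner x (S *v x)"
  obtains C where "C > 0"
    "\<forall>\<^sub>F n in sequentially. (\<integral>\<^sup>+\<omega>. inverse_dominator b n (\<lambda>i j. B n i j \<omega>) \<partial>M) \<le> ennreal C"
proof -
  interpret P: pair_sigma_finite "lborel :: (real^'p) measure" M
    by (simp add: pair_sigma_finite_def sigma_finite_lborel sigma_finite_measure_axioms)
  define f where "f n \<omega> = norm (gram_matrix n (\<lambda>i j. B n i j \<omega>) - S)" for n \<omega>
  define p where "p = CARD('p)"
  define a where "a = 4 * b"
  \<comment> \<open>The exponent r provides enough decay for the weight of order a. Then m is large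
    enough for 2^r \<le> 1 + m/2, and h small enough for 4 h m \<le> c; the threshold for n thus
    depends on b through h.\<close>
  define r where "r = a + p + 2"
  define m :: real where "m = 2 ^ (r + 1)"
  define h where "h = min (1 / 2) (c / (4 * m))"
  define K where "K = coercivity_constant b TYPE(real^'p)"
  define H where "H = enn2real (\<integral>\<^sup>+x. ennreal (1 / (1 + norm (x::real^'p)) ^ (p + 2)) \<partial>lborel)"
  define C where "C = 4 ^ b + K * ((2 / h) ^ r * H) + 2 ^ p * ((1 + norm S) ^ p + 1)"
  have K0: "K > 0" by (simp add: K_def coercivity_constant_pos)
  have H: "(\<integral>\<^sup>+x. ennreal (1 / (1 + norm (x::real^'p)) ^ (p + 2)) \<partial>lborel) = ennreal H" "H \<ge> 0"
    using nn_integral_inverse_power_finite[where 'b = "real^'p"] by (simp_all add: H_def p_def)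
  have m0: "m > 0" by (simp add: m_def)
  have h0: "h > 0" using c m0 by (simp add: h_def)
  have h2: "h \<le> 1 / 2" by (simp add: h_def)
  have hm: "4 * h * m \<le> c"
  proof -
    have "h \<le> c / (4 * m)" by (simp add: h_def)
    then show ?thesis using m0 by (simp add: field_simps)
  qed
  have rm: "2 ^ r \<le> 1 + m / 2" by (simp add: m_def)
  \<comment> \<open>Three moments of the deviation are needed: the first for the trace, the second
    for the Hilbert-Schmidt norm, and the p-th for the norm term of the dominator.\<close>
  have dev: "(\<lambda>n. expectation (\<lambda>\<omega>. f n \<omega> ^ k)) \<longlonglongrightarrow> 0" if "k > 0" for k
    unfolding f_def by (intro gram_deviation_moment_tendsto_zero B conv that)
  have "\<forall>\<^sub>F n in sequentially. expectation (\<lambda>\<omega>. f n \<omega> ^ 1) < c / 2"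
    using dev[of 1] c by (intro order_tendstoD) auto
  moreover have "\<forall>\<^sub>F n in sequentially. expectation (\<lambda>\<omega>. (f n \<omega>)\<^sup>2) < h\<^sup>2"
    using dev[of 2] h0 by (intro order_tendstoD) auto
  moreover have "\<forall>\<^sub>F n in sequentially. expectation (\<lambda>\<omega>. f n \<omega> ^ p) < 1"
    using dev[of p] by (intro order_tendstoD) (auto simp: p_def)
  ultimately have "\<forall>\<^sub>F n in sequentially. (\<integral>\<^sup>+\<omega>. inverse_dominator b n (\<lambda>i j. B n i j \<omega>) \<partial>M) \<le> ennreal C"
  proof eventually_elim
    case (elim n)
    let ?G = "\<lambda>\<omega>. gram_matrix n (\<lambda>i j. B n i j \<omega>)"
    have Bm: "\<And>i j. i < n \<Longrightarrow> B n i j \<in> borel_measurable M"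
      by (intro chaos_measurable B)
    define \<Phi> where "\<Phi> x \<omega> = ennreal (norm x ^ a * exp (- inner x (?G \<omega> *v x)))" for x \<omega>
    have \<Phi>m: "(\<lambda>(x, \<omega>). \<Phi> x \<omega>) \<in> borel_measurable (lborel \<Otimes>\<^sub>M M)"
      unfolding \<Phi>_def by (rule gram_exp_measurable[OF Bm])
    then have \<Phi>m': "(\<lambda>\<omega>. \<integral>\<^sup>+x. \<Phi> x \<omega> \<partial>lborel) \<in> borel_measurable M"
      using measurable_pair_swap[OF \<Phi>m]
      by (intro lborel.borel_measurable_nn_integral) (simp add: case_prod_unfold)
    have Gm [measurable]: "(\<lambda>\<omega>. norm (?G \<omega>)) \<in> borel_measurable M"
      using measurable_gram_norm[where S = 0, OF Bm] by simp
    have fm [measurable]: "f n \<in> borel_measurable M"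
      unfolding f_def[abs_def] by (rule measurable_gram_norm[OF Bm])
    have I: "(\<integral>\<^sup>+\<omega>. (\<integral>\<^sup>+x. \<Phi> x \<omega> \<partial>lborel) \<partial>M) \<le> ennreal ((2 / h) ^ r * H)"
    proof -
      have "(\<integral>\<^sup>+\<omega>. (\<integral>\<^sup>+x. \<Phi> x \<omega> \<partial>lborel) \<partial>M) = (\<integral>\<^sup>+x. (\<integral>\<^sup>+\<omega>. \<Phi> x \<omega> \<partial>M) \<partial>lborel)"
        by (rule P.Fubini'[OF \<Phi>m])
      also have "\<dots> \<le> (\<integral>\<^sup>+x. ennreal ((2 / h) ^ r) * ennreal (1 / (1 + norm (x::real^'p)) ^ (p + 2)) \<partial>lborel)"
      proof (rule nn_integral_mono)
        fix x :: "real^'p"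
        have em: "(\<lambda>\<omega>. exp (- inner x (?G \<omega> *v x))) \<in> borel_measurable M"
        proof -
          have [measurable]: "B n i j \<in> borel_measurable M" if "i \<in> {..<n}" for i j
            using that by (intro Bm) simp
          show ?thesis unfolding gram_quadratic_form by measurable
        qed
        have ei: "integrable M (\<lambda>\<omega>. exp (- inner x (?G \<omega> *v x)))"
          by (rule integrable_const_bound[where B = 1]) (use em in \<open>auto simp: gram_quadratic_form sum_nonneg\<close>)
        have "(\<integral>\<^sup>+\<omega>. \<Phi> x \<omega> \<partial>M) = ennreal (expectation (\<lambda>\<omega>. norm x ^ a * exp (- inner x (?G \<omega> *v x))))"
          unfolding \<Phi>_def using ei by (intro nn_integral_eq_integral) auto
        also have "\<dots> = ennreal (norm x ^ a * expectation (\<lambda>\<omega>. exp (- inner x (?G \<omega> *v x))))"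
          by simp
        also have "\<dots> \<le> ennreal (norm x ^ a * (2 / (1 + 2 * h * (norm x)\<^sup>2)) ^ r)"
          using elim m0 by (intro ennreal_leI mult_left_mono gram_laplace_bound[OF B c(2) h0 _ hm rm])
            (auto simp: f_def)
        also have "\<dots> \<le> ennreal ((2 / h) ^ r * (1 / (1 + norm x) ^ (p + 2)))"
          by (intro ennreal_leI laplace_weight_le h0 h2) (auto simp: r_def)
        also have "\<dots> = ennreal ((2 / h) ^ r) * ennreal (1 / (1 + norm x) ^ (p + 2))"
          using h0 by (intro ennreal_mult') simp
        finally show "(\<integral>\<^sup>+\<omega>. \<Phi> x \<omega> \<partial>M) \<le> ennreal ((2 / h) ^ r) * ennreal (1 / (1 + norm x) ^ (p + 2))" .
      qed
      also have "\<dots> = ennreal ((2 / h) ^ r) * ennreal H"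
        unfolding H(1)[symmetric] by (rule nn_integral_cmult) measurable
      also have "\<dots> = ennreal ((2 / h) ^ r * H)"
        using h0 by (intro ennreal_mult'[symmetric]) simp
      finally show ?thesis .
    qed
    have L: "(\<integral>\<^sup>+\<omega>. ennreal ((1 + norm (?G \<omega>)) ^ p) \<partial>M) \<le> ennreal (2 ^ p * ((1 + norm S) ^ p + 1))"
    proof -
      have ip: "integrable M (\<lambda>\<omega>. f n \<omega> ^ p)"
        unfolding f_def by (rule gram_deviation_moment(1)) (rule B)
      have "(\<integral>\<^sup>+\<omega>. ennreal ((1 + norm (?G \<omega>)) ^ p) \<partial>M) \<le> (\<integral>\<^sup>+\<omega>. ennreal (2 ^ p * ((1 + norm S) ^ p + f n \<omega> ^ p)) \<partial>M)"
      proof (intro nn_integral_mono ennreal_leI)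
        fix \<omega>
        have "(1 + norm (?G \<omega>)) ^ p \<le> ((1 + norm S) + f n \<omega>) ^ p"
          unfolding f_def by (intro power_mono) (use norm_triangle_sub[of "?G \<omega>" S] in auto)
        also have "\<dots> \<le> 2 ^ p * ((1 + norm S) ^ p + f n \<omega> ^ p)"
          by (intro power_add_le_two_power) (auto simp: f_def)
        finally show "(1 + norm (?G \<omega>)) ^ p \<le> 2 ^ p * ((1 + norm S) ^ p + f n \<omega> ^ p)" .
      qed
      also have "\<dots> = ennreal (expectation (\<lambda>\<omega>. 2 ^ p * ((1 + norm S) ^ p + f n \<omega> ^ p)))"
        using ip by (intro nn_integral_eq_integral) (auto simp: f_def)
      also have "expectation (\<lambda>\<omega>. 2 ^ p * ((1 + norm S) ^ p + f n \<omega> ^ p)) = 2 ^ p * ((1 + norm S) ^ p + expectation (\<lambda>\<omega>. f n \<omega> ^ p))"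
        using ip by (simp add: prob_space)
      also have "ennreal \<dots> \<le> ennreal (2 ^ p * ((1 + norm S) ^ p + 1))"
        using elim by (intro ennreal_leI mult_left_mono) auto
      finally show ?thesis .
    qed
    have "(\<integral>\<^sup>+\<omega>. inverse_dominator b n (\<lambda>i j. B n i j \<omega>) \<partial>M)
       = (\<integral>\<^sup>+\<omega>. (ennreal (4 ^ b) + ennreal K * (\<integral>\<^sup>+x. \<Phi> x \<omega> \<partial>lborel)) + ennreal ((1 + norm (?G \<omega>)) ^ p) \<partial>M)"
      by (simp add: inverse_dominator_def \<Phi>_def K_def a_def p_def)
    also have "\<dots> = ennreal (4 ^ b) + ennreal K * (\<integral>\<^sup>+\<omega>. (\<integral>\<^sup>+x. \<Phi> x \<omega> \<partial>lborel) \<partial>M)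
        + (\<integral>\<^sup>+\<omega>. ennreal ((1 + norm (?G \<omega>)) ^ p) \<partial>M)"
      using \<Phi>m' by (simp add: nn_integral_add nn_integral_cmult emeasure_space_1)
    also have "\<dots> \<le> ennreal (4 ^ b) + ennreal K * ennreal ((2 / h) ^ r * H) + ennreal (2 ^ p * ((1 + norm S) ^ p + 1))"
      by (intro add_mono mult_left_mono I L) auto
    also have "\<dots> = ennreal C"
      using K0 H(2) h0 by (simp add: C_def ennreal_mult'[symmetric] ennreal_plus[symmetric] del: ennreal_plus)
    finally show ?case .
  qed
  moreover have "C > 0"
    unfolding C_def using K0 H(2) h0 by (intro add_pos_nonneg mult_nonneg_nonneg add_nonneg_nonneg) auto
  ultimately show thesis using that by blast
qed

end

text \<open>Singular Gram matrices receive the value infinity in the determinant integral, so the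
  bound includes almost sure invertibility for large n. In the second claim the value of
  \<open>matrix_inv\<close> at a singular matrix does no harm, since the dominator is infinite
  there.\<close>

theorem theorem2p6:
  fixes M :: "'a measure"
    and N :: "nat \<Rightarrow> 'a \<Rightarrow> real"
    and B :: "nat \<Rightarrow> nat \<Rightarrow> 'p::finite \<Rightarrow> 'a \<Rightarrow> real"
    and \<Sigma> :: "real^'p^'p"
  assumes "prob_space M"
    and "prob_space.indep_vars M (\<lambda>_. borel) N UNIV"
    and "\<And>i. distributed M lborel (N i) std_normal_density"
    and "\<And>n i j. i < n \<Longrightarrow> B n i j \<in> first_wiener_chaos M N"
    and "invertible \<Sigma>"
    and "\<And>\<epsilon>. \<epsilon> > 0 \<Longrightarrow>
           (\<lambda>n. measure M {\<omega> \<in> space M. norm (gram_matrix n (\<lambda>i j. B n i j \<omega>) - \<Sigma>) > \<epsilon>})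
             \<longlonglongrightarrow> 0"
  shows "(\<forall>q::real. q \<ge> 1 \<longrightarrow>
            (\<exists>N0::nat. \<exists>C::real. C > 0 \<and>
               (\<forall>n\<ge>N0. (\<integral>\<^sup>+\<omega>. (let d = det (gram_matrix n (\<lambda>i j. B n i j \<omega>)) in
                                   if d = 0 then \<infinity> else ennreal (d powr (- q))) \<partial>M)
                         \<le> ennreal C)))
       \<and> (\<forall>q::real. q \<ge> 1 \<longrightarrow>
            (\<lambda>n. \<integral>\<^sup>+\<omega>. ennreal (norm (matrix_inv (gram_matrix n (\<lambda>i j. B n i j \<omega>))
                                         - matrix_inv \<Sigma>) powr q) \<partial>M) \<longlonglongrightarrow> 0)"
proof -
  interpret gaussian_sequence M N
    using assms(1-3) by (simp add: gaussian_sequence_def gaussian_sequence_axioms_def)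
  note B = assms(4) and S = assms(5) and conv = assms(6)
  let ?G = "\<lambda>n \<omega>. gram_matrix n (\<lambda>i j. B n i j \<omega>)"
  let ?D = "\<lambda>b n \<omega>. inverse_dominator b n (\<lambda>i j. B n i j \<omega>)"
  define p where "p = real (CARD('p))"
  have p1: "p \<ge> 1" by (simp add: p_def Suc_leI)
  \<comment> \<open>An event of probability below 1 misses some outcome, and the Gram matrix at that
    outcome is within \<epsilon> of \<Sigma>.\<close>
  have approx: "\<exists>n b. norm (gram_matrix n b - \<Sigma>) \<le> \<epsilon>" if "\<epsilon> > 0" for \<epsilon>
  proof -
    have "\<forall>\<^sub>F n in sequentially. prob {\<omega> \<in> space M. norm (?G n \<omega> - \<Sigma>) > \<epsilon>} < 1"
      using conv[OF that] by (intro order_tendstoD) auto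
    then obtain n where n: "prob {\<omega> \<in> space M. norm (?G n \<omega> - \<Sigma>) > \<epsilon>} < 1"
      by (auto simp: eventually_sequentially)
    have "{\<omega> \<in> space M. norm (?G n \<omega> - \<Sigma>) > \<epsilon>} \<noteq> space M"
      using n prob_space by auto
    then obtain \<omega> where "\<not> norm (?G n \<omega> - \<Sigma>) > \<epsilon>" by auto
    then show ?thesis by (meson not_less)
  qed
  obtain c where c: "c > 0" "\<And>x. c * (norm x)\<^sup>2 \<le> inner x (\<Sigma> *v x)"
    by (rule gram_limit_coercive[OF S approx]) auto
  have first: "\<exists>N0 C. C > 0 \<and> (\<forall>n\<ge>N0. (\<integral>\<^sup>+\<omega>. (let d = det (?G n \<omega>) in
       if d = 0 then \<infinity> else ennreal (d powr (- q))) \<partial>M) \<le> ennreal C)" if q: "q \<ge> 1" for q :: real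
  proof -
    \<comment> \<open>The determinant costs \<open>\<kappa>\<close> to the power p q, which is
      \<open>w powr (p * q / b)\<close>; as w \<ge> 1, b \<ge> p q makes this at most w.\<close>
    define b where "b = nat \<lceil>p * q\<rceil>"
    have pq: "p * q \<ge> 1" using p1 q mult_mono[of 1 p 1 q] by simp
    then have b0: "b > 0" and bpq: "p * q \<le> real b" unfolding b_def by linarith+
    obtain C where C: "C > 0" and bd: "\<forall>\<^sub>F n in sequentially. (\<integral>\<^sup>+\<omega>. ?D b n \<omega> \<partial>M) \<le> ennreal C"
      by (rule nn_integral_inverse_dominator_bounded[OF B conv c]) auto
    obtain N0 where N0: "\<And>n. n \<ge> N0 \<Longrightarrow> (\<integral>\<^sup>+\<omega>. ?D b n \<omega> \<partial>M) \<le> ennreal C"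
      using bd by (auto simp: eventually_sequentially)
    define F :: real where "F = fact (CARD('p)) powr q"
    have F0: "F > 0" by (simp add: F_def)
    have pw: "(let d = det (?G n \<omega>) in if d = 0 then \<infinity> else ennreal (d powr (- q))) \<le> ennreal F * ?D b n \<omega>" for n \<omega>
    proof (cases "?D b n \<omega>")
      case (real w)
      note co = inverse_dominator_coercive[OF b0 real(2,1)]
      define \<kappa> where "\<kappa> = w powr (1 / real b)"
      have \<kappa>: "\<kappa> > 0" using co(1) by (simp add: \<kappa>_def)
      define d where "d = det (?G n \<omega>)"
      note det = coercive_imp_det_bound[OF \<kappa> co(2)[folded \<kappa>_def], folded d_def]
      \<comment> \<open>The logarithm behind \<open>powr\<close> is even, so the sign of the
        determinant is immaterial.\<close>
      have "d powr (- q) = \<bar>d\<bar> powr (- q)"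
        by (simp add: powr_def abs_if ln_minus)
      also have "\<dots> = (1 / \<bar>d\<bar>) powr q"
        by (simp add: powr_minus powr_divide inverse_eq_divide)
      also have "\<dots> \<le> (fact (CARD('p)) * \<kappa> ^ CARD('p)) powr q"
        using det(2) q by (intro powr_mono2) auto
      also have "\<dots> = F * w powr (p * q / real b)"
        using \<kappa> co(1) by (simp add: F_def powr_mult \<kappa>_def p_def powr_realpow[symmetric] powr_powr)
      also have "\<dots> \<le> F * w powr 1"
        using F0 co(1) bpq b0 by (intro mult_left_mono powr_mono) auto
      finally have "d powr (- q) \<le> F * w" using co(1) by simp
      then have "ennreal (d powr (- q)) \<le> ennreal (F * w)" by (rule ennreal_leI)
      then show ?thesis
        using det(1) F0 real by (simp add: d_def[symmetric] ennreal_mult')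
    qed (use F0 in \<open>simp add: ennreal_mult_top\<close>)
    show ?thesis
    proof (intro exI conjI allI impI)
      show "F * C > 0" using F0 C by simp
      fix n assume n: "n \<ge> N0"
      have Dm: "?D b n \<in> borel_measurable M"
        by (rule inverse_dominator_measurable) (intro chaos_measurable B)
      have "(\<integral>\<^sup>+\<omega>. (let d = det (?G n \<omega>) in if d = 0 then \<infinity> else ennreal (d powr (- q))) \<partial>M)
          \<le> (\<integral>\<^sup>+\<omega>. ennreal F * ?D b n \<omega> \<partial>M)"
        by (intro nn_integral_mono pw)
      also have "\<dots> = ennreal F * (\<integral>\<^sup>+\<omega>. ?D b n \<omega> \<partial>M)"
        by (rule nn_integral_cmult[OF Dm])
      also have "\<dots> \<le> ennreal F * ennreal C"
        using N0[OF n] by (intro mult_left_mono) auto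
      also have "\<dots> = ennreal (F * C)" using F0 by (simp add: ennreal_mult')
      finally show "(\<integral>\<^sup>+\<omega>. (let d = det (?G n \<omega>) in if d = 0 then \<infinity> else ennreal (d powr (- q))) \<partial>M) \<le> ennreal (F * C)" .
    qed
  qed
  have second: "(\<lambda>n. \<integral>\<^sup>+\<omega>. ennreal (norm (matrix_inv (?G n \<omega>) - matrix_inv \<Sigma>) powr q) \<partial>M) \<longlonglongrightarrow> 0"
    if q: "q \<ge> 1" for q :: real
  proof -
    \<comment> \<open>Young's inequality squares the factor \<open>\<kappa> powr q\<close>, hence
      2q: with b \<ge> 2q the square is at most w.\<close>
    define b where "b = nat \<lceil>2 * q\<rceil>"
    have b0: "b > 0" and b2q: "2 * q \<le> real b" unfolding b_def using q by linarith+
    obtain C where C: "C > 0" and bd: "\<forall>\<^sub>F n in sequentially. (\<integral>\<^sup>+\<omega>. ?D b n \<omega> \<partial>M) \<le> ennreal C"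
      by (rule nn_integral_inverse_dominator_bounded[OF B conv c]) auto
    define f where "f n \<omega> = norm (?G n \<omega> - \<Sigma>)" for n \<omega>
    define \<gamma> where "\<gamma> = p\<^sup>2 * norm (matrix_inv \<Sigma>) + 1"
    define F where "F = \<gamma> powr q"
    have \<gamma>0: "\<gamma> > 0" by (simp add: \<gamma>_def add_nonneg_pos)
    then have F0: "F > 0" by (simp add: F_def)
    have fk: "integrable M (\<lambda>\<omega>. f n \<omega> ^ k)" for n k
      unfolding f_def by (rule gram_deviation_moment(1)) (rule B)
    have fm: "f n \<in> borel_measurable M" for n
      using fk[of n 1] by simp
    \<comment> \<open>The free parameter \<eta> weights the dominator, whose mean is only bounded;
      for fixed \<eta> the deviation term tends to 0.\<close>
    have pw: "ennreal (norm (matrix_inv (?G n \<omega>) - matrix_inv \<Sigma>) powr q)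
       \<le> ennreal (F * \<eta>) * ?D b n \<omega> + ennreal (F / (4 * \<eta>) * (f n \<omega> ^ 1 + f n \<omega> ^ b))" if \<eta>: "\<eta> > 0" for \<eta> n \<omega>
    proof (cases "?D b n \<omega>")
      case (real w)
      note co = inverse_dominator_coercive[OF b0 real(2,1)]
      define \<kappa> where "\<kappa> = w powr (1 / real b)"
      have \<kappa>: "\<kappa> > 0" using co(1) by (simp add: \<kappa>_def)
      define t where "t = f n \<omega>"
      have t0: "t \<ge> 0" by (simp add: t_def f_def)
      have "norm (matrix_inv (?G n \<omega>) - matrix_inv \<Sigma>) \<le> p\<^sup>2 * norm (matrix_inv \<Sigma>) * (\<kappa> * t)"
        using coercive_imp_inverse_diff_bound[OF \<kappa> co(2)[folded \<kappa>_def] S] by (simp add: p_def t_def f_def)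
      also have "\<dots> \<le> \<gamma> * (\<kappa> * t)"
        using \<kappa> t0 by (intro mult_right_mono) (auto simp: \<gamma>_def)
      finally have "norm (matrix_inv (?G n \<omega>) - matrix_inv \<Sigma>) powr q \<le> (\<gamma> * (\<kappa> * t)) powr q"
        using q by (intro powr_mono2) auto
      also have "\<dots> = F * (\<kappa> powr q * t powr q)"
        using \<gamma>0 \<kappa> t0 by (simp add: F_def powr_mult)
      also have "\<dots> \<le> F * (\<eta> * w + 1 / (4 * \<eta>) * (t ^ 1 + t ^ b))"
      proof (intro mult_left_mono)
        have sq: "x * y \<le> \<eta> * x\<^sup>2 + 1 / (4 * \<eta>) * y\<^sup>2" for x y :: real
        proof -
          have "0 \<le> \<eta> * (x - y / (2 * \<eta>))\<^sup>2" using \<eta> by simp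
          also have "\<dots> = \<eta> * x\<^sup>2 - x * y + 1 / (4 * \<eta>) * y\<^sup>2"
            using \<eta> by (simp add: power2_eq_square field_simps)
          finally show ?thesis by simp
        qed
        have "(\<kappa> powr q)\<^sup>2 = w powr (2 * q / real b)"
          using co(1) by (simp add: \<kappa>_def powr_powr powr_power mult_ac)
        also have "\<dots> \<le> w powr 1"
          using co(1) b2q b0 by (intro powr_mono) auto
        finally have 1: "(\<kappa> powr q)\<^sup>2 \<le> w" using co(1) by simp
        \<comment> \<open>The real power is replaced by integer ones, for which deviation moments
          are known: the first power dominates for t \<le> 1, the b-th for t > 1.\<close>
        have 2: "(t powr q)\<^sup>2 \<le> t ^ 1 + t ^ b"
        proof (cases "t \<le> 1")
          case True
          have "(t powr q)\<^sup>2 \<le> t powr 1"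
          proof (cases "t = 0")
            case False
            then have "(t powr q)\<^sup>2 = t powr (2 * q)"
              using t0 by (simp add: powr_power mult_ac)
            also have "\<dots> \<le> t powr 1"
              using True t0 q by (intro powr_mono') auto
            finally show ?thesis .
          qed simp
          then show ?thesis using t0 by (simp add: add_increasing2)
        next
          case False
          then have "(t powr q)\<^sup>2 = t powr (2 * q)"
            by (simp add: powr_power mult_ac)
          also have "\<dots> \<le> t powr real b"
            using False b2q by (intro powr_mono) auto
          also have "\<dots> = t ^ b" using False by (simp add: powr_realpow)
          finally show ?thesis using t0 by simp
        qed
        have "\<kappa> powr q * t powr q \<le> \<eta> * (\<kappa> powr q)\<^sup>2 + 1 / (4 * \<eta>) * (t powr q)\<^sup>2" by (rule sq)
        also have "\<dots> \<le> \<eta> * w + 1 / (4 * \<eta>) * (t ^ 1 + t ^ b)"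
          using \<eta> 1 2 by (intro add_mono mult_left_mono) auto
        finally show "\<kappa> powr q * t powr q \<le> \<eta> * w + 1 / (4 * \<eta>) * (t ^ 1 + t ^ b)" .
      qed (use F0 in simp)
      finally have "norm (matrix_inv (?G n \<omega>) - matrix_inv \<Sigma>) powr q \<le> F * \<eta> * w + F / (4 * \<eta>) * (t ^ 1 + t ^ b)"
        by (simp add: distrib_left mult.assoc)
      then have "ennreal (norm (matrix_inv (?G n \<omega>) - matrix_inv \<Sigma>) powr q) \<le> ennreal (F * \<eta> * w + F / (4 * \<eta>) * (t ^ 1 + t ^ b))"
        by (rule ennreal_leI)
      also have "\<dots> = ennreal (F * \<eta>) * ennreal w + ennreal (F / (4 * \<eta>) * (t ^ 1 + t ^ b))"
        using F0 \<eta> t0 real(1) by (subst ennreal_plus) (auto simp: ennreal_mult')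
      finally show ?thesis using real(2) by (simp only: t_def)
    qed (use F0 \<eta> in \<open>simp add: ennreal_mult_top\<close>)
    have bound: "(\<integral>\<^sup>+\<omega>. ennreal (norm (matrix_inv (?G n \<omega>) - matrix_inv \<Sigma>) powr q) \<partial>M)
       \<le> ennreal (F * \<eta>) * (\<integral>\<^sup>+\<omega>. ?D b n \<omega> \<partial>M)
         + ennreal (F / (4 * \<eta>) * (expectation (\<lambda>\<omega>. f n \<omega> ^ 1) + expectation (\<lambda>\<omega>. f n \<omega> ^ b)))" if \<eta>: "\<eta> > 0" for \<eta> n
    proof -
      have Dm: "?D b n \<in> borel_measurable M"
        by (rule inverse_dominator_measurable) (intro chaos_measurable B)
      have f0: "f n \<omega> \<ge> 0" for \<omega> by (simp add: f_def)
      have "(\<integral>\<^sup>+\<omega>. ennreal (norm (matrix_inv (?G n \<omega>) - matrix_inv \<Sigma>) powr q) \<partial>M)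
        \<le> (\<integral>\<^sup>+\<omega>. ennreal (F * \<eta>) * ?D b n \<omega> + ennreal (F / (4 * \<eta>) * (f n \<omega> ^ 1 + f n \<omega> ^ b)) \<partial>M)"
        by (intro nn_integral_mono pw \<eta>)
      also have "\<dots> = ennreal (F * \<eta>) * (\<integral>\<^sup>+\<omega>. ?D b n \<omega> \<partial>M) + (\<integral>\<^sup>+\<omega>. ennreal (F / (4 * \<eta>) * (f n \<omega> ^ 1 + f n \<omega> ^ b)) \<partial>M)"
        using Dm fm[of n] by (subst nn_integral_add) (auto simp: nn_integral_cmult)
      also have "(\<integral>\<^sup>+\<omega>. ennreal (F / (4 * \<eta>) * (f n \<omega> ^ 1 + f n \<omega> ^ b)) \<partial>M)
          = ennreal (expectation (\<lambda>\<omega>. F / (4 * \<eta>) * (f n \<omega> ^ 1 + f n \<omega> ^ b)))"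
        using F0 \<eta> f0
        by (intro nn_integral_eq_integral integrable_mult_right Bochner_Integration.integrable_add fk AE_I2)
          (auto intro!: mult_nonneg_nonneg add_nonneg_nonneg)
      also have "expectation (\<lambda>\<omega>. F / (4 * \<eta>) * (f n \<omega> ^ 1 + f n \<omega> ^ b))
          = F / (4 * \<eta>) * (expectation (\<lambda>\<omega>. f n \<omega> ^ 1) + expectation (\<lambda>\<omega>. f n \<omega> ^ b))"
        using fk[of n 1] fk[of n b] by simp
      finally show ?thesis .
    qed
    have dev: "(\<lambda>n. expectation (\<lambda>\<omega>. f n \<omega> ^ k)) \<longlonglongrightarrow> 0" if "k > 0" for k
      unfolding f_def by (intro gram_deviation_moment_tendsto_zero B conv that)
    have small: "\<forall>\<^sub>F n in sequentially. (\<integral>\<^sup>+\<omega>. ennreal (norm (matrix_inv (?G n \<omega>) - matrix_inv \<Sigma>) powr q) \<partial>M) \<le> ennreal e"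
      if e: "e > 0" for e
    proof -
      \<comment> \<open>Makes \<open>F * \<eta> * C\<close> equal to e/2, leaving e/2 for the
        deviation term.\<close>
      define \<eta> where "\<eta> = e / (2 * F * C)"
      have \<eta>: "\<eta> > 0" using e F0 C by (simp add: \<eta>_def)
      have "(\<lambda>n. F / (4 * \<eta>) * (expectation (\<lambda>\<omega>. f n \<omega> ^ 1) + expectation (\<lambda>\<omega>. f n \<omega> ^ b))) \<longlonglongrightarrow> F / (4 * \<eta>) * (0 + 0)"
        using b0 by (intro tendsto_mult tendsto_add tendsto_const dev) auto
      then have "\<forall>\<^sub>F n in sequentially. F / (4 * \<eta>) * (expectation (\<lambda>\<omega>. f n \<omega> ^ 1) + expectation (\<lambda>\<omega>. f n \<omega> ^ b)) < e / 2"
        using e by (intro order_tendstoD) auto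
      with bd show ?thesis
      proof eventually_elim
        case (elim n)
        have "(\<integral>\<^sup>+\<omega>. ennreal (norm (matrix_inv (?G n \<omega>) - matrix_inv \<Sigma>) powr q) \<partial>M)
          \<le> ennreal (F * \<eta>) * ennreal C + ennreal (e / 2)"
          by (rule order_trans[OF bound[OF \<eta>]]) (use elim in \<open>intro add_mono mult_left_mono ennreal_leI, auto\<close>)
        also have "\<dots> = ennreal (F * \<eta> * C + e / 2)"
          using F0 \<eta> C e by (simp add: ennreal_mult'[symmetric] ennreal_plus[symmetric] del: ennreal_plus)
        also have "F * \<eta> * C + e / 2 = e"
          using F0 C by (simp add: \<eta>_def field_simps)
        finally show ?case .
      qed
    qed
    show ?thesis
    proof (rule order_tendstoI)
      fix x :: ennreal assume "0 < x"
      \<comment> \<open>A value strictly below x is finite even when x is infinite, and the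
        non-strict bound by it gives the strict one.\<close>
      then obtain y where y: "0 < y" "y < x" using dense by blast
      then obtain e where e: "y = ennreal e" "e \<ge> 0" by (cases y) auto
      with y have "e > 0" by (simp add: ennreal_less_zero_iff)
      from small[OF this] show "\<forall>\<^sub>F n in sequentially. (\<integral>\<^sup>+\<omega>. ennreal (norm (matrix_inv (?G n \<omega>) - matrix_inv \<Sigma>) powr q) \<partial>M) < x"
        by (rule eventually_mono) (use e y in auto)
    qed simp
  qed
  show ?thesis using first second by blast
qed

end
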